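(* Let $T:\Lambda\to\Lambda$ be a nonuniformly expanding map with return time $\tau\in L^p(\mu_Y)$ for some $p\ge1$, let $v:\Lambda\to\mathbb{R}^d$ be Hölder (with exponent $\eta$) with $\int_\Lambda v\,d\mu=0$, let $\phi=v\circ\pi_\Delta:\Delta\to\mathbb{R}^d$, and let $\chi,m:\Delta\to\mathbb{R}^d$ be the functions constructed from $v$ in the context. Then $$\phi=m+\chi\circ f-\chi\qquad\text{and}\qquad m\in\ker L .$$
   Context: Nonuniformly expanding map. Let $(\Lambda,d_\Lambda)$ be a bounded metric space with finite Borel measure $\rho$, and let $T:\Lambda\to\Lambda$ be a nonsingular transformation. Let $Y\subset\Lambda$ have positive measure and let $\alpha$ be an at most countable measurable partition of $Y$ with $\rho(a)>0$ for all $a\in\alpha$. $T$ is called nonuniformly expanding if there are an integrable return time $\tau:Y\to\mathbb{Z}^+$ (with $T^{\tau(y)}y\in Y$; not necessarily the first return time), constant on each $a\in\alpha$ with value $\tau(a)\ge1$, and constants $\lambda>1$, $\eta\in(0,1]$, $C_0,C_1\ge1$ such that for each $a\in\alpha$: (1) $F=T^\tau$ restricts to a (measure-theoretic) bijection from $a$ onto $Y$; (2) $d_\Lambda(Fx,Fy)\ge\lambda d_\Lambda(x,y)$ for all $x,y\in a$; (3) $d_\Lambda(T^\ell x,T^\ell y)\le C_0d_\Lambda(Fx,Fy)$ for all $x,y\in a$, $0\le\ell<\tau(a)$; (4) $\zeta_0=\frac{d\rho|_Y}{d\rho|_Y\circ F}$ satisfies $|\log\zeta_0(x)-\log\zeta_0(y)|\le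 C_1d_\Lambda(Fx,Fy)^\eta$ for all $x,y\in a$. The map $F:Y\to Y$ has a unique absolutely continuous invariant probability measure $\mu_Y$, and $d\mu_Y/d\rho\in L^\infty$. Young tower. $\Delta=\{(y,\ell)\in Y\times\mathbb{Z}:0\le\ell\le\tau(y)-1\}$, $f:\Delta\to\Delta$, $f(y,\ell)=(y,\ell+1)$ if $\ell\le\tau(y)-2$ and $f(y,\tau(y)-1)=(Fy,0)$; $\pi_\Delta:\Delta\to\Lambda$, $\pi_\Delta(y,\ell)=T^\ell y$ (so $\pi_\Delta\circ f=T\circ\pi_\Delta$); $\mu_\Delta=(\mu_Y\times\text{counting})/\int_Y\tau\,d\mu_Y$ is an ergodic $f$-invariant probability measure and $\mu=(\pi_\Delta)_*\mu_\Delta$ is an absolutely continuous ergodic $T$-invariant probability measure. Transfer operators. $L:L^1(\Delta)\to L^1(\Delta)$ and $P:L^1(Y)\to L^1(Y)$ are the transfer operators of $f$ and $F$: $\int_\Delta Lv\,w\,d\mu_\Delta=\int_\Delta v\,w\circ f\,d\mu_\Delta$ for $w\in L^\infty(\Delta)$ and $\int_Y Pv\,w\,d\mu_Y=\int_Y v\,w\circ F\,d\mu_Y$ for $w\in L^\infty(Y)$ (acting componentwise on vector-valued functions). Construction. Define $\phi':Y\to\mathbb{R}^d$, $\phi'(y)=\sum_{\ell=0}^{\tau(y)-1}\phi(y,\ell)$; $\chi'=\sum_{k=1}^\infty P^k\phi'$ (this series converges in the Hölder norm on $Y$); $m'=\phi'-\chi'\circ F+\chi'$. Define $\chi(y,\ell)=\chi'(y)+\sum_{k=0}^{\ell-1}\phi(y,k)$,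 and $m(y,\ell)=0$ if $\ell\le\tau(y)-2$, $m(y,\tau(y)-1)=m'(y)$. *)

theory Defs
  imports "HOL-Probability.Probability"
begin

section \<open>Hoelder norm\<close>

text \<open>The norm takes the value \<open>\<infinity>\<close> exactly on the functions that are not bounded and Hoelder with
  exponent \<open>\<eta>\<close> on \<open>S\<close>.  Pairs with \<open>x = y\<close> contribute \<open>0 / 0 = 0\<close>.\<close>

definition holder_norm ::
    "real \<Rightarrow> 'a::metric_space set \<Rightarrow> ('a \<Rightarrow> 'b::real_normed_vector) \<Rightarrow> ennreal" where
  "holder_norm \<eta> S g =
     (SUP x\<in>S. ennreal (norm (g x))) +
     (SUP (x, y)\<in>S \<times> S. ennreal (norm (g x - g y) / dist x y powr \<eta>))"

text \<open>\<open>X\<close> is the sum of \<open>\<Sum>k. u k\<close>, with convergence in the Hoelder norm on \<open>S\<close>.  The terms \<open>u k\<close> are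
  elements of \<open>L\<^sup>1(M)\<close>, given by arbitrary representatives, so the norm is evaluated on Hoelder
  representatives \<open>g k\<close> of them.\<close>

definition holder_sums ::
    "'a::metric_space measure \<Rightarrow> real \<Rightarrow> 'a set \<Rightarrow> (nat \<Rightarrow> 'a \<Rightarrow> 'b::euclidean_space) \<Rightarrow> ('a \<Rightarrow> 'b) \<Rightarrow> bool" where
  "holder_sums M \<eta> S u X \<longleftrightarrow>
     (\<exists>g. (\<forall>k. holder_norm \<eta> S (g k) < \<infinity> \<and> (AE y in M. g k y = u k y)) \<and>
          (\<lambda>n. holder_norm \<eta> S (\<lambda>y. (\<Sum>k<n. g k y) - X y)) \<longlonglongrightarrow> 0)"


section \<open>Transfer operators\<close>

definition ess_bounded :: "'s measure \<Rightarrow> ('s \<Rightarrow> real) \<Rightarrow> bool" where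
  "ess_bounded M w \<longleftrightarrow> w \<in> borel_measurable M \<and> (\<exists>B. AE x in M. \<bar>w x\<bar> \<le> B)"

text \<open>A representative of the image of \<open>v\<close> under the transfer operator; it is determined up to
  \<open>M\<close>-null sets.  For vector-valued \<open>v\<close> and scalar \<open>w\<close> the duality relation is the componentwise
  one.\<close>

definition transfer ::
    "'s measure \<Rightarrow> ('s \<Rightarrow> 's) \<Rightarrow> ('s \<Rightarrow> 'b::euclidean_space) \<Rightarrow> 's \<Rightarrow> 'b" where
  "transfer M g v =
     (SOME u. integrable M u \<and>
        (\<forall>w. ess_bounded M w \<longrightarrow> (\<integral>x. w x *\<^sub>R u x \<partial>M) = (\<integral>x. w (g x) *\<^sub>R v x \<partial>M)))"

definition in_transfer_kernel ::
    "'s measure \<Rightarrow> ('s \<Rightarrow> 's) \<Rightarrow> ('s \<Rightarrow> 'b::euclidean_space) \<Rightarrow> bool" where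
  "in_transfer_kernel M g v \<longleftrightarrow> integrable M v \<and> (AE x in M. transfer M g v x = 0)"


section \<open>Nonuniformly expanding maps\<close>

definition return_map :: "('a \<Rightarrow> 'a) \<Rightarrow> ('a \<Rightarrow> nat) \<Rightarrow> 'a \<Rightarrow> 'a" where
  "return_map T \<tau> y = (T ^^ \<tau> y) y"

text \<open>A measure-theoretic bijection from \<open>A\<close> onto \<open>B\<close>: bijective and measurable in both directions
  after removal of null sets.\<close>

definition bij_betw_mod_null :: "'a measure \<Rightarrow> ('a \<Rightarrow> 'a) \<Rightarrow> 'a set \<Rightarrow> 'a set \<Rightarrow> bool" where
  "bij_betw_mod_null M F A B \<longleftrightarrow>
     (\<exists>A' B'. A' \<subseteq> A \<and> B' \<subseteq> B \<and> A - A' \<in> null_sets M \<and> B - B' \<in> null_sets M \<and>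
        bij_betw F A' B' \<and>
        (\<forall>E\<in>sets M. E \<subseteq> A' \<longrightarrow> F ` E \<in> sets M) \<and>
        (\<forall>E\<in>sets M. E \<subseteq> B' \<longrightarrow> F -` E \<inter> A' \<in> sets M))"

text \<open>The measure \<open>\<rho>|\<^sub>Y \<circ> F\<close>, which is \<open>E \<mapsto> \<rho>(F(E))\<close> for \<open>E\<close> inside one element of the partition \<open>\<alpha>\<close>
  (where \<open>F\<close> is injective).  Images of measurable sets are only measurable up to null sets, whence
  the completion.\<close>

definition pullback_measure :: "'a measure \<Rightarrow> 'a set \<Rightarrow> 'a set set \<Rightarrow> ('a \<Rightarrow> 'a) \<Rightarrow> 'a measure" where
  "pullback_measure \<rho> Y \<alpha> F =
     measure_of Y (sets (restrict_space \<rho> Y))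
       (\<lambda>E. \<integral>\<^sup>+ a. emeasure (completion \<rho>) (F ` (E \<inter> a)) \<partial>count_space \<alpha>)"

text \<open>The space \<open>\<Lambda>\<close> is the whole type.  The function \<open>\<zeta>\<^sub>0\<close> is the version of the Radon-Nikodym
  derivative for which the distortion bound holds at all points; as its logarithm is taken,
  it is positive.\<close>

locale nonuniformly_expanding = finite_measure \<rho>
  for \<rho> :: "'a::metric_space measure" +
  fixes T :: "'a \<Rightarrow> 'a" and Y :: "'a set" and \<alpha> :: "'a set set" and \<tau> :: "'a \<Rightarrow> nat"
    and lam \<eta> C\<^sub>0 C\<^sub>1 :: real and \<zeta>\<^sub>0 :: "'a \<Rightarrow> real"
  assumes bounded_space: "bounded (UNIV :: 'a set)"
    and borel: "sets \<rho> = sets borel"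
    and T_measurable: "T \<in> measurable \<rho> \<rho>"
    and T_nonsingular: "\<And>N. N \<in> null_sets \<rho> \<Longrightarrow> T -` N \<in> null_sets \<rho>"
    and Y_measurable: "Y \<in> sets \<rho>"
    and Y_pos: "emeasure \<rho> Y > 0"
    and partition: "partition_on Y \<alpha>"
    and partition_countable: "countable \<alpha>"
    and partition_measurable: "\<alpha> \<subseteq> sets \<rho>"
    and partition_pos: "\<And>a. a \<in> \<alpha> \<Longrightarrow> emeasure \<rho> a > 0"
    and \<tau>_ge_1: "\<And>y. y \<in> Y \<Longrightarrow> \<tau> y \<ge> 1"
    and \<tau>_const: "\<And>a x y. a \<in> \<alpha> \<Longrightarrow> x \<in> a \<Longrightarrow> y \<in> a \<Longrightarrow> \<tau> x = \<tau> y"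
    and \<tau>_integrable: "integrable (restrict_space \<rho> Y) (\<lambda>y. real (\<tau> y))"
    and return_in_Y: "\<And>y. y \<in> Y \<Longrightarrow> return_map T \<tau> y \<in> Y"
    and lam_gt_1: "lam > 1"
    and \<eta>_range: "0 < \<eta>" "\<eta> \<le> 1"
    and C\<^sub>0_ge_1: "C\<^sub>0 \<ge> 1"
    and C\<^sub>1_ge_1: "C\<^sub>1 \<ge> 1"
    and full_branch: "\<And>a. a \<in> \<alpha> \<Longrightarrow> bij_betw_mod_null \<rho> (return_map T \<tau>) a Y"
    and expansion: "\<And>a x y. a \<in> \<alpha> \<Longrightarrow> x \<in> a \<Longrightarrow> y \<in> a \<Longrightarrow>
        dist (return_map T \<tau> x) (return_map T \<tau> y) \<ge> lam * dist x y"
    and intermediate: "\<And>a x y l. a \<in> \<alpha> \<Longrightarrow> x \<in> a \<Longrightarrow> y \<in> a \<Longrightarrow> l < \<tau> x \<Longrightarrow>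
        dist ((T ^^ l) x) ((T ^^ l) y) \<le> C\<^sub>0 * dist (return_map T \<tau> x) (return_map T \<tau> y)"
    and \<zeta>\<^sub>0_measurable: "\<zeta>\<^sub>0 \<in> borel_measurable (restrict_space \<rho> Y)"
    and \<zeta>\<^sub>0_pos: "\<And>y. y \<in> Y \<Longrightarrow> \<zeta>\<^sub>0 y > 0"
    and \<zeta>\<^sub>0_density:
        "density (pullback_measure \<rho> Y \<alpha> (return_map T \<tau>)) (\<lambda>y. ennreal (\<zeta>\<^sub>0 y)) = restrict_space \<rho> Y"
    and distortion: "\<And>a x y. a \<in> \<alpha> \<Longrightarrow> x \<in> a \<Longrightarrow> y \<in> a \<Longrightarrow>
        \<bar>ln (\<zeta>\<^sub>0 x) - ln (\<zeta>\<^sub>0 y)\<bar> \<le> C\<^sub>1 * dist (return_map T \<tau> x) (return_map T \<tau> y) powr \<eta>"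

definition ac_invariant_prob ::
    "'a measure \<Rightarrow> 'a set \<Rightarrow> ('a \<Rightarrow> 'a) \<Rightarrow> 'a measure \<Rightarrow> bool" where
  "ac_invariant_prob \<rho> Y F \<mu> \<longleftrightarrow>
     prob_space \<mu> \<and> sets \<mu> = sets (restrict_space \<rho> Y) \<and>
     absolutely_continuous (restrict_space \<rho> Y) \<mu> \<and> distr \<mu> \<mu> F = \<mu>"


section \<open>The Young tower\<close>

definition tower :: "'a set \<Rightarrow> ('a \<Rightarrow> nat) \<Rightarrow> ('a \<times> nat) set" where
  "tower Y \<tau> = {(y, l). y \<in> Y \<and> l < \<tau> y}"

text \<open>The condition \<open>l \<le> \<tau> y - 2\<close> is written without subtraction, which truncates on \<open>nat\<close>.\<close>

definition tower_map :: "('a \<Rightarrow> 'a) \<Rightarrow> ('a \<Rightarrow> nat) \<Rightarrow> 'a \<times> nat \<Rightarrow> 'a \<times> nat" where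
  "tower_map T \<tau> = (\<lambda>(y, l). if l + 2 \<le> \<tau> y then (y, l + 1) else (return_map T \<tau> y, 0))"

definition tower_proj :: "('a \<Rightarrow> 'a) \<Rightarrow> 'a \<times> nat \<Rightarrow> 'a" where
  "tower_proj T = (\<lambda>(y, l). (T ^^ l) y)"

definition tower_measure :: "'a set \<Rightarrow> ('a \<Rightarrow> nat) \<Rightarrow> 'a measure \<Rightarrow> ('a \<times> nat) measure" where
  "tower_measure Y \<tau> \<mu>Y =
     scale_measure (1 / (\<integral>\<^sup>+ y. of_nat (\<tau> y) \<partial>\<mu>Y))
       (restrict_space (\<mu>Y \<Otimes>\<^sub>M count_space UNIV) (tower Y \<tau>))"


section \<open>The martingale-coboundary construction\<close>

definition induced_obs :: "('a \<Rightarrow> nat) \<Rightarrow> ('a \<times> nat \<Rightarrow> 'b::euclidean_space) \<Rightarrow> 'a \<Rightarrow> 'b" where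
  "induced_obs \<tau> \<phi> y = (\<Sum>l<\<tau> y. \<phi> (y, l))"

text \<open>The sum \<open>\<Sum>k\<ge>1. P\<^sup>k \<phi>'\<close> in the Hoelder norm on \<open>Y\<close>.  As an element of \<open>L\<^sup>1\<close> it is unique; the
  choice is between Hoelder representatives.\<close>

definition base_chi ::
    "('a::metric_space \<Rightarrow> 'a) \<Rightarrow> 'a set \<Rightarrow> ('a \<Rightarrow> nat) \<Rightarrow> real \<Rightarrow> 'a measure \<Rightarrow>
     ('a \<times> nat \<Rightarrow> 'b::euclidean_space) \<Rightarrow> 'a \<Rightarrow> 'b" where
  "base_chi T Y \<tau> \<eta> \<mu>Y \<phi> =
     (SOME X. holder_sums \<mu>Y \<eta> Y
        (\<lambda>k. (transfer \<mu>Y (return_map T \<tau>) ^^ Suc k) (induced_obs \<tau> \<phi>)) X)"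

definition base_m ::
    "('a::metric_space \<Rightarrow> 'a) \<Rightarrow> 'a set \<Rightarrow> ('a \<Rightarrow> nat) \<Rightarrow> real \<Rightarrow> 'a measure \<Rightarrow>
     ('a \<times> nat \<Rightarrow> 'b::euclidean_space) \<Rightarrow> 'a \<Rightarrow> 'b" where
  "base_m T Y \<tau> \<eta> \<mu>Y \<phi> y =
     induced_obs \<tau> \<phi> y - base_chi T Y \<tau> \<eta> \<mu>Y \<phi> (return_map T \<tau> y) + base_chi T Y \<tau> \<eta> \<mu>Y \<phi> y"

definition tower_chi ::
    "('a::metric_space \<Rightarrow> 'a) \<Rightarrow> 'a set \<Rightarrow> ('a \<Rightarrow> nat) \<Rightarrow> real \<Rightarrow> 'a measure \<Rightarrow>
     ('a \<times> nat \<Rightarrow> 'b::euclidean_space) \<Rightarrow> 'a \<times> nat \<Rightarrow> 'b" where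
  "tower_chi T Y \<tau> \<eta> \<mu>Y \<phi> = (\<lambda>(y, l). base_chi T Y \<tau> \<eta> \<mu>Y \<phi> y + (\<Sum>k<l. \<phi> (y, k)))"

definition tower_m ::
    "('a::metric_space \<Rightarrow> 'a) \<Rightarrow> 'a set \<Rightarrow> ('a \<Rightarrow> nat) \<Rightarrow> real \<Rightarrow> 'a measure \<Rightarrow>
     ('a \<times> nat \<Rightarrow> 'b::euclidean_space) \<Rightarrow> 'a \<times> nat \<Rightarrow> 'b" where
  "tower_m T Y \<tau> \<eta> \<mu>Y \<phi> = (\<lambda>(y, l). if l + 2 \<le> \<tau> y then 0 else base_m T Y \<tau> \<eta> \<mu>Y \<phi> y)"

end

theory Submission
  imports Defs
begin

text \<open>The coboundary identity is a telescoping computation.  For \<open>m \<in> ker L\<close> one needs that the series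
  defining \<open>\<chi>'\<close> converges, since otherwise the choice of \<open>\<chi>'\<close> is void.

  On the inverse branches, the transfer operator \<open>Q\<close> of \<open>F\<close> with respect to \<open>\<rho>\<close> maps the cone of
  functions \<open>u > 0\<close> with \<open>u x \<le> exp (K d(x, y)\<^sup>\<eta>) u y\<close> into the cone with constant \<open>K - 1\<close> if \<open>K\<close> is
  large.  As cone elements are bounded below by a multiple of their integral, \<open>Q u\<close> splits into a
  constant and an element of the cone with constant \<open>K\<close> whose integral is smaller by a fixed factor.
  For \<open>u\<close> and \<open>u'\<close> with the same integral the constants cancel, so \<open>Q\<^sup>n u - Q\<^sup>n u'\<close> decays
  geometrically in the Hoelder norm.  By density of Lipschitz functions in \<open>L\<^sup>1\<close>, the density \<open>h\<close> of any
  invariant \<open>\<mu>\<^sub>Y\<close> is the \<open>L\<^sup>1\<close> limit of \<open>Q\<^sup>n 1\<close> (normalised) and thus has a version in the cone.  Finally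
  \<open>P\<^sup>k \<phi>' = Q\<^sup>k (h \<phi>') / h\<close>, and \<open>h \<phi>'\<close> is a difference of two functions of equal integral that \<open>Q\<close> maps
  into the cone.\<close>


section \<open>Essentially bounded multipliers, transfer operators and Hoelder series\<close>

text \<open>Null sets shape the argument. Inverse branches exist only off null sets, so pointwise
  estimates live on a set \<open>G\<close> of full measure that every inverse branch maps into
  itself. The Hoelder norm in \<open>base_chi\<close> is a supremum over all of \<open>Y\<close>, so
  the iterates are extended from \<open>G\<close>. \<open>transfer\<close> is a choice up to null
  sets, so its iterates are compared with an explicit formula. And \<open>\<mu>Y\<close> is an
  arbitrary absolutely continuous invariant probability, so regularity of its density must come from
  invariance alone.

  The return time may be unbounded, and then \<open>\<phi>'\<close> need be neither bounded nor
  Hoelder: on a partition element its size and Hoelder constant are of order \<tau>. This is why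
  positivity is reached by adding a multiple of \<tau> and not a constant: the relative oscillation
  on each branch is then uniformly bounded.

  \<open>Q\<close> acts on functions with values in \<open>ennreal\<close>, which frees sums over
  countably many branches from convergence questions; in exchange, subtraction is usable only once
  finiteness and an order relation are secured.\<close>

lemma indicator_ess_bounded: "A \<in> sets M \<Longrightarrow> ess_bounded M (indicator A)"
  unfolding ess_bounded_def by (auto intro!: exI[of _ 1] simp: indicator_def)

lemma ess_bounded_scaleR_integrable:
  fixes f :: "'s \<Rightarrow> 'b::euclidean_space"
  assumes "ess_bounded M w" "integrable M f"
  shows "integrable M (\<lambda>x. w x *\<^sub>R f x)"
proof -
  obtain B where w: "w \<in> borel_measurable M" "AE x in M. \<bar>w x\<bar> \<le> B"
    using assms(1) by (auto simp: ess_bounded_def)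
  show ?thesis
    by (rule Bochner_Integration.integrable_bound[of M "\<lambda>x. \<bar>B\<bar> *\<^sub>R f x"])
      (use assms(2) w in \<open>auto elim!: eventually_mono intro!: mult_right_mono\<close>)
qed

text \<open>Invariance carries the almost sure bound: the null set where \<open>w\<close> exceeds
  \<open>B\<close> has a null preimage under \<open>F\<close>.\<close>

lemma ess_bounded_comp:
  assumes F [measurable]: "F \<in> measurable M M" and inv: "distr M M F = M" and w: "ess_bounded M w"
  shows "ess_bounded M (\<lambda>x. w (F x))"
proof -
  have [measurable]: "w \<in> borel_measurable M" using w by (simp add: ess_bounded_def)
  obtain B where "AE x in M. \<bar>w x\<bar> \<le> B" using w by (auto simp: ess_bounded_def)
  then have "AE x in distr M M F. \<bar>w x\<bar> \<le> B" by (subst inv)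
  then have "AE x in M. \<bar>w (F x)\<bar> \<le> B" by (subst (asm) AE_distr_iff) auto
  then show ?thesis unfolding ess_bounded_def by auto
qed

text \<open>\<open>transfer\<close> is a choice and means nothing until its defining property is
  known to be satisfiable. Any integrable \<open>u\<close> with the duality relation is a witness,
  and testing against indicators shows that the chosen function agrees with \<open>u\<close> almost
  everywhere.\<close>

lemma transfer_eqI:
  fixes u v :: "'s \<Rightarrow> 'b::euclidean_space"
  assumes "finite_measure M" and u: "integrable M u"
    and dual: "\<And>w. ess_bounded M w \<Longrightarrow> (\<integral>x. w x *\<^sub>R u x \<partial>M) = (\<integral>x. w (g x) *\<^sub>R v x \<partial>M)"
  shows integrable_transfer: "integrable M (transfer M g v)"
    and transfer_dual: "\<And>w. ess_bounded M w \<Longrightarrow>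
        (\<integral>x. w x *\<^sub>R transfer M g v x \<partial>M) = (\<integral>x. w (g x) *\<^sub>R v x \<partial>M)"
    and AE_transfer: "AE x in M. transfer M g v x = u x"
proof -
  interpret finite_measure M by fact
  have *: "integrable M (transfer M g v) \<and> (\<forall>w. ess_bounded M w \<longrightarrow>
      (\<integral>x. w x *\<^sub>R transfer M g v x \<partial>M) = (\<integral>x. w (g x) *\<^sub>R v x \<partial>M))"
    unfolding transfer_def by (rule someI[of _ u]) (use u dual in blast)
  then show "integrable M (transfer M g v)"
    and "\<And>w. ess_bounded M w \<Longrightarrow>
        (\<integral>x. w x *\<^sub>R transfer M g v x \<partial>M) = (\<integral>x. w (g x) *\<^sub>R v x \<partial>M)" by auto
  show "AE x in M. transfer M g v x = u x"
  proof (rule density_unique_banach)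
    fix A assume "A \<in> sets M"
    then show "set_lebesgue_integral M A (transfer M g v) = set_lebesgue_integral M A u"
      using * dual indicator_ess_bounded[of A M] by (simp add: set_lebesgue_integral_def)
  qed (use * u in auto)
qed

section \<open>Hoelder norms and extension of Hoelder functions\<close>

lemma holder_norm_le:
  assumes "\<And>x. x \<in> S \<Longrightarrow> norm (g x) \<le> A"
    and "\<And>x y. x \<in> S \<Longrightarrow> y \<in> S \<Longrightarrow> norm (g x - g y) \<le> B * dist x y powr \<eta>"
    and "0 \<le> A" "0 \<le> B"
  shows "holder_norm \<eta> S g \<le> ennreal (A + B)"
proof -
  have "norm (g x - g y) / dist x y powr \<eta> \<le> B" if "x \<in> S" "y \<in> S" for x y
  \<comment> \<open>Where the denominator is 0, so is the quotient, and \<open>0 \<le> B\<close>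
    suffices.\<close>
  proof (cases "dist x y powr \<eta> = 0")
    case False
    then have "0 < dist x y powr \<eta>" by (metis powr_ge_zero less_eq_real_def)
    then show ?thesis using assms(2)[OF that] by (simp add: divide_le_eq)
  qed (use assms in simp)
  then have "holder_norm \<eta> S g \<le> ennreal A + ennreal B"
    unfolding holder_norm_def using assms
    by (intro add_mono SUP_least) (auto intro!: ennreal_leI)
  then show ?thesis using assms by simp
qed

lemma holder_normD:
  assumes "holder_norm \<eta> S g \<le> ennreal A" "0 \<le> A"
  shows holder_norm_bound: "\<And>x. x \<in> S \<Longrightarrow> norm (g x) \<le> A"
    and holder_norm_hoelder: "\<And>x y. x \<in> S \<Longrightarrow> y \<in> S \<Longrightarrow> norm (g x - g y) \<le> A * dist x y powr \<eta>"
proof -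
  fix x assume x: "x \<in> S"
  have "ennreal (norm (g x)) \<le> (SUP x\<in>S. ennreal (norm (g x)))" using x by (rule SUP_upper)
  also have "\<dots> \<le> holder_norm \<eta> S g" unfolding holder_norm_def by (rule add_increasing2) auto
  also note assms(1)
  finally show "norm (g x) \<le> A" using assms(2) by (simp add: ennreal_le_iff)
next
  fix x y assume xy: "x \<in> S" "y \<in> S"
  have "ennreal (norm (g x - g y) / dist x y powr \<eta>) \<le>
      (SUP (x, y)\<in>S \<times> S. ennreal (norm (g x - g y) / dist x y powr \<eta>))"
    using SUP_upper[of "(x, y)" "S \<times> S" "\<lambda>(x, y). ennreal (norm (g x - g y) / dist x y powr \<eta>)"] xy by simp
  also have "\<dots> \<le> holder_norm \<eta> S g" unfolding holder_norm_def by (rule add_increasing) auto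
  also note assms(1)
  finally have *: "norm (g x - g y) / dist x y powr \<eta> \<le> A" using assms(2) by (simp add: ennreal_le_iff)
  show "norm (g x - g y) \<le> A * dist x y powr \<eta>"
  proof (cases "x = y")
    case False
    then have "0 < dist x y powr \<eta>" by simp
    then show ?thesis using * by (simp add: divide_le_eq)
  qed simp
qed

text \<open>After division by \<open>a + b\<close> this is \<open>t \<le> t powr \<eta>\<close> on
  [0, 1]. It gives \<open>dist powr \<eta>\<close> the triangle inequality, on which the extension
  below rests.\<close>

lemma powr_subadditive:
  fixes a b :: real
  assumes "0 \<le> a" "0 \<le> b" "0 < \<eta>" "\<eta> \<le> 1"
  shows "(a + b) powr \<eta> \<le> a powr \<eta> + b powr \<eta>"
proof (cases "a + b = 0")
  case False
  then have ab: "0 < a + b" using assms by simp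
  have *: "t \<le> t powr \<eta>" if "0 \<le> t" "t \<le> 1" for t :: real
    using powr_mono'[of \<eta> 1 t] that assms by simp
  have "(a + b) powr \<eta> = (a + b) powr \<eta> * (a / (a + b) + b / (a + b))"
    using ab by (simp add: add_divide_distrib[symmetric])
  also have "\<dots> \<le> (a + b) powr \<eta> * ((a / (a + b)) powr \<eta> + (b / (a + b)) powr \<eta>)"
    using ab assms by (intro mult_left_mono add_mono *) auto
  also have "\<dots> = a powr \<eta> + b powr \<eta>"
    using ab assms by (simp add: powr_divide distrib_left)
  finally show ?thesis .
qed (use assms in simp)

lemma dist_powr_triangle:
  assumes "0 < \<eta>" "\<eta> \<le> (1::real)"
  shows "dist x y powr \<eta> \<le> dist x z powr \<eta> + dist z y powr \<eta>"
proof -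
  have "dist x y powr \<eta> \<le> (dist x z + dist z y) powr \<eta>"
    using assms by (intro powr_mono2 dist_triangle) auto
  also have "\<dots> \<le> dist x z powr \<eta> + dist z y powr \<eta>" using assms by (intro powr_subadditive) auto
  finally show ?thesis .
qed

text \<open>McShane's extension for the metric \<open>dist powr \<eta>\<close>.\<close>

lemma hoelder_extension_real:
  fixes f :: "'a::metric_space \<Rightarrow> real"
  assumes G: "G \<noteq> {}" and \<eta>: "0 < \<eta>" "\<eta> \<le> 1" and L: "0 \<le> L"
    and bound: "\<And>x. x \<in> G \<Longrightarrow> \<bar>f x\<bar> \<le> B"
    and f: "\<And>x y. x \<in> G \<Longrightarrow> y \<in> G \<Longrightarrow> \<bar>f x - f y\<bar> \<le> L * dist x y powr \<eta>"
  obtains g where "\<And>x. x \<in> G \<Longrightarrow> g x = f x" "\<And>x. \<bar>g x\<bar> \<le> B"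
    "\<And>x y. \<bar>g x - g y\<bar> \<le> L * dist x y powr \<eta>"
proof
  define e where "e x = (INF y\<in>G. f y + L * dist x y powr \<eta>)" for x
  \<comment> \<open>Clamping to [-B, B] is 1-Lipschitz and does not alter values on
    \<open>G\<close>; the infimum by itself need not be bounded above by \<open>B\<close>.\<close>
  define g where "g x = max (- B) (min B (e x))" for x
  have bdd: "bdd_below ((\<lambda>y. f y + L * dist x y powr \<eta>) ` G)" for x
  proof (rule bdd_belowI2)
    fix y assume "y \<in> G"
    then have "- B \<le> f y" using bound[of y] by (simp add: abs_le_iff)
    moreover have "0 \<le> L * dist x y powr \<eta>" using L by simp
    ultimately show "- B \<le> f y + L * dist x y powr \<eta>" by linarith
  qed
  have e_le: "e x - e y \<le> L * dist x y powr \<eta>" for x y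
  proof -
    have "e x - L * dist x y powr \<eta> \<le> e y"
      unfolding e_def[of y]
    proof (rule cINF_greatest[OF G])
      fix z assume z: "z \<in> G"
      have "e x \<le> f z + L * dist x z powr \<eta>"
        unfolding e_def using bdd z by (rule cINF_lower)
      also have "\<dots> \<le> f z + L * (dist x y powr \<eta> + dist y z powr \<eta>)"
        using L dist_powr_triangle[OF \<eta>] by (intro add_left_mono mult_left_mono) auto
      finally show "e x - L * dist x y powr \<eta> \<le> f z + L * dist y z powr \<eta>"
        by (simp add: distrib_left)
    qed
    then show ?thesis by simp
  qed
  have e_G: "e x = f x" if x: "x \<in> G" for x
  proof (rule antisym)
    show "e x \<le> f x" unfolding e_def using cINF_lower[OF bdd x, of x] by simp
    show "f x \<le> e x"
      unfolding e_def
    proof (rule cINF_greatest[OF G])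
      show "f x \<le> f y + L * dist x y powr \<eta>" if "y \<in> G" for y using f[OF x that] by linarith
    qed
  qed
  show "g x = f x" if "x \<in> G" for x using bound[OF that] by (simp add: g_def e_G[OF that] abs_le_iff)
  have "0 \<le> B" using G bound by force
  then show "\<bar>g x\<bar> \<le> B" for x by (auto simp: g_def)
  show "\<bar>g x - g y\<bar> \<le> L * dist x y powr \<eta>" for x y
  proof -
    have "\<bar>g x - g y\<bar> \<le> \<bar>e x - e y\<bar>" by (auto simp: g_def)
    also have "\<dots> \<le> L * dist x y powr \<eta>" using e_le[of x y] e_le[of y x] by (auto simp: dist_commute)
    finally show ?thesis .
  qed
qed

text \<open>The coordinates are extended separately. The factor \<open>DIM('b)\<close> is the cost
  of bounding the norm by the sum of the coordinates; it is harmless because only the geometric rate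
  matters later.\<close>

lemma hoelder_extension:
  fixes f :: "'a::metric_space \<Rightarrow> 'b::euclidean_space" and L B \<eta> :: real
  assumes G: "G \<noteq> {}" and \<eta>: "0 < \<eta>" "\<eta> \<le> 1" and L: "0 \<le> L"
    and bound: "\<And>x b. x \<in> G \<Longrightarrow> b \<in> Basis \<Longrightarrow> \<bar>f x \<bullet> b\<bar> \<le> B"
    and f: "\<And>x y b. x \<in> G \<Longrightarrow> y \<in> G \<Longrightarrow> b \<in> Basis \<Longrightarrow> \<bar>f x \<bullet> b - f y \<bullet> b\<bar> \<le> L * dist x y powr \<eta>"
  obtains g where "\<And>x. x \<in> G \<Longrightarrow> g x = f x" "\<And>x. norm (g x) \<le> DIM('b) * B"
    "\<And>x y. norm (g x - g y) \<le> DIM('b) * L * dist x y powr \<eta>"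
proof -
  have "\<forall>b\<in>Basis. \<exists>g. (\<forall>x\<in>G. g x = f x \<bullet> b) \<and> (\<forall>x. \<bar>g x\<bar> \<le> B) \<and>
      (\<forall>x y. \<bar>g x - g y\<bar> \<le> L * dist x y powr \<eta>)"
  proof
    fix b :: 'b assume b: "b \<in> Basis"
    obtain g where "\<And>x. x \<in> G \<Longrightarrow> g x = f x \<bullet> b" "\<And>x. \<bar>g x\<bar> \<le> B"
      "\<And>x y. \<bar>g x - g y\<bar> \<le> L * dist x y powr \<eta>"
      by (rule hoelder_extension_real[OF G \<eta> L, of "\<lambda>x. f x \<bullet> b" B]) (use bound f b in auto)
    then show "\<exists>g. (\<forall>x\<in>G. g x = f x \<bullet> b) \<and> (\<forall>x. \<bar>g x\<bar> \<le> B) \<and>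
      (\<forall>x y. \<bar>g x - g y\<bar> \<le> L * dist x y powr \<eta>)" by blast
  qed
  from bchoice[OF this] obtain g where g: "\<And>b x. b \<in> Basis \<Longrightarrow> x \<in> G \<Longrightarrow> g b x = f x \<bullet> b"
    "\<And>b x. b \<in> Basis \<Longrightarrow> \<bar>g b x\<bar> \<le> B"
    "\<And>b x y. b \<in> Basis \<Longrightarrow> \<bar>g b x - g b y\<bar> \<le> L * dist x y powr \<eta>" by blast
  define h where "h x = (\<Sum>b\<in>Basis. g b x *\<^sub>R b)" for x
  have h: "h x \<bullet> b = g b x" if "b \<in> Basis" for x b using that by (simp add: h_def)
  show thesis
  proof
    show "h x = f x" if "x \<in> G" for x
      by (rule euclidean_eqI) (simp add: h g(1)[OF _ that])
    show "norm (h x) \<le> DIM('b) * B" for x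
    proof -
      have "norm (h x) \<le> (\<Sum>b\<in>Basis. \<bar>h x \<bullet> b\<bar>)" by (rule norm_le_l1)
      also have "\<dots> \<le> DIM('b) * B" by (rule sum_bounded_above) (simp add: h g(2))
      finally show ?thesis .
    qed
    show "norm (h x - h y) \<le> DIM('b) * L * dist x y powr \<eta>" for x y
    proof -
      have "norm (h x - h y) \<le> (\<Sum>b\<in>Basis. \<bar>(h x - h y) \<bullet> b\<bar>)" by (rule norm_le_l1)
      also have "\<dots> \<le> DIM('b) * (L * dist x y powr \<eta>)"
        by (rule sum_bounded_above) (simp add: h g(3) inner_diff_left)
      finally show ?thesis by (simp add: mult.assoc)
    qed
  qed
qed

section \<open>Series that converge in the Hoelder norm\<close>

lemma holder_sums_geometric:
  fixes g :: "nat \<Rightarrow> 'a::metric_space \<Rightarrow> 'b::euclidean_space"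
  assumes A: "0 \<le> A" and \<gamma>: "0 \<le> \<gamma>" "\<gamma> < 1"
    and bound: "\<And>k x. x \<in> S \<Longrightarrow> norm (g k x) \<le> A * \<gamma> ^ k"
    and hoelder: "\<And>k x y. x \<in> S \<Longrightarrow> y \<in> S \<Longrightarrow> norm (g k x - g k y) \<le> A * \<gamma> ^ k * dist x y powr \<eta>"
    and AE: "\<And>k. AE x in M. g k x = u k x"
  shows "holder_sums M \<eta> S u (\<lambda>x. \<Sum>k. g k x)"
  unfolding holder_sums_def
proof (intro exI[of _ g] conjI allI AE)
  fix k
  have "holder_norm \<eta> S (g k) \<le> ennreal (A * \<gamma> ^ k + A * \<gamma> ^ k)"
    using bound hoelder A \<gamma> by (intro holder_norm_le) auto
  then show "holder_norm \<eta> S (g k) < \<infinity>" by (auto intro: le_less_trans)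
next
  have geo: "(\<lambda>k. A * \<gamma> ^ (k + n)) sums (A * \<gamma> ^ n / (1 - \<gamma>))" for n
    using sums_mult[OF geometric_sums[of \<gamma>], of "A * \<gamma> ^ n"] \<gamma> by (simp add: power_add mult_ac)
  \<comment> \<open>One estimate for both parts of the norm: \<open>c = 1\<close> gives the
    supremum, \<open>c = dist x y powr \<eta>\<close> the seminorm.\<close>
  have tail: "summable (\<lambda>k. f (k + n)) \<and> norm (\<Sum>k. f (k + n)) \<le> A * \<gamma> ^ n / (1 - \<gamma>) * c"
    if f: "\<And>k. norm (f k) \<le> A * \<gamma> ^ k * c" for f :: "nat \<Rightarrow> 'b" and n c
  proof -
    have 1: "(\<lambda>k. A * \<gamma> ^ (k + n) * c) sums (A * \<gamma> ^ n / (1 - \<gamma>) * c)" by (intro sums_mult2 geo)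
    have 2: "summable (\<lambda>k. norm (f (k + n)))"
      by (rule summable_comparison_test'[OF sums_summable[OF 1]]) (use f in auto)
    have "norm (\<Sum>k. f (k + n)) \<le> (\<Sum>k. norm (f (k + n)))" using 2 by (rule summable_norm)
    also have "\<dots> \<le> (\<Sum>k. A * \<gamma> ^ (k + n) * c)" using 2 sums_summable[OF 1] f by (intro suminf_le) auto
    also have "\<dots> = A * \<gamma> ^ n / (1 - \<gamma>) * c" using 1 by (rule sums_unique[symmetric])
    finally show ?thesis using summable_norm_cancel[OF 2] by blast
  qed
  have sum: "summable (\<lambda>k. g k x)" if "x \<in> S" for x
    using tail[of "\<lambda>k. g k x" 1 0] bound[OF that] by simp
  have rest: "(\<Sum>k<n. g k x) - (\<Sum>k. g k x) = - (\<Sum>k. g (k + n) x)" if "x \<in> S" for x n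
    using suminf_split_initial_segment[OF sum[OF that], of n] by simp
  have le: "holder_norm \<eta> S (\<lambda>x. (\<Sum>k<n. g k x) - (\<Sum>k. g k x)) \<le>
      ennreal (A * \<gamma> ^ n / (1 - \<gamma>) + A * \<gamma> ^ n / (1 - \<gamma>))" for n
  proof (rule holder_norm_le)
    fix x assume x: "x \<in> S"
    show "norm ((\<Sum>k<n. g k x) - (\<Sum>k. g k x)) \<le> A * \<gamma> ^ n / (1 - \<gamma>)"
      using tail[of "\<lambda>k. g k x" 1 n] bound[OF x] by (simp add: rest[OF x])
    fix y assume y: "y \<in> S"
    have "(\<Sum>k<n. g k x) - (\<Sum>k. g k x) - ((\<Sum>k<n. g k y) - (\<Sum>k. g k y)) = - (\<Sum>k. g (k + n) x - g (k + n) y)"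
      using summable_ignore_initial_segment[OF sum[OF x], of n] summable_ignore_initial_segment[OF sum[OF y], of n]
      by (subst suminf_diff[symmetric]) (simp_all add: rest x y)
    then show "norm ((\<Sum>k<n. g k x) - (\<Sum>k. g k x) - ((\<Sum>k<n. g k y) - (\<Sum>k. g k y))) \<le>
        A * \<gamma> ^ n / (1 - \<gamma>) * dist x y powr \<eta>"
      using tail[of "\<lambda>k. g k x - g k y" "dist x y powr \<eta>" n] hoelder[OF x y] by simp
  qed (use A \<gamma> in auto)
  have "(\<lambda>n. A * \<gamma> ^ n / (1 - \<gamma>) + A * \<gamma> ^ n / (1 - \<gamma>)) \<longlonglongrightarrow> A * 0 / (1 - \<gamma>) + A * 0 / (1 - \<gamma>)"
    using \<gamma> by (intro tendsto_intros LIMSEQ_realpow_zero) auto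
  then have "(\<lambda>n. ennreal (A * \<gamma> ^ n / (1 - \<gamma>) + A * \<gamma> ^ n / (1 - \<gamma>))) \<longlonglongrightarrow> ennreal 0"
    by (intro tendsto_ennrealI) simp
  then have "(\<lambda>n. ennreal (A * \<gamma> ^ n / (1 - \<gamma>) + A * \<gamma> ^ n / (1 - \<gamma>))) \<longlonglongrightarrow> 0" by simp
  from tendsto_sandwich[OF _ _ tendsto_const this] show "(\<lambda>n. holder_norm \<eta> S (\<lambda>x. (\<Sum>k<n. g k x) - (\<Sum>k. g k x))) \<longlonglongrightarrow> 0"
    using le by simp
qed

lemma hoelder_continuous_on:
  fixes g :: "'a::metric_space \<Rightarrow> 'b::real_normed_vector"
  assumes g: "\<And>x y. x \<in> S \<Longrightarrow> y \<in> S \<Longrightarrow> norm (g x - g y) \<le> A * dist x y powr \<eta>" and \<eta>: "0 < \<eta>"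
  shows "continuous_on S g"
proof -
  have "(g \<longlongrightarrow> g x) (at x within S)" if x: "x \<in> S" for x
  proof (rule metric_tendsto_imp_tendsto[of "\<lambda>y. A * dist y x powr \<eta>" 0])
    have "((\<lambda>y. dist y x) \<longlongrightarrow> dist x x) (at x within S)" by (intro tendsto_intros)
    then have "((\<lambda>y. dist y x powr \<eta>) \<longlongrightarrow> 0) (at x within S)"
      using \<eta> by (intro tendsto_zero_powrI[of _ _ _ \<eta>]) auto
    then show "((\<lambda>y. A * dist y x powr \<eta>) \<longlongrightarrow> 0) (at x within S)" by (rule tendsto_mult_right_zero)
    show "\<forall>\<^sub>F y in at x within S. dist (g y) (g x) \<le> dist (A * dist y x powr \<eta>) 0"
      unfolding eventually_at_topological
      by (intro exI[of _ UNIV]) (use g[OF _ x] in \<open>force simp: dist_norm intro: order_trans\<close>)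
  qed
  then show ?thesis by (simp add: continuous_on_def)
qed

text \<open>The sum \<open>X\<close> is an arbitrary function, so its measurability has to be
  derived: the representatives \<open>g k\<close> are continuous on \<open>S\<close>, and
  convergence in the norm is uniform on all of \<open>S\<close>, which is the space of
  \<open>M\<close>. Uniform convergence on a finite measure space also lets the integrals pass to
  the limit.\<close>

lemma holder_sums_imp:
  fixes u :: "nat \<Rightarrow> 'a::metric_space \<Rightarrow> 'b::euclidean_space"
  assumes "finite_measure M" and sets: "sets M = sets (restrict_space borel S)" and \<eta>: "0 < \<eta>"
    and hs: "holder_sums M \<eta> S u X" and u: "\<And>k. integrable M (u k)"
  shows holder_sums_integrable: "integrable M X"
    and holder_sums_integral: "\<And>w. ess_bounded M w \<Longrightarrow>
        (\<lambda>n. \<Sum>k<n. \<integral>x. w x *\<^sub>R u k x \<partial>M) \<longlonglongrightarrow> (\<integral>x. w x *\<^sub>R X x \<partial>M)"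
proof -
  interpret finite_measure M by fact
  have S: "space M = S" using sets_eq_imp_space_eq[OF sets] by (simp add: space_restrict_space)
  obtain g where fin: "\<And>k. holder_norm \<eta> S (g k) < \<infinity>" and AE: "\<And>k. AE y in M. g k y = u k y"
    and lim: "(\<lambda>n. holder_norm \<eta> S (\<lambda>y. (\<Sum>k<n. g k y) - X y)) \<longlonglongrightarrow> 0"
    using hs unfolding holder_sums_def by blast
  have g_meas [measurable]: "g k \<in> borel_measurable M" for k
  proof -
    obtain A where A: "holder_norm \<eta> S (g k) = ennreal A" "0 \<le> A" using fin[of k] by (cases "holder_norm \<eta> S (g k)") auto
    have "continuous_on S (g k)"
      using holder_norm_hoelder[of \<eta> S "g k" A] A by (intro hoelder_continuous_on[OF _ \<eta>]) auto
    then have "g k \<in> borel_measurable (restrict_space borel S)" by (rule borel_measurable_continuous_on_restrict)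
    then show ?thesis using measurable_cong_sets[OF sets refl] by blast
  qed
  have close: "\<forall>\<^sub>F n in sequentially. \<forall>x\<in>S. norm ((\<Sum>k<n. g k x) - X x) \<le> e" if "0 < e" for e :: real
  proof -
    have "\<forall>\<^sub>F n in sequentially. holder_norm \<eta> S (\<lambda>y. (\<Sum>k<n. g k y) - X y) < ennreal e"
      using lim that by (intro order_tendstoD(2)[OF lim]) auto
    then show ?thesis
    proof eventually_elim
      case (elim n)
      then show ?case using holder_norm_bound[of \<eta> S "\<lambda>y. (\<Sum>k<n. g k y) - X y" e] that by (auto simp: less_imp_le)
    qed
  qed
  have X_lim: "(\<lambda>n. \<Sum>k<n. g k x) \<longlonglongrightarrow> X x" if x: "x \<in> S" for x
  proof (rule tendstoI)
    fix e :: real assume "0 < e"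
    then have "0 < e / 2" by simp
    from close[OF this] show "\<forall>\<^sub>F n in sequentially. dist (\<Sum>k<n. g k x) (X x) < e"
    proof eventually_elim
      case (elim n)
      then have "norm ((\<Sum>k<n. g k x) - X x) \<le> e / 2" using x by blast
      then show ?case using \<open>0 < e\<close> by (simp add: dist_norm)
    qed
  qed
  have [measurable]: "X \<in> borel_measurable M"
    by (rule borel_measurable_LIMSEQ_metric[of "\<lambda>n x. \<Sum>k<n. g k x"]) (use X_lim S in auto)
  have g_int: "integrable M (g k)" for k
    using u[of k] AE[of k] by (subst integrable_cong_AE[of _ _ "u k"]) auto
  \<comment> \<open>\<open>X\<close> is an integrable partial sum minus an error bounded by
    1.\<close>
  obtain n where n: "\<And>x. x \<in> S \<Longrightarrow> norm ((\<Sum>k<n. g k x) - X x) \<le> 1"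
    using close[of 1] by (auto simp: eventually_sequentially)
  have sX: "integrable M (\<lambda>x. (\<Sum>k<n. g k x) - X x)"
    by (rule integrable_const_bound[of _ 1]) (use n S in auto)
  then have "integrable M (\<lambda>x. (\<Sum>k<n. g k x) - ((\<Sum>k<n. g k x) - X x))"
    using g_int by (intro Bochner_Integration.integrable_diff[OF _ sX] Bochner_Integration.integrable_sum) auto
  moreover have "(\<lambda>x. (\<Sum>k<n. g k x) - ((\<Sum>k<n. g k x) - X x)) = X" by auto
  ultimately show X_int: "integrable M X" by (simp only:)
  fix w assume w: "ess_bounded M w"
  then have [measurable]: "w \<in> borel_measurable M" by (simp add: ess_bounded_def)
  obtain B where "AE x in M. \<bar>w x\<bar> \<le> B" using w by (auto simp: ess_bounded_def)
  then have B: "AE x in M. \<bar>w x\<bar> \<le> \<bar>B\<bar>" by (rule eventually_mono) auto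
  note w_int = ess_bounded_scaleR_integrable[OF w]
  have sum_eq: "(\<Sum>k<n. \<integral>x. w x *\<^sub>R u k x \<partial>M) = (\<integral>x. w x *\<^sub>R (\<Sum>k<n. g k x) \<partial>M)" for n
  proof -
    have "(\<integral>x. w x *\<^sub>R (\<Sum>k<n. g k x) \<partial>M) = (\<integral>x. (\<Sum>k<n. w x *\<^sub>R g k x) \<partial>M)" by (simp add: scaleR_sum_right)
    also have "\<dots> = (\<Sum>k<n. \<integral>x. w x *\<^sub>R g k x \<partial>M)" using w_int g_int by (intro Bochner_Integration.integral_sum) auto
    also have "\<dots> = (\<Sum>k<n. \<integral>x. w x *\<^sub>R u k x \<partial>M)"
    proof (intro sum.cong refl integral_cong_AE)
      show "AE x in M. w x *\<^sub>R g k x = w x *\<^sub>R u k x" for k using AE[of k] by eventually_elim simp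
      show "(\<lambda>x. w x *\<^sub>R u k x) \<in> borel_measurable M" for k
        using borel_measurable_integrable[OF w_int[OF u[of k]]] .
    qed auto
    finally show ?thesis ..
  qed
  show "(\<lambda>n. \<Sum>k<n. \<integral>x. w x *\<^sub>R u k x \<partial>M) \<longlonglongrightarrow> (\<integral>x. w x *\<^sub>R X x \<partial>M)"
    unfolding sum_eq
  proof (rule tendstoI)
    fix e :: real assume e: "0 < e"
    \<comment> \<open>The summand 1 keeps the divisor positive when \<open>B\<close> or the total
      mass is 0.\<close>
    define c where "c = \<bar>B\<bar> * measure M (space M) + 1"
    have c: "0 < c" unfolding c_def by (intro add_nonneg_pos mult_nonneg_nonneg) auto
    have "0 < e / c" using e c by simp
    from close[OF this] show "\<forall>\<^sub>F n in sequentially. dist (\<integral>x. w x *\<^sub>R (\<Sum>k<n. g k x) \<partial>M) (\<integral>x. w x *\<^sub>R X x \<partial>M) < e"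
    proof eventually_elim
      case (elim n)
      have s_int: "integrable M (\<lambda>x. \<Sum>k<n. g k x)" using g_int by auto
      have "(\<integral>x. w x *\<^sub>R (\<Sum>k<n. g k x) \<partial>M) - (\<integral>x. w x *\<^sub>R X x \<partial>M) = (\<integral>x. w x *\<^sub>R ((\<Sum>k<n. g k x) - X x) \<partial>M)"
        using w_int[OF s_int] w_int[OF X_int]
        by (simp add: Bochner_Integration.integral_diff[symmetric] scaleR_diff_right del: Bochner_Integration.integral_diff)
      also have "norm \<dots> \<le> (\<integral>x. norm (w x *\<^sub>R ((\<Sum>k<n. g k x) - X x)) \<partial>M)" by (rule integral_norm_bound)
      also have "\<dots> \<le> (\<integral>x. \<bar>B\<bar> * (e / c) \<partial>M)"
      proof (rule integral_mono_AE)
        show "integrable M (\<lambda>x. norm (w x *\<^sub>R ((\<Sum>k<n. g k x) - X x)))"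
          by (intro integrable_norm w_int Bochner_Integration.integrable_diff s_int X_int)
        show "AE x in M. norm (w x *\<^sub>R ((\<Sum>k<n. g k x) - X x)) \<le> \<bar>B\<bar> * (e / c)"
          using B AE_space
        proof eventually_elim
          fix x assume "\<bar>w x\<bar> \<le> \<bar>B\<bar>" "x \<in> space M"
          then have "\<bar>w x\<bar> * norm ((\<Sum>k<n. g k x) - X x) \<le> \<bar>B\<bar> * (e / c)"
            using elim S by (intro mult_mono) auto
          then show "norm (w x *\<^sub>R ((\<Sum>k<n. g k x) - X x)) \<le> \<bar>B\<bar> * (e / c)" by simp
        qed
      qed simp
      also have "\<dots> = \<bar>B\<bar> * measure M (space M) * (e / c)" by simp
      also have "\<dots> < c * (e / c)" using e c by (intro mult_strict_right_mono) (auto simp: c_def)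
      also have "\<dots> = e" using c by simp
      finally show ?case by (simp add: dist_norm)
    qed
  qed
qed

text \<open>Formally the operator sends \<open>X \<circ> F\<close> to \<open>X\<close>, and
  \<open>X\<close> to its own series without the first term, so it annihilates
  \<open>\<phi>' - X \<circ> F + X\<close>. The computation is done with integrals against
  \<open>w \<circ> F\<close>, since duality with bounded functions is what is known about the
  operator.\<close>

lemma martingale_coboundary_dual:
  fixes \<phi>' :: "'a::metric_space \<Rightarrow> 'b::euclidean_space"
  assumes "finite_measure M" and sets: "sets M = sets (restrict_space borel S)" and \<eta>: "0 < \<eta>"
    and F: "F \<in> measurable M M" and inv: "distr M M F = M"
    and int: "\<And>k. integrable M ((transfer M F ^^ k) \<phi>')"
    and dual: "\<And>k w. ess_bounded M w \<Longrightarrow>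
        (\<integral>x. w x *\<^sub>R (transfer M F ^^ Suc k) \<phi>' x \<partial>M) = (\<integral>x. w (F x) *\<^sub>R (transfer M F ^^ k) \<phi>' x \<partial>M)"
    and hs: "holder_sums M \<eta> S (\<lambda>k. (transfer M F ^^ Suc k) \<phi>') X"
  shows "integrable M (\<lambda>x. \<phi>' x - X (F x) + X x)"
    and "ess_bounded M w \<Longrightarrow> (\<integral>x. w (F x) *\<^sub>R (\<phi>' x - X (F x) + X x) \<partial>M) = 0"
proof -
  note [measurable] = F
  let ?p = "\<lambda>k. (transfer M F ^^ k) \<phi>'"
  have X: "integrable M X" by (rule holder_sums_integrable[OF assms(1) sets \<eta> hs int])
  then have "integrable (distr M M F) X" by (simp add: inv)
  then have XF: "integrable M (\<lambda>x. X (F x))" by (rule integrable_distr[OF F])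
  have \<phi>': "integrable M \<phi>'" using int[of 0] by simp
  then show "integrable M (\<lambda>x. \<phi>' x - X (F x) + X x)" using X XF by simp
  assume w: "ess_bounded M w"
  then have [measurable]: "w \<in> borel_measurable M" by (simp add: ess_bounded_def)
  have wF: "ess_bounded M (\<lambda>x. w (F x))" by (rule ess_bounded_comp[OF F inv w])
  note w_int = ess_bounded_scaleR_integrable[OF wF]
  have 1: "(\<lambda>n. \<Sum>k<n. \<integral>x. w x *\<^sub>R ?p (Suc k) x \<partial>M) \<longlonglongrightarrow> (\<integral>x. w x *\<^sub>R X x \<partial>M)"
    by (rule holder_sums_integral[OF assms(1) sets \<eta> hs int w])
  have "(\<lambda>n. \<Sum>k<n. \<integral>x. w (F x) *\<^sub>R ?p (Suc k) x \<partial>M) \<longlonglongrightarrow> (\<integral>x. w (F x) *\<^sub>R X x \<partial>M)"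
    by (rule holder_sums_integral[OF assms(1) sets \<eta> hs int wF])
  \<comment> \<open>Duality trades the \<open>F\<close> inside \<open>w\<close> for one more power
    of the operator: against \<open>w\<close>, this is the series without its first term.\<close>
  then have "(\<lambda>n. \<Sum>k<n. \<integral>x. w x *\<^sub>R ?p (Suc (Suc k)) x \<partial>M) \<longlonglongrightarrow> (\<integral>x. w (F x) *\<^sub>R X x \<partial>M)"
    using dual[OF w] by (simp del: funpow.simps)
  then have "(\<lambda>n. (\<integral>x. w x *\<^sub>R ?p (Suc 0) x \<partial>M) + (\<Sum>k<n. \<integral>x. w x *\<^sub>R ?p (Suc (Suc k)) x \<partial>M)) \<longlonglongrightarrow>
      (\<integral>x. w x *\<^sub>R ?p (Suc 0) x \<partial>M) + (\<integral>x. w (F x) *\<^sub>R X x \<partial>M)" by (intro tendsto_intros)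
  moreover have "(\<integral>x. w x *\<^sub>R ?p (Suc 0) x \<partial>M) + (\<Sum>k<n. \<integral>x. w x *\<^sub>R ?p (Suc (Suc k)) x \<partial>M) =
      (\<Sum>k<Suc n. \<integral>x. w x *\<^sub>R ?p (Suc k) x \<partial>M)" for n
    by (subst sum.lessThan_Suc_shift) simp
  ultimately have "(\<lambda>n. \<Sum>k<Suc n. \<integral>x. w x *\<^sub>R ?p (Suc k) x \<partial>M) \<longlonglongrightarrow>
      (\<integral>x. w x *\<^sub>R ?p (Suc 0) x \<partial>M) + (\<integral>x. w (F x) *\<^sub>R X x \<partial>M)" by (simp only:)
  from LIMSEQ_unique[OF this LIMSEQ_Suc[OF 1]]
  have 2: "(\<integral>x. w x *\<^sub>R ?p (Suc 0) x \<partial>M) + (\<integral>x. w (F x) *\<^sub>R X x \<partial>M) = (\<integral>x. w x *\<^sub>R X x \<partial>M)" .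
  have 3: "(\<integral>x. w x *\<^sub>R ?p (Suc 0) x \<partial>M) = (\<integral>x. w (F x) *\<^sub>R \<phi>' x \<partial>M)" using dual[OF w, of 0] by simp
  \<comment> \<open>Invariance of \<open>M\<close>: the operator undoes composition with
    \<open>F\<close>.\<close>
  have "(\<integral>x. w x *\<^sub>R X x \<partial>M) = (\<integral>x. w x *\<^sub>R X x \<partial>distr M M F)" by (simp add: inv)
  also have "\<dots> = (\<integral>x. w (F x) *\<^sub>R X (F x) \<partial>M)" using X by (intro integral_distr F) auto
  finally have 4: "(\<integral>x. w x *\<^sub>R X x \<partial>M) = (\<integral>x. w (F x) *\<^sub>R X (F x) \<partial>M)" .
  have "(\<integral>x. w (F x) *\<^sub>R (\<phi>' x - X (F x) + X x) \<partial>M) =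
      (\<integral>x. w (F x) *\<^sub>R \<phi>' x \<partial>M) - (\<integral>x. w (F x) *\<^sub>R X (F x) \<partial>M) + (\<integral>x. w (F x) *\<^sub>R X x \<partial>M)"
    using w_int[OF \<phi>'] w_int[OF XF] w_int[OF X] by (simp add: scaleR_diff_right scaleR_add_right)
  also have "\<dots> = 0" using 2 3 4 by (simp add: algebra_simps)
  finally show "(\<integral>x. w (F x) *\<^sub>R (\<phi>' x - X (F x) + X x) \<partial>M) = 0" .
qed

section \<open>Density of Lipschitz functions in \<open>L\<^sup>1\<close>\<close>

text \<open>The bound \<open>B\<close> keeps \<open>g\<close> integrable over a finite Borel
  measure, so that for integrable \<open>h\<close> the integral is a true distance and not the
  default value 0.\<close>

definition lipschitz_approximable :: "'a::metric_space measure \<Rightarrow> ('a \<Rightarrow> real) \<Rightarrow> bool" where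
  "lipschitz_approximable N h \<longleftrightarrow> (\<forall>e>0. \<exists>g L B. (\<forall>x y. \<bar>g x - g y\<bar> \<le> L * dist x y) \<and>
     (\<forall>x. \<bar>g x\<bar> \<le> B) \<and> (\<integral>x. \<bar>h x - g x\<bar> \<partial>N) < e)"

locale finite_borel_measure = finite_measure M for M :: "'a::metric_space measure" +
  assumes sets_borel: "sets M = sets borel"

lemma lipschitz_imp_continuous:
  fixes g :: "'a::metric_space \<Rightarrow> real"
  assumes "\<And>x y. \<bar>g x - g y\<bar> \<le> L * dist x y"
  shows "continuous_on UNIV g"
proof -
  have "\<bar>L\<bar>-lipschitz_on UNIV g"
  proof (rule lipschitz_onI)
    show "dist (g x) (g y) \<le> \<bar>L\<bar> * dist x y" for x y
      using assms[of x y] by (simp add: dist_real_def) (smt (verit) mult_right_mono zero_le_dist abs_ge_self)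
  qed simp
  then show ?thesis by (rule lipschitz_on_continuous_on)
qed

lemma (in finite_borel_measure) lipschitz_integrable:
  assumes "\<And>x y. \<bar>g x - g y\<bar> \<le> L * dist x y" "\<And>x. \<bar>g x\<bar> \<le> B"
  shows "integrable M (g :: 'a \<Rightarrow> real)"
proof (rule integrable_const_bound)
  show "AE x in M. norm (g x) \<le> B" using assms(2) by simp
  have "g \<in> borel_measurable borel"
    using lipschitz_imp_continuous[OF assms(1)] by (rule borel_measurable_continuous_onI)
  then show "g \<in> borel_measurable M" using sets_borel measurable_cong_sets by blast
qed

lemma (in finite_borel_measure) lipschitz_approximable_limit:
  assumes h: "integrable M h"
    and lim: "\<And>e. e > 0 \<Longrightarrow> \<exists>h'. lipschitz_approximable M h' \<and> integrable M h' \<and> (\<integral>x. \<bar>h x - h' x\<bar> \<partial>M) < e"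
  shows "lipschitz_approximable M (h :: 'a \<Rightarrow> real)"
  unfolding lipschitz_approximable_def
proof (intro allI impI)
  fix e :: real assume "e > 0"
  then obtain h' where h': "lipschitz_approximable M h'" "integrable M h'" "(\<integral>x. \<bar>h x - h' x\<bar> \<partial>M) < e / 2"
    using lim[of "e / 2"] by auto
  obtain g L B where g: "\<And>x y. \<bar>g x - g y\<bar> \<le> L * dist x y" "\<And>x. \<bar>g x\<bar> \<le> B"
      "(\<integral>x. \<bar>h' x - g x\<bar> \<partial>M) < e / 2"
    using h'(1) \<open>e > 0\<close> unfolding lipschitz_approximable_def by (metis half_gt_zero)
  have [simp]: "integrable M g" using lipschitz_integrable[OF g(1,2)] .
  have "(\<integral>x. \<bar>h x - g x\<bar> \<partial>M) \<le> (\<integral>x. \<bar>h x - h' x\<bar> + \<bar>h' x - g x\<bar> \<partial>M)"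
    using h h' by (intro integral_mono) auto
  also have "\<dots> < e" using h h' g by simp
  finally show "\<exists>g L B. (\<forall>x y. \<bar>g x - g y\<bar> \<le> L * dist x y) \<and> (\<forall>x. \<bar>g x\<bar> \<le> B) \<and> (\<integral>x. \<bar>h x - g x\<bar> \<partial>M) < e"
    using g(1,2) by blast
qed

lemma (in finite_borel_measure) lipschitz_approximable_add:
  assumes h: "integrable M h" "integrable M k"
    and a: "lipschitz_approximable M h" "lipschitz_approximable M k"
  shows "lipschitz_approximable M (\<lambda>x. h x + k x :: real)"
  unfolding lipschitz_approximable_def
proof (intro allI impI)
  fix e :: real assume "e > 0"
  obtain g L B where g: "\<And>x y. \<bar>g x - g y\<bar> \<le> L * dist x y" "\<And>x. \<bar>g x\<bar> \<le> B"
      "(\<integral>x. \<bar>h x - g x\<bar> \<partial>M) < e / 2"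
    using a(1) \<open>e > 0\<close> unfolding lipschitz_approximable_def by (metis half_gt_zero)
  obtain g' L' B' where g': "\<And>x y. \<bar>g' x - g' y\<bar> \<le> L' * dist x y" "\<And>x. \<bar>g' x\<bar> \<le> B'"
      "(\<integral>x. \<bar>k x - g' x\<bar> \<partial>M) < e / 2"
    using a(2) \<open>e > 0\<close> unfolding lipschitz_approximable_def by (metis half_gt_zero)
  have [simp]: "integrable M g" "integrable M g'"
    using lipschitz_integrable[OF g(1,2)] lipschitz_integrable[OF g'(1,2)] .
  have "(\<integral>x. \<bar>h x + k x - (g x + g' x)\<bar> \<partial>M) \<le> (\<integral>x. \<bar>h x - g x\<bar> + \<bar>k x - g' x\<bar> \<partial>M)"
    using h by (intro integral_mono) auto
  also have "\<dots> < e" using h g g' by simp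
  finally have "(\<integral>x. \<bar>h x + k x - (g x + g' x)\<bar> \<partial>M) < e" .
  moreover have "\<bar>(g x + g' x) - (g y + g' y)\<bar> \<le> (L + L') * dist x y" for x y
    using g(1)[of x y] g'(1)[of x y] by (simp add: distrib_right abs_le_iff)
  moreover have "\<bar>g x + g' x\<bar> \<le> B + B'" for x using g(2)[of x] g'(2)[of x] by linarith
  ultimately show "\<exists>g L B. (\<forall>x y. \<bar>g x - g y\<bar> \<le> L * dist x y) \<and> (\<forall>x. \<bar>g x\<bar> \<le> B) \<and>
      (\<integral>x. \<bar>h x + k x - g x\<bar> \<partial>M) < e"
    by (intro exI[of _ "\<lambda>x. g x + g' x"] exI[of _ "L + L'"] exI[of _ "B + B'"]) auto
qed

lemma (in finite_borel_measure) lipschitz_approximable_cmult: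
  assumes a: "lipschitz_approximable M h"
  shows "lipschitz_approximable M (\<lambda>x. c * h x :: real)"
  unfolding lipschitz_approximable_def
proof (intro allI impI)
  fix e :: real assume "e > 0"
  then have "0 < e / (\<bar>c\<bar> + 1)" by simp
  then obtain g L B where g: "\<And>x y. \<bar>g x - g y\<bar> \<le> L * dist x y" "\<And>x. \<bar>g x\<bar> \<le> B"
      "(\<integral>x. \<bar>h x - g x\<bar> \<partial>M) < e / (\<bar>c\<bar> + 1)"
    using a unfolding lipschitz_approximable_def by metis
  have "(\<integral>x. \<bar>c * h x - c * g x\<bar> \<partial>M) = \<bar>c\<bar> * (\<integral>x. \<bar>h x - g x\<bar> \<partial>M)"
    by (simp add: right_diff_distrib[symmetric] abs_mult)
  also have "\<dots> \<le> (\<bar>c\<bar> + 1) * (\<integral>x. \<bar>h x - g x\<bar> \<partial>M)" by (intro mult_right_mono) auto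
  also have "\<dots> < e" using g(3) by (simp add: field_simps)
  finally have "(\<integral>x. \<bar>c * h x - c * g x\<bar> \<partial>M) < e" .
  moreover have "\<bar>c * g x - c * g y\<bar> \<le> (\<bar>c\<bar> * L) * dist x y" for x y
    using mult_left_mono[OF g(1)[of x y], of "\<bar>c\<bar>"] by (simp add: right_diff_distrib[symmetric] abs_mult mult.assoc)
  moreover have "\<bar>c * g x\<bar> \<le> \<bar>c\<bar> * B" for x using g(2)[of x] by (simp add: abs_mult mult_left_mono)
  ultimately show "\<exists>g L B. (\<forall>x y. \<bar>g x - g y\<bar> \<le> L * dist x y) \<and> (\<forall>x. \<bar>g x\<bar> \<le> B) \<and>
      (\<integral>x. \<bar>c * h x - g x\<bar> \<partial>M) < e"
    by (intro exI[of _ "\<lambda>x. c * g x"] exI[of _ "\<bar>c\<bar> * L"] exI[of _ "\<bar>c\<bar> * B"]) auto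
qed

lemma lipschitz_approximable_lipschitz:
  assumes "\<And>x y. \<bar>g x - g y\<bar> \<le> L * dist x y" "\<And>x. \<bar>g x\<bar> \<le> B"
  shows "lipschitz_approximable M g"
  unfolding lipschitz_approximable_def
  by (intro allI impI exI[of _ g] exI[of _ L] exI[of _ B]) (use assms in auto)

lemma L1_tendsto_by_domination:
  fixes h :: "'a \<Rightarrow> real"
  assumes s: "\<And>i. s i \<in> borel_measurable M" "h \<in> borel_measurable M"
    and lim: "\<And>x. x \<in> space M \<Longrightarrow> (\<lambda>i. s i x) \<longlonglongrightarrow> h x"
    and dom: "\<And>i x. x \<in> space M \<Longrightarrow> \<bar>s i x\<bar> \<le> w x" and w: "integrable M w"
    and e: "0 < e"
  shows "\<exists>i. (\<integral>x. \<bar>h x - s i x\<bar> \<partial>M) < e"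
proof -
  have "(\<lambda>i. \<integral>x. \<bar>h x - s i x\<bar> \<partial>M) \<longlonglongrightarrow> (\<integral>x. 0 \<partial>M)"
  proof (rule integral_dominated_convergence[where w="\<lambda>x. 2 * w x"])
    show "AE x in M. (\<lambda>i. \<bar>h x - s i x\<bar>) \<longlonglongrightarrow> 0"
      using lim by (intro AE_I2) (auto intro!: tendsto_eq_intros)
    have hw: "\<bar>h x\<bar> \<le> w x" if x: "x \<in> space M" for x
      by (rule LIMSEQ_le_const2[OF tendsto_rabs[OF lim[OF x]]]) (use dom[OF x] in auto)
    show "AE x in M. norm \<bar>h x - s i x\<bar> \<le> 2 * w x" for i
    proof (rule AE_I2)
      fix x assume "x \<in> space M"
      from hw[OF this] dom[OF this, of i] show "norm \<bar>h x - s i x\<bar> \<le> 2 * w x" by simp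
    qed
  qed (use s w in auto)
  then have "(\<lambda>i. \<integral>x. \<bar>h x - s i x\<bar> \<partial>M) \<longlonglongrightarrow> 0" by simp
  from order_tendstoD(2)[OF this e] show ?thesis
    by (auto simp: eventually_sequentially)
qed

lemma (in finite_borel_measure) lipschitz_approximable_closed:
  fixes E :: "'a set"
  assumes E: "closed E"
  shows "lipschitz_approximable M (indicator E)"
\<comment> \<open>\<open>infdist x {}\<close> is 0 by convention, so for empty \<open>E\<close> the
  functions \<open>s n\<close> below would be constantly 1.\<close>
proof (cases "E = {}")
  case True
  have "lipschitz_approximable M (indicator {})"
    by (rule lipschitz_approximable_lipschitz[of _ 0 0]) auto
  with True show ?thesis by simp
next
  case False
  define s where "s n x = max 0 (1 - real n * infdist x E)" for n x
  have lip: "\<bar>s n x - s n y\<bar> \<le> real n * dist x y" for n x y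
  proof -
    have "\<bar>s n x - s n y\<bar> \<le> \<bar>real n * infdist x E - real n * infdist y E\<bar>" by (auto simp: s_def)
    also have "\<dots> = real n * \<bar>infdist x E - infdist y E\<bar>" by (simp add: right_diff_distrib[symmetric] abs_mult)
    also have "\<dots> \<le> real n * dist x y" by (intro mult_left_mono infdist_triangle_abs) auto
    finally show ?thesis .
  qed
  have bd: "\<bar>s n x\<bar> \<le> 1" for n x by (auto simp: s_def infdist_nonneg)
  have Es: "E \<in> sets M" using E sets_borel by auto
  note int = lipschitz_integrable[OF lip bd]
  show ?thesis
  proof (rule lipschitz_approximable_limit)
    show "integrable M (indicator E :: 'a \<Rightarrow> real)" using Es by (simp add: emeasure_eq_measure)
    fix e :: real assume e: "e > 0"
    have "\<exists>i. (\<integral>x. \<bar>indicator E x - s i x\<bar> \<partial>M) < e"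
    proof (rule L1_tendsto_by_domination[OF _ _ _ _ _ e])
      show "(\<lambda>i. s i x) \<longlonglongrightarrow> indicator E x" for x
      proof (cases "x \<in> E")
        case True
        then show ?thesis by (simp add: s_def)
      next
        case False
        then have "infdist x E > 0"
          using in_closed_iff_infdist_zero[OF E \<open>E \<noteq> {}\<close>] infdist_nonneg[of x E] by (metis less_eq_real_def)
        then obtain k where k: "1 < real k * infdist x E" using reals_Archimedean3 by blast
        have "\<forall>\<^sub>F i in sequentially. s i x = 0"
          using eventually_ge_at_top[of k]
        proof eventually_elim
          case (elim i)
          then have "real k * infdist x E \<le> real i * infdist x E" by (intro mult_right_mono infdist_nonneg) auto
          then show ?case using k by (simp add: s_def)
        qed
        then show ?thesis using False by (simp add: tendsto_eventually)
      qed
      show "s i \<in> borel_measurable M" for i using int[of i] by blast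
    qed (use Es bd in auto)
    then show "\<exists>h'. lipschitz_approximable M h' \<and> integrable M h' \<and> (\<integral>x. \<bar>indicator E x - h' x\<bar> \<partial>M) < e"
      using lipschitz_approximable_lipschitz[OF lip bd] int by blast
  qed
qed

text \<open>Closed sets form an intersection-stable generator, so Dynkin induction asks only for
  complements and disjoint unions. The first follow from linearity, the second from closedness under
  limits in the mean.\<close>

lemma (in finite_borel_measure) lipschitz_approximable_sets:
  fixes E :: "'a set"
  assumes E: "E \<in> sets M"
  shows "lipschitz_approximable M (indicator E)"
proof -
  have sb: "sets M = sigma_sets UNIV (Collect closed)"
    using sets_borel by (simp add: borel_eq_closed)
  have "Int_stable (Collect closed :: 'a set set)" "Collect closed \<subseteq> Pow (UNIV :: 'a set)"
    "E \<in> sigma_sets UNIV (Collect closed)"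
    using E sb by (auto simp: Int_stable_def)
  then show ?thesis
  proof (induction rule: sigma_sets_induct_disjoint)
    case (basic A)
    then show ?case by (intro lipschitz_approximable_closed) simp
  next
    case empty
    show ?case by (rule lipschitz_approximable_closed) simp
  next
    case (compl A)
    then have A: "A \<in> sets M" by (simp add: sb)
    have "(indicator (UNIV - A) :: 'a \<Rightarrow> real) = (\<lambda>x. 1 + (- 1) * indicator A x)"
      by (auto split: split_indicator)
    moreover have "lipschitz_approximable M (\<lambda>x. 1 + (- 1) * indicator A x)"
      by (intro lipschitz_approximable_add lipschitz_approximable_cmult compl.IH
          lipschitz_approximable_lipschitz[of _ 0 1]) (use A in \<open>auto simp: emeasure_eq_measure\<close>)
    ultimately show ?case by simp
  next
    case (union A)
    then have A: "A i \<in> sets M" for i by (auto simp: sb)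
    define s where "s n x = (\<Sum>i<n. indicator (A i) x :: real)" for n x
    have fin: "integrable M (indicator (A i) :: 'a \<Rightarrow> real)" for i using A by (simp add: emeasure_eq_measure)
    have int: "integrable M (s n)" for n unfolding s_def using fin by auto
    have app: "lipschitz_approximable M (s n)" for n
    proof (induction n)
      case 0
      then show ?case using lipschitz_approximable_lipschitz[of "\<lambda>_. 0" 0 0] by (simp add: s_def[abs_def])
    next
      case (Suc n)
      have "s (Suc n) = (\<lambda>x. s n x + indicator (A n) x)" by (simp add: s_def[abs_def])
      then show ?case using lipschitz_approximable_add[OF int fin Suc union.IH] by simp
    qed
    have s: "s n x = indicator (\<Union>i<n. A i) x" for n x
      unfolding s_def using union(1)
      by (subst indicator_UN_disjoint) (auto simp: disjoint_family_on_def)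
    show ?case
    proof (rule lipschitz_approximable_limit)
      show "integrable M (indicator (\<Union> (range A)) :: 'a \<Rightarrow> real)"
        using A by (auto simp: emeasure_eq_measure)
      fix e :: real assume e: "e > 0"
      have "\<exists>i. (\<integral>x. \<bar>indicator (\<Union> (range A)) x - s i x\<bar> \<partial>M) < e"
      proof (rule L1_tendsto_by_domination[OF _ _ _ _ _ e])
        show "(\<lambda>i. s i x) \<longlonglongrightarrow> indicator (\<Union> (range A)) x" for x
          unfolding s by (rule LIMSEQ_indicator_UN)
        show "integrable M (\<lambda>_. 1 :: real)" by simp
      qed (use A int s in \<open>auto split: split_indicator\<close>)
      then show "\<exists>h'. lipschitz_approximable M h' \<and> integrable M h' \<and>
          (\<integral>x. \<bar>indicator (\<Union> (range A)) x - h' x\<bar> \<partial>M) < e"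
        using app int by blast
    qed
  qed
qed

lemma (in finite_borel_measure) integrable_imp_lipschitz_approximable:
  fixes h :: "'a \<Rightarrow> real"
  assumes h: "integrable M h"
  shows "lipschitz_approximable M h"
  using h
proof (induction rule: integrable_induct)
  case (base A c)
  then show ?case
    using lipschitz_approximable_cmult[OF lipschitz_approximable_sets[OF base(1)], of c]
    by (simp add: mult.commute)
next
  case (add f g)
  then show ?case by (rule lipschitz_approximable_add)
next
  case (lim f s)
  show ?case
  proof (rule lipschitz_approximable_limit[OF lim(4)])
    fix e :: real assume e: "e > 0"
    have "\<exists>i. (\<integral>x. \<bar>f x - s i x\<bar> \<partial>M) < e"
      by (rule L1_tendsto_by_domination[where w="\<lambda>x. 2 * \<bar>f x\<bar>", OF _ _ lim(2) _ _ e]) (use lim in auto)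
    then show "\<exists>h'. lipschitz_approximable M h' \<and> integrable M h' \<and> (\<integral>x. \<bar>f x - h' x\<bar> \<partial>M) < e"
      using lim(1,5) by blast
  qed
qed

section \<open>Contraction of cones of log-Hoelder functions\<close>

text \<open>An abstract map with full branches: \<open>\<psi> a\<close> are the inverse branches of
  \<open>F\<close>, \<open>J a\<close> their Jacobians, and \<theta> is the contraction rate for the
  metric \<open>dist powr \<eta>\<close>. \<open>change_of_variables\<close> ties the measure to the
  branches. The regularity bounds are required at every point of \<open>G\<close>, because Hoelder
  estimates are pointwise. \<open>D\<close> is at least 1 so that it bounds
  \<open>dist powr \<eta>\<close> as well as \<open>dist\<close>.\<close>

locale branch_system = finite_measure M
  for M :: "'a::metric_space measure" +
  fixes G :: "'a set" and I :: "'i set" and \<psi> :: "'i \<Rightarrow> 'a \<Rightarrow> 'a" and J :: "'i \<Rightarrow> 'a \<Rightarrow> ennreal"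
    and F :: "'a \<Rightarrow> 'a" and \<eta> \<theta> C D :: real
  assumes countable_I: "countable I"
    and G_sets [measurable]: "G \<in> sets M"
    and AE_G: "AE x in M. x \<in> G"
    and M_pos: "measure M (space M) > 0"
    and F_measurable [measurable]: "F \<in> measurable M M"
    and \<psi>_measurable: "\<And>a. a \<in> I \<Longrightarrow> \<psi> a \<in> measurable M M"
    and J_measurable: "\<And>a. a \<in> I \<Longrightarrow> J a \<in> borel_measurable M"
    and \<psi>_G: "\<And>a y. a \<in> I \<Longrightarrow> y \<in> G \<Longrightarrow> \<psi> a y \<in> G"
    and F_\<psi>: "\<And>a y. a \<in> I \<Longrightarrow> y \<in> G \<Longrightarrow> F (\<psi> a y) = y"
    and change_of_variables: "\<And>f. f \<in> borel_measurable M \<Longrightarrow>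
        (\<integral>\<^sup>+ x. f x \<partial>M) = (\<integral>\<^sup>+ y. (\<integral>\<^sup>+ a. J a y * f (\<psi> a y) \<partial>count_space I) \<partial>M)"
    and \<eta>_pos: "0 < \<eta>" and \<eta>_le_1: "\<eta> \<le> 1"
    and \<theta>_nonneg: "0 \<le> \<theta>" and \<theta>_less_1: "\<theta> < 1"
    and C_nonneg: "0 \<le> C"
    and D_ge_1: "1 \<le> D"
    and diam: "\<And>x y. x \<in> G \<Longrightarrow> y \<in> G \<Longrightarrow> dist x y \<le> D"
    and contraction: "\<And>a x y. a \<in> I \<Longrightarrow> x \<in> G \<Longrightarrow> y \<in> G \<Longrightarrow>
        dist (\<psi> a x) (\<psi> a y) powr \<eta> \<le> \<theta> * dist x y powr \<eta>"
    and J_distortion: "\<And>a x y. a \<in> I \<Longrightarrow> x \<in> G \<Longrightarrow> y \<in> G \<Longrightarrow>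
        J a x \<le> ennreal (exp (C * dist x y powr \<eta>)) * J a y"
begin

section \<open>The transfer operator on nonnegative functions and its cones\<close>

definition Q :: "('a \<Rightarrow> ennreal) \<Rightarrow> 'a \<Rightarrow> ennreal" where
  "Q u y = (\<integral>\<^sup>+ a. J a y * u (\<psi> a y) \<partial>count_space I)"

text \<open>The values 0 and \<infinity> are allowed: remainders may vanish, and finiteness on
  \<open>G\<close> comes later from a finite integral.\<close>

definition hcone :: "real \<Rightarrow> ('a \<Rightarrow> ennreal) \<Rightarrow> bool" where
  "hcone K u \<longleftrightarrow> (\<forall>x\<in>G. \<forall>y\<in>G. u x \<le> ennreal (exp (K * dist x y powr \<eta>)) * u y)"

text \<open>For functions that may jump from one partition element to the next: points are compared
  only within one branch, and the distance is that of their images under \<open>F\<close>.\<close>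

definition branch_cone :: "real \<Rightarrow> ('a \<Rightarrow> ennreal) \<Rightarrow> bool" where
  "branch_cone K u \<longleftrightarrow> (\<forall>a\<in>I. \<forall>x\<in>G. \<forall>y\<in>G.
     u (\<psi> a x) \<le> ennreal (exp (K * dist x y powr \<eta>)) * u (\<psi> a y))"

abbreviation V :: real where "V \<equiv> measure M (space M)"

lemma Q_measurable [measurable]:
  assumes [measurable]: "u \<in> borel_measurable M"
  shows "Q u \<in> borel_measurable M"
proof -
  interpret I: sigma_finite_measure "count_space I"
    by (rule sigma_finite_measure_count_space_countable) (rule countable_I)
  have "(\<lambda>(a, y). J a y * u (\<psi> a y)) \<in> borel_measurable (count_space I \<Otimes>\<^sub>M M)"
  proof (rule measurable_pair_measure_countable1[OF countable_I])
    fix a assume "a \<in> I"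
    note [measurable] = \<psi>_measurable[OF this] J_measurable[OF this]
    show "(\<lambda>y. case (a, y) of (a, y) \<Rightarrow> J a y * u (\<psi> a y)) \<in> borel_measurable M"
      by simp
  qed
  then have "(\<lambda>(y, a). J a y * u (\<psi> a y)) \<in> borel_measurable (M \<Otimes>\<^sub>M count_space I)"
    by (subst measurable_pair_swap_iff) (simp add: case_prod_beta')
  then show ?thesis
    unfolding Q_def by (rule I.borel_measurable_nn_integral[of "\<lambda>y a. J a y * u (\<psi> a y)"])
qed

lemma Qn_measurable [measurable]:
  "u \<in> borel_measurable M \<Longrightarrow> (Q ^^ n) u \<in> borel_measurable M"
  by (induction n) auto

lemma nn_integral_Q: "u \<in> borel_measurable M \<Longrightarrow> (\<integral>\<^sup>+ x. Q u x \<partial>M) = (\<integral>\<^sup>+ x. u x \<partial>M)"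
  unfolding Q_def using change_of_variables[of u] by simp

lemma nn_integral_Qn:
  "u \<in> borel_measurable M \<Longrightarrow> (\<integral>\<^sup>+ x. (Q ^^ n) u x \<partial>M) = (\<integral>\<^sup>+ x. u x \<partial>M)"
  by (induction n) (auto simp: nn_integral_Q)

lemma Q_cong: "(\<And>x. x \<in> G \<Longrightarrow> u x = u' x) \<Longrightarrow> y \<in> G \<Longrightarrow> Q u y = Q u' y"
  unfolding Q_def by (intro nn_integral_cong) (simp add: \<psi>_G)

lemma Q_mono: "(\<And>x. x \<in> G \<Longrightarrow> u x \<le> u' x) \<Longrightarrow> y \<in> G \<Longrightarrow> Q u y \<le> Q u' y"
  unfolding Q_def by (intro nn_integral_mono mult_left_mono) (simp_all add: \<psi>_G)

lemma Q_add: "Q (\<lambda>x. u x + u' x) y = Q u y + Q u' y"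
  unfolding Q_def by (subst nn_integral_add[symmetric]) (auto simp: distrib_left)

lemma Q_cmult: "Q (\<lambda>x. c * u x) y = c * Q u y"
  unfolding Q_def by (subst nn_integral_cmult[symmetric]) (auto simp: mult_ac)

lemma Q_mult_comp: "y \<in> G \<Longrightarrow> Q (\<lambda>x. u x * w (F x)) y = Q u y * w y"
  unfolding Q_def by (subst nn_integral_multc[symmetric])
    (auto simp: mult_ac F_\<psi> intro!: nn_integral_cong)

lemma Qn_mono: "(\<And>x. x \<in> G \<Longrightarrow> u x \<le> u' x) \<Longrightarrow> y \<in> G \<Longrightarrow> (Q ^^ n) u y \<le> (Q ^^ n) u' y"
  by (induction n arbitrary: y) (auto intro: Q_mono)

lemma Qn_add: "(Q ^^ n) (\<lambda>x. u x + u' x) y = (Q ^^ n) u y + (Q ^^ n) u' y"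
proof (induction n arbitrary: y)
  case (Suc n)
  then have "(Q ^^ n) (\<lambda>x. u x + u' x) = (\<lambda>y. (Q ^^ n) u y + (Q ^^ n) u' y)" by blast
  then show ?case by (simp add: Q_add)
qed simp

lemma Qn_cmult: "(Q ^^ n) (\<lambda>x. c * u x) y = c * (Q ^^ n) u y"
proof (induction n arbitrary: y)
  case (Suc n)
  then have "(Q ^^ n) (\<lambda>x. c * u x) = (\<lambda>y. c * (Q ^^ n) u y)" by blast
  then show ?case by (simp add: Q_cmult)
qed simp

text \<open>Apply preservation of integrals to \<open>u\<close> times
  \<open>indicator E \<circ> F\<close>; the second factor comes out of \<open>Q\<close> as
  \<open>indicator E\<close>. So \<open>Q\<close> describes the push-forward of densities, and an
  invariant measure has a density fixed by \<open>Q\<close>.\<close>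

lemma density_Q:
  assumes [measurable]: "u \<in> borel_measurable M"
  shows "distr (density M u) M F = density M (Q u)"
proof (rule measure_eqI)
  fix E assume "E \<in> sets (distr (density M u) M F)"
  then have E [measurable]: "E \<in> sets M" by simp
  have "emeasure (distr (density M u) M F) E = (\<integral>\<^sup>+ x. u x * indicator E (F x) \<partial>M)"
    by (subst emeasure_distr)
      (auto simp: emeasure_density intro!: nn_integral_cong split: split_indicator)
  also have "\<dots> = (\<integral>\<^sup>+ y. Q (\<lambda>x. u x * indicator E (F x)) y \<partial>M)"
    by (rule nn_integral_Q[symmetric]) measurable
  also have "\<dots> = (\<integral>\<^sup>+ y. Q u y * indicator E y \<partial>M)"
    using AE_G by (intro nn_integral_cong_AE) (auto simp: Q_mult_comp)
  finally show "emeasure (distr (density M u) M F) E = emeasure (density M (Q u)) E"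
    by (simp add: emeasure_density)
qed simp

text \<open>The bound holds term by term: the distortion of the Jacobian contributes
  \<open>C\<close> to the exponent and the function contributes \<open>K\<close>. The factor does
  not depend on the branch, so it survives the sum.\<close>

lemma cone_Q:
  assumes "branch_cone K u"
  shows "hcone (C + K) (Q u)"
  unfolding hcone_def
proof (intro ballI)
  fix x y assume xy: "x \<in> G" "y \<in> G"
  let ?d = "dist x y powr \<eta>"
  have "Q u x \<le> (\<integral>\<^sup>+ a. ennreal (exp ((C + K) * ?d)) * (J a y * u (\<psi> a y)) \<partial>count_space I)"
    unfolding Q_def
  proof (rule nn_integral_mono)
    fix a assume "a \<in> space (count_space I)"
    then have a: "a \<in> I" by simp
    have "J a x * u (\<psi> a x) \<le>
        (ennreal (exp (C * ?d)) * J a y) * (ennreal (exp (K * ?d)) * u (\<psi> a y))"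
      using assms a xy by (intro mult_mono J_distortion) (auto simp: branch_cone_def)
    also have "\<dots> = ennreal (exp (C * ?d) * exp (K * ?d)) * (J a y * u (\<psi> a y))"
      by (simp add: ennreal_mult mult_ac)
    also have "exp (C * ?d) * exp (K * ?d) = exp ((C + K) * ?d)"
      by (simp add: exp_add[symmetric] distrib_right)
    finally show "J a x * u (\<psi> a x) \<le> ennreal (exp ((C + K) * ?d)) * (J a y * u (\<psi> a y))" .
  qed
  then show "Q u x \<le> ennreal (exp ((C + K) * ?d)) * Q u y"
    unfolding Q_def by (subst (asm) nn_integral_cmult) auto
qed

lemma cone_mono:
  assumes "hcone K u" "K \<le> K'"
  shows "hcone K' u"
  unfolding hcone_def
proof (intro ballI)
  fix x y assume "x \<in> G" "y \<in> G"
  then have "u x \<le> ennreal (exp (K * dist x y powr \<eta>)) * u y"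
    using assms(1) by (auto simp: hcone_def)
  also have "\<dots> \<le> ennreal (exp (K' * dist x y powr \<eta>)) * u y"
    using assms(2) by (intro mult_right_mono ennreal_leI) (auto intro: mult_right_mono)
  finally show "u x \<le> ennreal (exp (K' * dist x y powr \<eta>)) * u y" .
qed

lemma cone_imp_branch_cone:
  assumes "hcone K u" "0 \<le> K"
  shows "branch_cone (K * \<theta>) u"
  unfolding branch_cone_def
proof (intro ballI)
  fix a x y assume *: "a \<in> I" "x \<in> G" "y \<in> G"
  have "u (\<psi> a x) \<le> ennreal (exp (K * dist (\<psi> a x) (\<psi> a y) powr \<eta>)) * u (\<psi> a y)"
    using assms(1) * \<psi>_G by (auto simp: hcone_def)
  also have "\<dots> \<le> ennreal (exp (K * \<theta> * dist x y powr \<eta>)) * u (\<psi> a y)"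
    using contraction[OF *] assms(2)
    by (intro mult_right_mono ennreal_leI) (auto simp: mult.assoc mult_left_mono)
  finally show "u (\<psi> a x) \<le> ennreal (exp (K * \<theta> * dist x y powr \<eta>)) * u (\<psi> a y)" .
qed

text \<open>The solution of \<open>C + K * \<theta> = K - 1\<close>: from here on, one application
  of \<open>Q\<close> lowers the cone constant by at least 1.\<close>

definition K\<^sub>0 :: real where "K\<^sub>0 = (C + 1) / (1 - \<theta>)"

lemma K\<^sub>0_ge_1: "1 \<le> K\<^sub>0"
  using C_nonneg \<theta>_nonneg \<theta>_less_1 by (simp add: K\<^sub>0_def field_simps)

lemma cone_Q_gain:
  assumes "hcone K u" "K\<^sub>0 \<le> K"
  shows "hcone (K - 1) (Q u)"
proof (rule cone_mono)
  have "0 \<le> K" using assms K\<^sub>0_ge_1 by linarith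
  with assms show "hcone (C + K * \<theta>) (Q u)"
    by (intro cone_Q cone_imp_branch_cone)
  show "C + K * \<theta> \<le> K - 1"
    using assms(2) \<theta>_less_1 by (simp add: K\<^sub>0_def field_simps)
qed

lemma hdist_le:
  assumes "x \<in> G" "y \<in> G"
  shows "dist x y powr \<eta> \<le> D"
proof -
  have "dist x y powr \<eta> \<le> D powr \<eta>"
    using diam[OF assms] \<eta>_pos by (intro powr_mono2) auto
  also have "\<dots> \<le> D powr 1"
    using D_ge_1 \<eta>_le_1 by (intro powr_mono) auto
  finally show ?thesis using D_ge_1 by simp
qed

lemma cone_le:
  assumes "hcone K u" "0 \<le> K" "x \<in> G" "y \<in> G"
  shows "u x \<le> ennreal (exp (K * D)) * u y"
proof -
  have "u x \<le> ennreal (exp (K * dist x y powr \<eta>)) * u y"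
    using assms by (auto simp: hcone_def)
  also have "\<dots> \<le> ennreal (exp (K * D)) * u y"
    using hdist_le[OF assms(3,4)] assms(2)
    by (intro mult_right_mono ennreal_leI) (auto intro: mult_left_mono)
  finally show ?thesis .
qed

text \<open>Integrating \<open>u x \<le> exp (K * D) * u y\<close> over \<open>y\<close>, and the
  same inequality with the points exchanged, compares \<open>u x\<close> with the average
  \<open>c / V\<close>.\<close>

lemma cone_bounds:
  assumes [measurable]: "u \<in> borel_measurable M" and u: "hcone K u" "0 \<le> K"
    and int: "(\<integral>\<^sup>+ x. u x \<partial>M) = ennreal c" and c: "0 \<le> c" and x: "x \<in> G"
  shows cone_upper: "u x \<le> ennreal (exp (K * D) * c / V)"
    and cone_lower: "ennreal (exp (- K * D) * c / V) \<le> u x"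
proof -
  have V: "emeasure M (space M) = ennreal V"
    by (simp add: emeasure_eq_measure)
  have "(\<integral>\<^sup>+ y. u x \<partial>M) \<le> (\<integral>\<^sup>+ y. ennreal (exp (K * D)) * u y \<partial>M)"
    using AE_G by (intro nn_integral_mono_AE) (auto intro: cone_le[OF u x])
  then have 1: "u x * ennreal V \<le> ennreal (exp (K * D) * c)"
    by (simp add: nn_integral_cmult int V ennreal_mult c)
  then have fin: "u x \<noteq> \<top>"
    using M_pos by (auto simp: ennreal_top_mult top_unique)
  then obtain r where r: "u x = ennreal r" "0 \<le> r"
    by (cases "u x") auto
  have "r * V \<le> exp (K * D) * c"
    using 1 r c by (simp add: ennreal_mult[symmetric])
  then show "u x \<le> ennreal (exp (K * D) * c / V)"
    using M_pos r by (auto simp: field_simps intro!: ennreal_leI)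
  have "(\<integral>\<^sup>+ y. u y \<partial>M) \<le> (\<integral>\<^sup>+ y. ennreal (exp (K * D)) * u x \<partial>M)"
    using AE_G by (intro nn_integral_mono_AE) (auto intro: cone_le[OF u _ x])
  then have "ennreal c \<le> ennreal (exp (K * D) * r * V)"
    by (simp add: int V r ennreal_mult)
  then have "c \<le> exp (K * D) * r * V"
    using r M_pos by (subst (asm) ennreal_le_iff) auto
  then have "exp (- K * D) * c / V \<le> r"
    using M_pos by (simp add: field_simps exp_minus)
  then show "ennreal (exp (- K * D) * c / V) \<le> u x"
    using r by (auto intro!: ennreal_leI)
qed


section \<open>Geometric decay of differences\<close>

lemma exp_diff_ge:
  fixes s :: real
  assumes "0 \<le> s" "0 \<le> k" "s \<le> D"
  shows "exp (k * s) - 1 \<le> k * s * exp (k * D)"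
proof -
  have "1 - k * s \<le> exp (- (k * s))" using exp_ge_add_one_self[of "- (k * s)"] by simp
  then have "exp (k * s) * (1 - k * s) \<le> exp (k * s) * exp (- (k * s))" by (intro mult_left_mono) auto
  then have "exp (k * s) - 1 \<le> k * s * exp (k * s)"
    by (simp add: exp_minus field_simps)
  also have "\<dots> \<le> k * s * exp (k * D)"
    using assms by (intro mult_left_mono) (auto intro: mult_left_mono)
  finally show ?thesis .
qed

text \<open>The gap between \<open>K - 1\<close> and \<open>K\<close> pays for the subtraction. With
  \<open>s\<close> the power of the distance, it is enough that \<open>e * (exp (K * s) - 1) \<le>
  (exp (K * s) - exp ((K - 1) * s)) * w y\<close>. The left side is at most
  \<open>e * K * s * exp (K * D)\<close> and the right side at least \<open>s * b\<close>; the given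
  \<open>e\<close> makes these two bounds equal.\<close>

lemma hcone_subtract:
  assumes w: "hcone (K - 1) w" and K: "1 \<le> K"
    and lower: "\<And>x. x \<in> G \<Longrightarrow> ennreal b \<le> w x" and b: "0 \<le> b"
    and fin: "\<And>x. x \<in> G \<Longrightarrow> w x < \<top>"
    and e: "e = exp (- K * D) * b / K"
  shows "hcone K (\<lambda>x. w x - ennreal e)"
  unfolding hcone_def
proof (intro ballI)
  fix x y assume xy: "x \<in> G" "y \<in> G"
  define s where "s = dist x y powr \<eta>"
  have s: "0 \<le> s" "s \<le> D" using hdist_le[OF xy] by (auto simp: s_def)
  obtain p where p: "w x = ennreal p" "0 \<le> p" using fin[OF xy(1)] by (cases "w x") auto
  obtain q where q: "w y = ennreal q" "0 \<le> q" using fin[OF xy(2)] by (cases "w y") auto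
  have bq: "b \<le> q" using lower[OF xy(2)] q b by simp
  have e0: "0 \<le> e" using e b K by auto
  \<comment> \<open>Hence \<open>e \<le> b\<close>, and the subtraction in \<open>ennreal\<close>
    never truncates.\<close>
  have "exp (- K * D) / K \<le> 1"
    using K D_ge_1 by (simp add: field_simps) (smt (verit) exp_le_one_iff mult_nonneg_nonneg)
  then have "e \<le> b" using e b mult_right_mono[of "exp (- K * D) / K" 1 b] by simp
  have "ennreal p \<le> ennreal (exp ((K - 1) * s) * q)"
    using bspec[OF bspec[OF w[unfolded hcone_def] xy(1)] xy(2)] p q by (simp add: s_def ennreal_mult)
  then have pq: "p \<le> exp ((K - 1) * s) * q" using q by (subst (asm) ennreal_le_iff) auto
  have "e * (exp (K * s) - 1) \<le> e * (K * s * exp (K * D))"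
    using e0 exp_diff_ge[of s K] s K by (intro mult_left_mono) auto
  also have "\<dots> = s * b" using K by (simp add: e exp_minus field_simps)
  also have "\<dots> \<le> s * q" using bq s by (intro mult_left_mono) auto
  also have "\<dots> \<le> (exp (K * s) - exp ((K - 1) * s)) * q"
  proof (intro mult_right_mono)
    have "exp (K * s) = exp ((K - 1) * s) * exp s" by (simp add: exp_add[symmetric] algebra_simps)
    then have "exp (K * s) - exp ((K - 1) * s) = exp ((K - 1) * s) * (exp s - 1)"
      by (simp add: algebra_simps)
    also have "\<dots> \<ge> 1 * s"
      using s K exp_ge_add_one_self[of s] by (intro mult_mono) (auto simp del: exp_ge_add_one_self)
    finally show "s \<le> exp (K * s) - exp ((K - 1) * s)" by simp
  qed (use q in auto)
  finally have "p - e \<le> exp (K * s) * (q - e)"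
    using pq by (simp add: algebra_simps)
  then have "ennreal (p - e) \<le> ennreal (exp (K * s)) * ennreal (q - e)"
    using bq \<open>e \<le> b\<close> by (subst ennreal_mult[symmetric]) (auto intro!: ennreal_leI)
  then show "w x - ennreal e \<le> ennreal (exp (K * dist x y powr \<eta>)) * (w y - ennreal e)"
    using p q e0 by (simp add: ennreal_minus s_def)
qed

text \<open>The proportion of mass left after one step of \<open>Q_split\<close>. In the removed
  part, \<open>K * D\<close> and the division by \<open>K\<close> come from
  \<open>hcone_subtract\<close>, and \<open>(K - 1) * D\<close> from the lower bound for
  \<open>Q u\<close> in the cone with constant \<open>K - 1\<close>.\<close>

definition \<gamma> :: "real \<Rightarrow> real" where "\<gamma> K = 1 - exp (- (2 * K - 1) * D) / K"

lemma \<gamma>_range: "1 \<le> K \<Longrightarrow> 0 \<le> \<gamma> K" "1 \<le> K \<Longrightarrow> \<gamma> K < 1"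
proof -
  assume K: "1 \<le> K"
  have "exp (- (2 * K - 1) * D) \<le> 1" using K D_ge_1 by (simp add: mult_nonpos_nonneg)
  then have "exp (- (2 * K - 1) * D) \<le> K" using K by linarith
  then show "0 \<le> \<gamma> K" "\<gamma> K < 1" using K by (auto simp: \<gamma>_def field_simps)
qed

text \<open>\<open>Q\<close> gains 1 in the cone constant, and the gain is spent on subtracting a
  constant. That constant depends on \<open>u\<close> only through the integral \<open>c\<close>, so
  two functions with equal integrals lose the same amount.\<close>

lemma Q_split:
  assumes [measurable]: "u \<in> borel_measurable M" and u: "hcone K u" and K: "K\<^sub>0 \<le> K"
    and int: "(\<integral>\<^sup>+ x. u x \<partial>M) = ennreal c" and c: "0 \<le> c"
  defines "e \<equiv> exp (- (2 * K - 1) * D) * c / (K * V)"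
  obtains r where "r \<in> borel_measurable M" "hcone K r" "(\<integral>\<^sup>+ x. r x \<partial>M) = ennreal (\<gamma> K * c)"
    "\<And>x. x \<in> G \<Longrightarrow> Q u x = r x + ennreal e"
proof
  define b where "b = exp (- (K - 1) * D) * c / V"
  have K1: "1 \<le> K" using K K\<^sub>0_ge_1 by simp
  have e: "e = exp (- K * D) * b / K"
    by (simp add: e_def b_def exp_add[symmetric] algebra_simps)
  have b: "0 \<le> b" using c M_pos by (auto simp: b_def)
  have Qu: "hcone (K - 1) (Q u)" by (rule cone_Q_gain) fact+
  have Qint: "(\<integral>\<^sup>+ x. Q u x \<partial>M) = ennreal c" by (simp add: nn_integral_Q int)
  have upper: "Q u x \<le> ennreal (exp ((K - 1) * D) * c / V)" if "x \<in> G" for x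
    by (rule cone_upper[OF _ Qu _ Qint]) (use K1 c that in auto)
  have lower: "ennreal b \<le> Q u x" if "x \<in> G" for x
    unfolding b_def by (rule cone_lower[OF _ Qu _ Qint]) (use K1 c that in auto)
  have fin: "Q u x < \<top>" if "x \<in> G" for x
    using upper[OF that] by (auto intro: le_less_trans)
  let ?r = "\<lambda>x. Q u x - ennreal e"
  show [measurable]: "?r \<in> borel_measurable M" by measurable
  show "hcone K ?r"
    by (rule hcone_subtract[OF Qu K1 lower b fin e])
  have "exp (- K * D) / K \<le> 1"
    using K1 D_ge_1 by (simp add: field_simps) (smt (verit) exp_le_one_iff mult_nonneg_nonneg)
  then have "e \<le> b" using e b mult_right_mono[of "exp (- K * D) / K" 1 b] by simp
  have e0: "0 \<le> e" using e b K1 by auto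
  show split: "Q u x = ?r x + ennreal e" if "x \<in> G" for x
  proof -
    have "ennreal e \<le> Q u x"
      using order_trans[OF ennreal_leI[OF \<open>e \<le> b\<close>] lower[OF that]] .
    then show ?thesis by (simp add: diff_add_cancel_ennreal)
  qed
  have "ennreal c = (\<integral>\<^sup>+ x. ?r x + ennreal e \<partial>M)"
    unfolding Qint[symmetric] using AE_G by (intro nn_integral_cong_AE) (auto simp: split[symmetric])
  also have "\<dots> = (\<integral>\<^sup>+ x. ?r x \<partial>M) + ennreal (e * V)"
    using e0 by (subst nn_integral_add) (auto simp: emeasure_eq_measure ennreal_mult)
  finally have *: "(\<integral>\<^sup>+ x. ?r x \<partial>M) + ennreal (e * V) = ennreal c" by simp
  then have "(\<integral>\<^sup>+ x. ?r x \<partial>M) = ennreal c - ennreal (e * V)"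
    by (metis ennreal_add_diff_cancel_right ennreal_neq_top)
  also have "\<dots> = ennreal (c - e * V)" using e0 by (simp add: ennreal_minus)
  also have "c - e * V = \<gamma> K * c"
    using M_pos by (simp add: \<gamma>_def e_def field_simps)
  finally show "(\<integral>\<^sup>+ x. ?r x \<partial>M) = ennreal (\<gamma> K * c)" .
qed

text \<open>A coupling: \<open>k\<close> collects the constants split off so far, pushed forward by
  the later applications of \<open>Q\<close>. It is common to both functions and is never estimated,
  while the remainders keep the cone constant \<open>K\<close> and only the fraction
  \<open>\<gamma> K ^ n\<close> of the mass.\<close>

lemma Qn_split:
  assumes "u \<in> borel_measurable M" "hcone K u" "(\<integral>\<^sup>+ x. u x \<partial>M) = ennreal c"
    and "u' \<in> borel_measurable M" "hcone K u'" "(\<integral>\<^sup>+ x. u' x \<partial>M) = ennreal c"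
    and c: "0 \<le> c" and K: "K\<^sub>0 \<le> K"
  shows "\<exists>r r' k. r \<in> borel_measurable M \<and> hcone K r \<and> (\<integral>\<^sup>+ x. r x \<partial>M) = ennreal (\<gamma> K ^ n * c) \<and>
    r' \<in> borel_measurable M \<and> hcone K r' \<and> (\<integral>\<^sup>+ x. r' x \<partial>M) = ennreal (\<gamma> K ^ n * c) \<and>
    (\<forall>x\<in>G. (Q ^^ n) u x = r x + k x \<and> (Q ^^ n) u' x = r' x + k x)"
proof (induction n)
  case 0
  then show ?case using assms by (intro exI[of _ u] exI[of _ u'] exI[of _ "\<lambda>x. 0"]) auto
next
  case (Suc n)
  then obtain r r' k where r: "r \<in> borel_measurable M" "hcone K r" "(\<integral>\<^sup>+ x. r x \<partial>M) = ennreal (\<gamma> K ^ n * c)"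
    and r': "r' \<in> borel_measurable M" "hcone K r'" "(\<integral>\<^sup>+ x. r' x \<partial>M) = ennreal (\<gamma> K ^ n * c)"
    and split: "\<And>x. x \<in> G \<Longrightarrow> (Q ^^ n) u x = r x + k x" "\<And>x. x \<in> G \<Longrightarrow> (Q ^^ n) u' x = r' x + k x"
    by blast
  have c': "0 \<le> \<gamma> K ^ n * c" using K K\<^sub>0_ge_1 c \<gamma>_range by auto
  define e where "e = ennreal (exp (- (2 * K - 1) * D) * (\<gamma> K ^ n * c) / (K * V))"
  obtain s where s: "s \<in> borel_measurable M" "hcone K s" "(\<integral>\<^sup>+ x. s x \<partial>M) = ennreal (\<gamma> K * (\<gamma> K ^ n * c))"
    "\<And>x. x \<in> G \<Longrightarrow> Q r x = s x + e"
    unfolding e_def using Q_split[OF r(1,2) K r(3) c'] by metis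
  obtain s' where s': "s' \<in> borel_measurable M" "hcone K s'" "(\<integral>\<^sup>+ x. s' x \<partial>M) = ennreal (\<gamma> K * (\<gamma> K ^ n * c))"
    "\<And>x. x \<in> G \<Longrightarrow> Q r' x = s' x + e"
    unfolding e_def using Q_split[OF r'(1,2) K r'(3) c'] by metis
  have "(Q ^^ Suc n) u x = s x + (e + Q k x) \<and> (Q ^^ Suc n) u' x = s' x + (e + Q k x)"
    if x: "x \<in> G" for x
  proof -
    have "Q ((Q ^^ n) u) x = Q (\<lambda>x. r x + k x) x" using split(1) x by (rule Q_cong)
    moreover have "Q ((Q ^^ n) u') x = Q (\<lambda>x. r' x + k x) x" using split(2) x by (rule Q_cong)
    ultimately show ?thesis using s(4)[OF x] s'(4)[OF x] by (simp add: Q_add add.assoc)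
  qed
  then show ?case using s s' by (intro exI[of _ s] exI[of _ s'] exI[of _ "\<lambda>x. e + Q k x"]) (auto simp: mult.assoc)
qed

lemma hcone_real_bounds:
  fixes f :: "'a \<Rightarrow> real"
  assumes f: "\<And>x y. x \<in> G \<Longrightarrow> y \<in> G \<Longrightarrow> f x \<le> exp (K * dist x y powr \<eta>) * f y"
    and bound: "\<And>x. x \<in> G \<Longrightarrow> 0 \<le> f x \<and> f x \<le> B" and K: "0 \<le> K" and xy: "x \<in> G" "y \<in> G"
  shows "\<bar>f x - f y\<bar> \<le> B * K * exp (K * D) * dist x y powr \<eta>"
proof -
  have *: "f x - f y \<le> B * K * exp (K * D) * dist x y powr \<eta>" if "x \<in> G" "y \<in> G" for x y
  proof -
    have "f x - f y \<le> (exp (K * dist x y powr \<eta>) - 1) * f y" using f[OF that] by (simp add: algebra_simps)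
    also have "\<dots> \<le> (K * dist x y powr \<eta> * exp (K * D)) * B"
      using bound[OF that(2)] exp_diff_ge[of "dist x y powr \<eta>" K] hdist_le[OF that] K
      by (intro mult_mono) auto
    finally show ?thesis by (simp add: mult_ac)
  qed
  show ?thesis using *[OF xy] *[OF xy(2,1)] by (auto simp: dist_commute abs_le_iff)
qed

text \<open>The common part cancels in the difference, and a cone function with integral
  \<open>\<gamma> K ^ n * c\<close> has supremum and Hoelder constant of that order.\<close>

lemma decay:
  assumes u: "u \<in> borel_measurable M" "hcone K u" "(\<integral>\<^sup>+ x. u x \<partial>M) = ennreal c"
    and u': "u' \<in> borel_measurable M" "hcone K u'" "(\<integral>\<^sup>+ x. u' x \<partial>M) = ennreal c"
    and c: "0 \<le> c" and K: "K\<^sub>0 \<le> K"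
  defines "b \<equiv> exp (K * D) * c / V"
  defines "d \<equiv> \<lambda>n x. enn2real ((Q ^^ n) u x) - enn2real ((Q ^^ n) u' x)"
  assumes x: "x \<in> G"
  shows decay_bound: "\<bar>d n x\<bar> \<le> b * \<gamma> K ^ n"
    and decay_hoelder: "y \<in> G \<Longrightarrow> \<bar>d n x - d n y\<bar> \<le> 2 * b * K * exp (K * D) * \<gamma> K ^ n * dist x y powr \<eta>"
proof -
  have K1: "1 \<le> K" using K K\<^sub>0_ge_1 by simp
  obtain r r' k where r: "r \<in> borel_measurable M" "hcone K r" "(\<integral>\<^sup>+ x. r x \<partial>M) = ennreal (\<gamma> K ^ n * c)"
    and r': "r' \<in> borel_measurable M" "hcone K r'" "(\<integral>\<^sup>+ x. r' x \<partial>M) = ennreal (\<gamma> K ^ n * c)"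
    and split: "\<And>x. x \<in> G \<Longrightarrow> (Q ^^ n) u x = r x + k x" "\<And>x. x \<in> G \<Longrightarrow> (Q ^^ n) u' x = r' x + k x"
    using Qn_split[OF u u' c K, of n] by blast
  have c': "0 \<le> \<gamma> K ^ n * c" using K1 c \<gamma>_range by auto
  \<comment> \<open>Cancelling \<open>k x\<close> in \<open>ennreal\<close> requires it to be
    finite; this follows because the iterate stays in the cone and keeps its integral.\<close>
  have qfin: "(Q ^^ n) u x < \<top>" if "x \<in> G" for x
  proof -
    have "hcone K ((Q ^^ n) u)"
    proof (induction n)
      case (Suc n)
      then have "hcone (K - 1) (Q ((Q ^^ n) u))" by (intro cone_Q_gain K)
      then show ?case by (auto intro: cone_mono)
    qed (use u in auto)
    moreover have "(\<integral>\<^sup>+ x. (Q ^^ n) u x \<partial>M) = ennreal c" using u by (simp add: nn_integral_Qn)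
    ultimately have "(Q ^^ n) u x \<le> ennreal (exp (K * D) * c / V)"
      using u(1) K1 c that by (intro cone_upper) auto
    then show ?thesis by (auto intro: le_less_trans)
  qed
  define B where "B = exp (K * D) * (\<gamma> K ^ n * c) / V"
  have B: "B = b * \<gamma> K ^ n" by (simp add: B_def b_def)
  have real_r: "\<exists>p. (\<forall>x\<in>G. r x = ennreal (p x) \<and> 0 \<le> p x \<and> p x \<le> B) \<and>
     (\<forall>x\<in>G. \<forall>y\<in>G. \<bar>p x - p y\<bar> \<le> B * K * exp (K * D) * dist x y powr \<eta>)"
    if r: "r \<in> borel_measurable M" "hcone K r" "(\<integral>\<^sup>+ x. r x \<partial>M) = ennreal (\<gamma> K ^ n * c)" for r
  proof -
    have "r x \<le> ennreal B" if "x \<in> G" for x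
      unfolding B_def using K1 c' that by (intro cone_upper[OF r(1,2) _ r(3)]) auto
    moreover have "0 \<le> B" using c' M_pos by (auto simp: B_def)
    ultimately have p: "r x = ennreal (enn2real (r x))" "0 \<le> enn2real (r x)" "enn2real (r x) \<le> B"
      if "x \<in> G" for x
      using that le_less_trans[of "r x" "ennreal B" \<top>] by (auto simp: enn2real_leI)
    have cone: "enn2real (r x) \<le> exp (K * dist x y powr \<eta>) * enn2real (r y)" if "x \<in> G" "y \<in> G" for x y
    proof -
      have "r x \<le> ennreal (exp (K * dist x y powr \<eta>)) * r y" using r(2) that by (auto simp: hcone_def)
      then have "ennreal (enn2real (r x)) \<le> ennreal (exp (K * dist x y powr \<eta>) * enn2real (r y))"
        using p(1)[OF that(1)] p(1)[OF that(2)] by (simp add: ennreal_mult)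
      then show ?thesis by (subst (asm) ennreal_le_iff) auto
    qed
    show ?thesis
      using p cone hcone_real_bounds[of "\<lambda>x. enn2real (r x)" K B] K1
      by (intro exI[of _ "\<lambda>x. enn2real (r x)"]) auto
  qed
  obtain p where p: "\<And>x. x \<in> G \<Longrightarrow> r x = ennreal (p x) \<and> 0 \<le> p x \<and> p x \<le> B"
    "\<And>x y. x \<in> G \<Longrightarrow> y \<in> G \<Longrightarrow> \<bar>p x - p y\<bar> \<le> B * K * exp (K * D) * dist x y powr \<eta>"
    using real_r[OF r] by blast
  obtain p' where p': "\<And>x. x \<in> G \<Longrightarrow> r' x = ennreal (p' x) \<and> 0 \<le> p' x \<and> p' x \<le> B"
    "\<And>x y. x \<in> G \<Longrightarrow> y \<in> G \<Longrightarrow> \<bar>p' x - p' y\<bar> \<le> B * K * exp (K * D) * dist x y powr \<eta>"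
    using real_r[OF r'] by blast
  have d: "d n x = p x - p' x" if "x \<in> G" for x
  proof -
    have "k x \<noteq> \<top>" using qfin[OF that] split(1)[OF that] by auto
    then obtain q where "k x = ennreal q" "0 \<le> q" by (cases "k x") auto
    then show ?thesis
      using p(1)[OF that] p'(1)[OF that] split[OF that]
      by (simp add: d_def ennreal_plus[symmetric] del: ennreal_plus)
  qed
  show "\<bar>d n x\<bar> \<le> b * \<gamma> K ^ n"
    using d[OF x] p(1)[OF x] p'(1)[OF x] by (auto simp: B)
  show "\<bar>d n x - d n y\<bar> \<le> 2 * b * K * exp (K * D) * \<gamma> K ^ n * dist x y powr \<eta>" if y: "y \<in> G"
    using d[OF x] d[OF y] p(2)[OF x y] p'(2)[OF x y] by (auto simp: B mult_ac)
qed

end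

section \<open>Regularity of invariant densities\<close>

context branch_system
begin

text \<open>Functions that agree almost everywhere are densities of the same measure, hence have the
  same push-forward, and its density is unique up to null sets. No preimages of null sets under
  \<open>\<psi> a\<close> have to be examined.\<close>

lemma Q_AE_cong:
  assumes [measurable]: "u \<in> borel_measurable M" "u' \<in> borel_measurable M"
    and "AE x in M. u x = u' x"
  shows "AE x in M. Q u x = Q u' x"
proof -
  have "density M u = density M u'" using assms by (intro density_cong) auto
  then have "density M (Q u) = density M (Q u')" by (simp add: density_Q[symmetric])
  then show ?thesis by (simp add: density_unique_iff)
qed

lemma Qn_invariant:
  assumes [measurable]: "h \<in> borel_measurable M" and "AE x in M. Q h x = h x"
  shows "AE x in M. (Q ^^ n) h x = h x"
proof (induction n)
  case (Suc n)
  have "AE x in M. Q ((Q ^^ n) h) x = Q h x" by (rule Q_AE_cong) (use Suc in auto)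
  with assms(2) show ?case by eventually_elim simp
qed simp

lemma decay_ennreal:
  assumes u: "u \<in> borel_measurable M" "hcone K u" "(\<integral>\<^sup>+ x. u x \<partial>M) = ennreal c"
    and u': "u' \<in> borel_measurable M" "hcone K u'" "(\<integral>\<^sup>+ x. u' x \<partial>M) = ennreal c"
    and c: "0 \<le> c" and K: "K\<^sub>0 \<le> K" and x: "x \<in> G"
  shows "(Q ^^ n) u x \<le> (Q ^^ n) u' x + ennreal (exp (K * D) * c / V * \<gamma> K ^ n)"
proof -
  have K1: "1 \<le> K" using K K\<^sub>0_ge_1 by simp
  obtain r r' k where r: "r \<in> borel_measurable M" "hcone K r" "(\<integral>\<^sup>+ x. r x \<partial>M) = ennreal (\<gamma> K ^ n * c)"
    and split: "\<And>x. x \<in> G \<Longrightarrow> (Q ^^ n) u x = r x + k x" "\<And>x. x \<in> G \<Longrightarrow> (Q ^^ n) u' x = r' x + k x"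
    using Qn_split[OF u u' c K, of n] by blast
  have "r x \<le> ennreal (exp (K * D) * (\<gamma> K ^ n * c) / V)"
    using K1 c x \<gamma>_range by (intro cone_upper[OF r(1,2) _ r(3)]) auto
  then have "r x + k x \<le> ennreal (exp (K * D) * c / V * \<gamma> K ^ n) + (r' x + k x)"
    by (intro add_mono) (auto simp: mult_ac)
  then show ?thesis using split[OF x] by (simp add: add.commute)
qed

text \<open>The lower bound \<open>b\<close> turns the additive Lipschitz error into a relative one,
  \<open>L * dist x y \<le> L * D / b * dist x y powr \<eta> * g y\<close>, and then
  \<open>1 + t \<le> exp t\<close> applies.\<close>

lemma lipschitz_hcone:
  fixes g :: "'a \<Rightarrow> real"
  assumes g: "\<And>x y. \<bar>g x - g y\<bar> \<le> L * dist x y" and low: "\<And>x. b \<le> g x" and b: "0 < b" and L: "0 \<le> L"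
  shows "hcone (L * D / b) (\<lambda>x. ennreal (g x))"
  unfolding hcone_def
proof (intro ballI)
  fix x y assume xy: "x \<in> G" "y \<in> G"
  have "dist x y \<le> D * dist x y powr \<eta>"
  proof (cases "dist x y = 0")
    case False
    then have "dist x y = dist x y powr (1 - \<eta>) * dist x y powr \<eta>"
      by (simp add: powr_add[symmetric])
    also have "\<dots> \<le> D powr (1 - \<eta>) * dist x y powr \<eta>"
      using diam[OF xy] \<eta>_le_1 by (intro mult_right_mono powr_mono2) auto
    also have "\<dots> \<le> D powr 1 * dist x y powr \<eta>"
      using D_ge_1 \<eta>_pos by (intro mult_right_mono powr_mono) auto
    finally show ?thesis using D_ge_1 by simp
  qed auto
  then have "L * dist x y \<le> L * (D * dist x y powr \<eta>)" using L by (rule mult_left_mono)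
  also have "\<dots> = L * D / b * dist x y powr \<eta> * b" using b by simp
  also have "\<dots> \<le> L * D / b * dist x y powr \<eta> * g y"
    using low[of y] L b D_ge_1 by (intro mult_left_mono) auto
  finally have "g x \<le> (1 + L * D / b * dist x y powr \<eta>) * g y"
    using g[of x y] by (simp add: algebra_simps)
  also have "\<dots> \<le> exp (L * D / b * dist x y powr \<eta>) * g y"
    using low[of y] b by (intro mult_right_mono exp_ge_add_one_self) auto
  finally show "ennreal (g x) \<le> ennreal (exp (L * D / b * dist x y powr \<eta>)) * ennreal (g y)"
    using low[of y] b by (subst ennreal_mult[symmetric]) (auto intro!: ennreal_leI)
qed

definition q :: "nat \<Rightarrow> 'a \<Rightarrow> ennreal" where
  "q n = (Q ^^ n) (\<lambda>_. ennreal (1 / V))"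

lemma q_measurable [measurable]: "q n \<in> borel_measurable M"
  by (simp add: q_def)

lemma nn_integral_q: "(\<integral>\<^sup>+ x. q n x \<partial>M) = 1"
  unfolding q_def using M_pos
  by (subst nn_integral_Qn) (auto simp: emeasure_eq_measure ennreal_mult[symmetric])

lemma hcone_const: "0 \<le> K \<Longrightarrow> hcone K (\<lambda>_. c)"
  unfolding hcone_def using mult_right_mono[of 1 _ c] by fastforce

lemma hcone_q: "hcone K\<^sub>0 (q n)"
proof (induction n)
  case 0
  show ?case using K\<^sub>0_ge_1 hcone_const[of K\<^sub>0] by (simp add: q_def)
next
  case (Suc n)
  then have "hcone (K\<^sub>0 - 1) (Q (q n))" by (intro cone_Q_gain) auto
  then show ?case by (auto simp: q_def intro: cone_mono)
qed

text \<open>The sum of the two truncated differences is \<open>\<bar>h - g\<bar>\<close>.\<close>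

definition L1_dist :: "('a \<Rightarrow> ennreal) \<Rightarrow> ('a \<Rightarrow> ennreal) \<Rightarrow> ennreal" where
  "L1_dist h g = (\<integral>\<^sup>+ x. (h x - g x) + (g x - h x) \<partial>M)"

lemma le_add_diff_ennreal: "(a::ennreal) \<le> b + (a - b)"
  by (metis add.commute add_diff_self_ennreal le_cases order_refl order_trans zero_le add_increasing2)

text \<open>Write \<open>h\<close> as \<open>(Q ^^ n) h\<close> and replace \<open>h\<close> by a
  Lipschitz function shifted into a cone; if \<open>c\<close> is the integral of the latter, its
  iterates approach \<open>c * q n\<close> uniformly. The error is a function \<open>E\<close> and
  not a number, because \<open>Q\<close> controls the approximation error only in integral. The cone
  constant depends on \<open>e\<close>, but this affects only the choice of
  \<open>n\<close>.\<close>

lemma q_near_invariant: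
  assumes [measurable]: "h \<in> borel_measurable M" and int: "(\<integral>\<^sup>+ x. h x \<partial>M) = 1"
    and inv: "AE x in M. Q h x = h x"
    and approx: "\<And>e. e > 0 \<Longrightarrow> \<exists>g L. (\<forall>x y. \<bar>g x - g y\<bar> \<le> L * dist x y) \<and> (\<forall>x. 0 \<le> g x) \<and>
        g \<in> borel_measurable M \<and> L1_dist h (\<lambda>x. ennreal (g x)) \<le> ennreal e"
    and e: "0 < e"
  shows "\<exists>n E. E \<in> borel_measurable M \<and> (\<integral>\<^sup>+ x. E x \<partial>M) \<le> ennreal e \<and>
    (AE x in M. h x \<le> q n x + E x \<and> q n x \<le> h x + E x)"
proof -
  \<comment> \<open>The four contributions to the integral of \<open>E\<close> below are at most
    \<open>2 * d\<close>, \<open>d\<close>, \<open>d\<close> and \<open>d\<close>.\<close>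
  define d where "d = e / 5"
  have d: "0 < d" using e by (simp add: d_def)
  obtain g L where g: "\<And>x y. \<bar>g x - g y\<bar> \<le> L * dist x y" "\<And>x. 0 \<le> g x"
      and [measurable]: "g \<in> borel_measurable M" and gd: "L1_dist h (\<lambda>x. ennreal (g x)) \<le> ennreal d"
    using approx[OF d] by blast
  define E' where "E' x = (h x - ennreal (g x)) + (ennreal (g x) - h x)" for x
  have [measurable]: "E' \<in> borel_measurable M" by (simp add: E'_def[abs_def])
  have E': "(\<integral>\<^sup>+ x. E' x \<partial>M) \<le> ennreal d" using gd by (simp add: L1_dist_def E'_def)
  have hg: "h x \<le> ennreal (g x) + E' x" for x
    using le_add_diff_ennreal[of "h x" "ennreal (g x)"]
    by (auto simp: E'_def intro: order_trans add_left_mono)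
  have gh: "ennreal (g x) \<le> h x + E' x" for x
    using le_add_diff_ennreal[of "ennreal (g x)" "h x"]
    by (auto simp: E'_def intro: order_trans add_left_mono)
  \<comment> \<open>The shift by \<open>b\<close> supplies the lower bound for
    \<open>lipschitz_hcone\<close> and has integral \<open>d\<close>.\<close>
  define b where "b = d / V"
  have b: "0 < b" "b * V = d" using d M_pos by (auto simp: b_def)
  define u where "u x = ennreal (g x + b)" for x
  have [measurable]: "u \<in> borel_measurable M" by (simp add: u_def[abs_def])
  have u: "u x = ennreal (g x) + ennreal b" for x using g(2) b by (simp add: u_def)
  have bV: "ennreal b * ennreal V = ennreal d" using b by (simp add: ennreal_mult[symmetric])
  have int_b: "(\<integral>\<^sup>+ x. ennreal b \<partial>M) = ennreal d"
    using b by (simp add: emeasure_eq_measure ennreal_mult[symmetric])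
  have ug: "(\<integral>\<^sup>+ x. u x \<partial>M) = (\<integral>\<^sup>+ x. ennreal (g x) \<partial>M) + ennreal d"
    unfolding u by (subst nn_integral_add) (auto simp: int_b simp del: nn_integral_const)
  have "(\<integral>\<^sup>+ x. ennreal (g x) \<partial>M) \<le> (\<integral>\<^sup>+ x. h x + E' x \<partial>M)" by (intro nn_integral_mono gh)
  also have "\<dots> \<le> 1 + ennreal d" using E' by (subst nn_integral_add) (auto simp: int intro: add_left_mono)
  also have "\<dots> = ennreal (1 + d)" using d by simp
  finally have g_up: "(\<integral>\<^sup>+ x. ennreal (g x) \<partial>M) \<le> ennreal (1 + d)" .
  obtain c' where c': "(\<integral>\<^sup>+ x. ennreal (g x) \<partial>M) = ennreal c'" "0 \<le> c'"
    using g_up by (cases "\<integral>\<^sup>+ x. ennreal (g x) \<partial>M") (auto simp: top_unique)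
  have "1 \<le> (\<integral>\<^sup>+ x. ennreal (g x) + E' x \<partial>M)" unfolding int[symmetric] by (intro nn_integral_mono hg)
  also have "\<dots> \<le> ennreal c' + ennreal d" using E' by (subst nn_integral_add) (auto simp: c' intro: add_left_mono)
  also have "\<dots> = ennreal (c' + d)" using c' d by simp
  finally have "1 \<le> c' + d" using c' d by (subst (asm) ennreal_1[symmetric], subst (asm) ennreal_le_iff) auto
  moreover have "c' \<le> 1 + d" using g_up c' d by (subst (asm) c'(1), subst (asm) ennreal_le_iff) auto
  moreover define c where "c = c' + d"
  ultimately have c: "1 \<le> c" "c \<le> 1 + 2 * d" by auto
  have u_int: "(\<integral>\<^sup>+ x. u x \<partial>M) = ennreal c" using ug c' d by (simp add: c_def)
  define K where "K = max K\<^sub>0 (\<bar>L\<bar> * D / b)"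
  have K: "K\<^sub>0 \<le> K" by (simp add: K_def)
  have "hcone (\<bar>L\<bar> * D / b) u"
    unfolding u_def
  proof (rule lipschitz_hcone)
    show "\<bar>(g x + b) - (g y + b)\<bar> \<le> \<bar>L\<bar> * dist x y" for x y
      using g(1)[of x y] mult_right_mono[OF abs_ge_self[of L] zero_le_dist[of x y]] by simp
  qed (use g(2) b in auto)
  then have uK: "hcone K u" by (rule cone_mono) (simp add: K_def)
  let ?w = "\<lambda>_. ennreal c * ennreal (1 / V)"
  have w: "(\<lambda>x. ?w x) \<in> borel_measurable M" "hcone K ?w" "(\<integral>\<^sup>+ x. ?w x \<partial>M) = ennreal c"
    using K K\<^sub>0_ge_1 c M_pos by (auto intro!: hcone_const simp: emeasure_eq_measure ennreal_mult[symmetric])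
  have Qw: "(Q ^^ n) ?w x = ennreal c * q n x" for n x
    unfolding q_def by (rule Qn_cmult)
  define B where "B = exp (K * D) * c / V"
  have "(\<lambda>n. B * \<gamma> K ^ n * V) \<longlonglongrightarrow> 0"
    using \<gamma>_range[of K] K K\<^sub>0_ge_1
    by (intro tendsto_mult_left_zero tendsto_mult_right_zero LIMSEQ_realpow_zero) auto
  from order_tendstoD(2)[OF this d] obtain n where n: "B * \<gamma> K ^ n * V < d"
    by (auto simp: eventually_sequentially)
  have Bn: "0 \<le> B * \<gamma> K ^ n"
    using \<gamma>_range[of K] K K\<^sub>0_ge_1 c M_pos by (auto simp: B_def)
  \<comment> \<open>In order: the excess of the mass \<open>c\<close> over 1, the uniform decay
    error, the pushed-forward approximation error, the pushed-forward shift.\<close>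
  define E where "E x = (ennreal (c - 1) * q n x + ennreal (B * \<gamma> K ^ n)) + ((Q ^^ n) E' x + (Q ^^ n) (\<lambda>_. ennreal b) x)" for x
  have [measurable]: "E \<in> borel_measurable M" unfolding E_def by measurable
  have "(\<integral>\<^sup>+ x. E x \<partial>M) = (ennreal (c - 1) + ennreal (B * \<gamma> K ^ n * V)) + ((\<integral>\<^sup>+ x. E' x \<partial>M) + ennreal d)"
    unfolding E_def using Bn
    by (simp add: nn_integral_add nn_integral_cmult nn_integral_Qn nn_integral_q bV
        emeasure_eq_measure ennreal_mult)
  also have "\<dots> \<le> (ennreal (2 * d) + ennreal d) + (ennreal d + ennreal d)"
    using c n E' by (intro add_mono ennreal_leI) auto
  also have "\<dots> = ennreal e" using d by (simp add: ennreal_plus[symmetric] d_def del: ennreal_plus)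
  finally have "(\<integral>\<^sup>+ x. E x \<partial>M) \<le> ennreal e" .
  moreover have "AE x in M. h x \<le> q n x + E x \<and> q n x \<le> h x + E x"
    using AE_G Qn_invariant[OF assms(1) inv, of n]
  proof eventually_elim
    case (elim x)
    have 1: "(Q ^^ n) u x \<le> ennreal c * q n x + ennreal (B * \<gamma> K ^ n)"
      using decay_ennreal[OF _ uK u_int w _ K elim(1), of n] c by (simp add: Qw B_def)
    have 2: "ennreal c * q n x \<le> (Q ^^ n) u x + ennreal (B * \<gamma> K ^ n)"
      using decay_ennreal[OF w _ uK u_int _ K elim(1), of n] c by (simp add: Qw B_def)
    have cq: "ennreal c * q n x = q n x + ennreal (c - 1) * q n x"
    proof -
      have "ennreal c = 1 + ennreal (c - 1)" using c by (simp add: ennreal_1[symmetric] ennreal_plus[symmetric] del: ennreal_1 ennreal_plus)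
      then show ?thesis by (simp add: distrib_right)
    qed
    have "h x = (Q ^^ n) h x" using elim by simp
    also have "\<dots> \<le> (Q ^^ n) (\<lambda>x. u x + E' x) x"
      using elim(1) by (intro Qn_mono) (auto simp: u intro: order_trans[OF hg] add_right_mono)
    also have "\<dots> = (Q ^^ n) u x + (Q ^^ n) E' x" by (rule Qn_add)
    also have "\<dots> \<le> (ennreal c * q n x + ennreal (B * \<gamma> K ^ n)) + ((Q ^^ n) E' x + (Q ^^ n) (\<lambda>_. ennreal b) x)"
      using 1 by (intro add_mono) auto
    also have "\<dots> = q n x + E x" by (simp add: E_def cq add_ac)
    finally have *: "h x \<le> q n x + E x" .
    have "q n x \<le> ennreal c * q n x" by (simp add: cq)
    also note 2
    also have "(Q ^^ n) u x \<le> (Q ^^ n) (\<lambda>x. h x + (E' x + ennreal b)) x"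
      using elim(1) gh by (intro Qn_mono) (auto simp: u add.assoc[symmetric] intro: add_right_mono)
    also have "\<dots> = h x + ((Q ^^ n) E' x + (Q ^^ n) (\<lambda>_. ennreal b) x)"
      using elim(2) by (simp add: Qn_add)
    finally have "q n x \<le> h x + ((Q ^^ n) E' x + (Q ^^ n) (\<lambda>_. ennreal b) x) + ennreal (B * \<gamma> K ^ n)"
      by (simp add: add_right_mono)
    also have "\<dots> \<le> h x + E x" by (auto simp: E_def add_ac intro!: add_left_mono)
    finally show ?case using * by simp
  qed
  ultimately show ?thesis by (intro exI[of _ n] exI[of _ E]) auto
qed

text \<open>All \<open>q n\<close> lie in the cone with the single constant
  \<open>K\<^sub>0\<close>, which the Lipschitz approximants need not do, so the cone condition is
  inherited from the \<open>q n\<close>. Choosing errors that are summable in integral forces them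
  to 0 almost everywhere, without passing to a further subsequence.\<close>

lemma invariant_density_hcone:
  assumes h [measurable]: "h \<in> borel_measurable M" and int: "(\<integral>\<^sup>+ x. h x \<partial>M) = 1"
    and inv: "AE x in M. Q h x = h x"
    and approx: "\<And>e. e > 0 \<Longrightarrow> \<exists>g L. (\<forall>x y. \<bar>g x - g y\<bar> \<le> L * dist x y) \<and> (\<forall>x. 0 \<le> g x) \<and>
        g \<in> borel_measurable M \<and> L1_dist h (\<lambda>x. ennreal (g x)) \<le> ennreal e"
  obtains h' where "h' \<in> borel_measurable M" "hcone K\<^sub>0 h'" "AE x in M. h x = h' x"
proof -
  have "\<forall>k. \<exists>n E. E \<in> borel_measurable M \<and> (\<integral>\<^sup>+ x. E x \<partial>M) \<le> ennreal ((1 / 2) ^ k) \<and>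
    (AE x in M. h x \<le> q n x + E x \<and> q n x \<le> h x + E x)"
    using q_near_invariant[OF h int inv approx] by simp
  from choice[OF this] obtain n where "\<forall>k. \<exists>E. E \<in> borel_measurable M \<and>
    (\<integral>\<^sup>+ x. E x \<partial>M) \<le> ennreal ((1 / 2) ^ k) \<and>
    (AE x in M. h x \<le> q (n k) x + E x \<and> q (n k) x \<le> h x + E x)" ..
  from choice[OF this] obtain E where [measurable]: "\<And>k. E k \<in> borel_measurable M"
    and E: "\<And>k. (\<integral>\<^sup>+ x. E k x \<partial>M) \<le> ennreal ((1 / 2) ^ k)"
    and hq: "\<And>k. AE x in M. h x \<le> q (n k) x + E k x \<and> q (n k) x \<le> h x + E k x"
    by blast
  have "(\<integral>\<^sup>+ x. (\<Sum>k. E k x) \<partial>M) = (\<Sum>k. \<integral>\<^sup>+ x. E k x \<partial>M)" by (rule nn_integral_suminf) auto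
  also have "\<dots> \<le> (\<Sum>k. ennreal ((1 / 2) ^ k))" by (intro suminf_le E) auto
  also have "\<dots> = ennreal 2"
    by (rule sums_unique[symmetric]) (subst sums_ennreal, auto simp: geometric_sums[of "1/2::real", simplified])
  finally have "(\<integral>\<^sup>+ x. (\<Sum>k. E k x) \<partial>M) < \<infinity>" by (auto intro: le_less_trans)
  then have Ef: "AE x in M. (\<Sum>k. E k x) \<noteq> \<infinity>" by (intro nn_integral_noteq_infinite) auto
  have hf: "AE x in M. h x \<noteq> \<infinity>" by (intro nn_integral_noteq_infinite) (auto simp: int)
  \<comment> \<open>The lower limit exists at every point, so the cone inequality holds on all of
    \<open>G\<close>, even where \<open>q (n k)\<close> does not converge.\<close>
  define h' where "h' x = liminf (\<lambda>k. q (n k) x)" for x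
  have "AE x in M. \<forall>k. h x \<le> q (n k) x + E k x \<and> q (n k) x \<le> h x + E k x"
    using hq by (simp add: AE_all_countable)
  with Ef hf have "AE x in M. h x = h' x"
  proof eventually_elim
    case (elim x)
    have E0: "(\<lambda>k. E k x) \<longlonglongrightarrow> 0"
    proof -
      have fin: "E k x \<noteq> \<top>" for k
      proof -
        have "E k x \<le> (\<Sum>k. E k x)" using sum_le_suminf[of "\<lambda>k. E k x" "{k}"] by simp
        then show ?thesis using elim(1) by (auto simp: top_unique)
      qed
      then have eq: "E k x = ennreal (enn2real (E k x))" for k by (simp add: less_top)
      have "summable (\<lambda>k. enn2real (E k x))"
        by (rule summable_suminf_not_top) (use elim(1) eq in auto)
      then have "(\<lambda>k. enn2real (E k x)) \<longlonglongrightarrow> 0" by (rule summable_LIMSEQ_zero)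
      then have "(\<lambda>k. ennreal (enn2real (E k x))) \<longlonglongrightarrow> ennreal 0" by (intro tendsto_ennrealI)
      then show ?thesis using eq by simp
    qed
    have "(\<lambda>k. q (n k) x) \<longlonglongrightarrow> h x"
    proof (rule tendsto_sandwich)
      show "(\<lambda>k. h x - E k x) \<longlonglongrightarrow> h x"
        using tendsto_diff_ennreal[OF tendsto_const E0, of "h x"] elim(2) by simp
      show "(\<lambda>k. h x + E k x) \<longlonglongrightarrow> h x"
        using tendsto_add[OF tendsto_const E0, of "h x"] by simp
      show "\<forall>\<^sub>F k in sequentially. q (n k) x \<le> h x + E k x" using elim(3) by simp
      show "\<forall>\<^sub>F k in sequentially. h x - E k x \<le> q (n k) x"
        using elim(2,3) by (auto intro!: always_eventually simp: ennreal_minus_le_iff add.commute)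
    qed
    then show ?case unfolding h'_def by (rule lim_imp_Liminf[symmetric, rotated]) simp
  qed
  moreover have "hcone K\<^sub>0 h'"
    unfolding hcone_def
  proof (intro ballI)
    fix x y assume xy: "x \<in> G" "y \<in> G"
    let ?c = "ennreal (exp (K\<^sub>0 * dist x y powr \<eta>))"
    have "h' x \<le> liminf (\<lambda>k. ?c * q (n k) y)"
      unfolding h'_def using hcone_q xy by (intro Liminf_mono always_eventually) (auto simp: hcone_def)
    also have "\<dots> = ?c * h' y"
      unfolding h'_def
      by (rule Liminf_compose_continuous_mono)
        (auto intro!: ennreal_continuous_on_cmult monoI mult_left_mono)
    finally show "h' x \<le> ?c * h' y" .
  qed
  moreover have "h' \<in> borel_measurable M" unfolding h'_def by measurable
  ultimately show ?thesis by (intro that)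
qed

end

section \<open>The series of transfer operator iterates\<close>

locale invariant_branch_system = branch_system M G I \<psi> J F \<eta> \<theta> C D
  for M :: "'a::metric_space measure" and G :: "'a set" and I :: "'i set" and \<psi> J F \<eta> \<theta> C D +
  fixes h :: "'a \<Rightarrow> ennreal" and K :: real and \<mu> :: "'a measure"
  assumes h_measurable [measurable]: "h \<in> borel_measurable M"
    and K_nonneg: "0 \<le> K"
    and h_hcone: "hcone K h"
    and h_int: "(\<integral>\<^sup>+ x. h x \<partial>M) = 1"
    and \<mu>_density: "\<mu> = density M h"
begin

section \<open>Passage from the reference measure to the invariant measure\<close>

definition hr :: "'a \<Rightarrow> real" where "hr x = enn2real (h x)"

text \<open>The reciprocal of the lower bound in \<open>cone_lower\<close> for a function of
  integral 1.\<close>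

definition R :: real where "R = V * exp (K * D)"

lemma R_pos: "0 < R" using M_pos by (simp add: R_def)

lemma hr_measurable [measurable]: "hr \<in> borel_measurable M"
  by (simp add: hr_def[abs_def])

lemma
  assumes x: "x \<in> G"
  shows h_eq: "h x = ennreal (hr x)" and hr_pos: "0 < hr x" and inverse_hr_le: "1 / hr x \<le> R"
proof -
  have int: "(\<integral>\<^sup>+ x. h x \<partial>M) = ennreal 1" by (simp add: h_int)
  have up: "h x \<le> ennreal (exp (K * D) * 1 / V)"
    using cone_upper[OF _ h_hcone K_nonneg int _ x] by simp
  have low: "ennreal (exp (- K * D) * 1 / V) \<le> h x"
    using cone_lower[OF _ h_hcone K_nonneg int _ x] by simp
  show eq: "h x = ennreal (hr x)"
    using up by (auto simp: hr_def intro!: ennreal_enn2real[symmetric] le_less_trans[OF up])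
  have "exp (- K * D) * 1 / V \<le> hr x"
    using low unfolding eq by (subst (asm) ennreal_le_iff) (auto simp: hr_def)
  then have "1 / R \<le> hr x" by (simp add: R_def exp_minus field_simps)
  moreover have "0 < 1 / R" using R_pos by simp
  ultimately show pos: "0 < hr x" by (rule less_le_trans[rotated])
  show "1 / hr x \<le> R" using \<open>1 / R \<le> hr x\<close> pos R_pos by (simp add: field_simps)
qed

text \<open>The cone condition is stable under reciprocals, with the two points exchanged, so the
  conversion to a Hoelder bound applies to \<open>1 / hr\<close> with supremum
  \<open>R\<close>.\<close>

lemma inverse_hr_hoelder:
  assumes "x \<in> G" "y \<in> G"
  shows "\<bar>1 / hr x - 1 / hr y\<bar> \<le> R * K * exp (K * D) * dist x y powr \<eta>"
proof (rule hcone_real_bounds[OF _ _ K_nonneg assms])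
  fix x y assume xy: "x \<in> G" "y \<in> G"
  have "h y \<le> ennreal (exp (K * dist y x powr \<eta>)) * h x" using h_hcone xy by (auto simp: hcone_def)
  then have "ennreal (hr y) \<le> ennreal (exp (K * dist x y powr \<eta>) * hr x)"
    using xy hr_pos[OF xy(1)] by (simp add: h_eq ennreal_mult dist_commute)
  then have "hr y \<le> exp (K * dist x y powr \<eta>) * hr x"
    using hr_pos[OF xy(1)] by (subst (asm) ennreal_le_iff) auto
  then show "1 / hr x \<le> exp (K * dist x y powr \<eta>) * (1 / hr y)"
    using hr_pos xy by (simp add: field_simps)
qed (use hr_pos inverse_hr_le in \<open>auto intro: less_imp_le\<close>)

lemma sets_\<mu> [measurable_cong]: "sets \<mu> = sets M"
  by (simp add: \<mu>_density)

lemma AE_\<mu>: "(AE x in M. P x) \<Longrightarrow> (AE x in \<mu>. P x)"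
  by (subst \<mu>_density) (auto simp: AE_density elim: eventually_mono)

lemma prob_space_\<mu>: "prob_space \<mu>"
  by (rule prob_spaceI) (simp add: \<mu>_density emeasure_density h_int space_density cong: nn_integral_cong)

lemma \<mu>_eq: "\<mu> = density M (\<lambda>x. ennreal (hr x))"
  unfolding \<mu>_density using AE_G by (intro density_cong) (auto simp: h_eq)

text \<open>The density with respect to \<mu> of the measure with density \<open>U\<close> with
  respect to \<open>M\<close>. Passing to it conjugates \<open>Q\<close> into the transfer operator
  of \<mu>, as \<open>weight_dual\<close> expresses.\<close>

definition weight :: "('a \<Rightarrow> ennreal) \<Rightarrow> 'a \<Rightarrow> real" where
  "weight U x = enn2real (U x) / hr x"

lemma
  assumes [measurable]: "U \<in> borel_measurable M" and fin: "(\<integral>\<^sup>+ x. U x \<partial>M) < \<infinity>"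
  shows weight_integrable: "integrable \<mu> (weight U)"
    and weight_integral: "w \<in> borel_measurable M \<Longrightarrow>
      (\<integral>x. w x * weight U x \<partial>\<mu>) = (\<integral>x. w x \<partial>density M U)"
proof -
  have U_fin: "AE x in M. U x = ennreal (enn2real (U x))"
    using nn_integral_noteq_infinite[of U M] fin by (auto elim!: eventually_mono simp: less_top)
  have "(\<integral>\<^sup>+ x. ennreal (enn2real (U x)) \<partial>M) = (\<integral>\<^sup>+ x. U x \<partial>M)"
    using U_fin by (intro nn_integral_cong_AE) (auto elim: eventually_mono)
  then have U_int: "integrable M (\<lambda>x. enn2real (U x))"
    using fin by (intro integrableI_nonneg) auto
  have eq: "AE x in M. hr x *\<^sub>R weight U x = enn2real (U x)"
    using AE_G by eventually_elim (use hr_pos in \<open>force simp: weight_def\<close>)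
  have [measurable]: "weight U \<in> borel_measurable M" by (simp add: weight_def[abs_def])
  have hr0: "AE x in M. 0 \<le> hr x" by (simp add: hr_def)
  have "integrable M (\<lambda>x. hr x *\<^sub>R weight U x)"
    using U_int by (subst integrable_cong_AE[OF _ _ eq]) auto
  then show "integrable \<mu> (weight U)"
    unfolding \<mu>_eq by (subst integrable_density[OF _ _ hr0]) auto
  assume [measurable]: "w \<in> borel_measurable M"
  have "(\<integral>x. w x * weight U x \<partial>\<mu>) = (\<integral>x. hr x *\<^sub>R (w x * weight U x) \<partial>M)"
    unfolding \<mu>_eq by (rule integral_density[OF _ _ hr0]) auto
  also have "\<dots> = (\<integral>x. enn2real (U x) *\<^sub>R w x \<partial>M)"
    using eq by (intro integral_cong_AE) (auto elim!: eventually_mono simp: mult_ac)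
  also have "\<dots> = (\<integral>x. w x \<partial>density M (\<lambda>x. ennreal (enn2real (U x))))"
    by (rule integral_density[symmetric]) auto
  also have "density M (\<lambda>x. ennreal (enn2real (U x))) = density M U"
    using U_fin by (intro density_cong) (auto elim: eventually_mono)
  finally show "(\<integral>x. w x * weight U x \<partial>\<mu>) = (\<integral>x. w x \<partial>density M U)" .
qed

lemma weight_dual:
  assumes [measurable]: "U \<in> borel_measurable M" and fin: "(\<integral>\<^sup>+ x. U x \<partial>M) < \<infinity>"
    and [measurable]: "w \<in> borel_measurable M"
  shows "(\<integral>x. w x * weight (Q U) x \<partial>\<mu>) = (\<integral>x. w (F x) * weight U x \<partial>\<mu>)"
proof -
  have "(\<integral>x. w x * weight (Q U) x \<partial>\<mu>) = (\<integral>x. w x \<partial>density M (Q U))"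
    using fin by (intro weight_integral) (auto simp: nn_integral_Q)
  also have "\<dots> = (\<integral>x. w x \<partial>distr (density M U) M F)" by (simp add: density_Q)
  also have "\<dots> = (\<integral>x. w (F x) \<partial>density M U)" by (rule integral_distr) auto
  also have "\<dots> = (\<integral>x. w (F x) * weight U x \<partial>\<mu>)" using fin by (intro weight_integral[symmetric]) auto
  finally show ?thesis .
qed

lemma F_measurable_\<mu>: "F \<in> measurable \<mu> \<mu>"
  using F_measurable measurable_cong_sets[OF sets_\<mu> sets_\<mu>] by blast

end

text \<open>The bounds fit a sum of \<tau> terms along an orbit: size and Hoelder constant on a
  branch grow like \<tau>, and distances are measured after the return. Only the \<mu>-integral of
  \<tau> is under control, not its supremum.\<close>

locale branch_observable = invariant_branch_system M G I \<psi> J F \<eta> \<theta> C D h K \<mu>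
  for M :: "'a::metric_space measure" and G :: "'a set" and I :: "'i set" and \<psi> J F \<eta> \<theta> C D h K \<mu> +
  fixes \<tau> :: "'a \<Rightarrow> nat" and \<Phi> :: "'a \<Rightarrow> 'b::euclidean_space" and B H :: real
  assumes inv: "distr \<mu> \<mu> F = \<mu>"
    and \<tau>_integrable: "integrable \<mu> (\<lambda>x. real (\<tau> x))"
    and \<Phi>_measurable [measurable]: "\<Phi> \<in> borel_measurable M"
    and B_nonneg: "0 \<le> B" and H_nonneg: "0 \<le> H"
    and \<Phi>_bound: "\<And>x b. x \<in> space M \<Longrightarrow> b \<in> Basis \<Longrightarrow> \<bar>\<Phi> x \<bullet> b\<bar> \<le> B * \<tau> x"
    and \<tau>_branch: "\<And>a x y. a \<in> I \<Longrightarrow> x \<in> G \<Longrightarrow> y \<in> G \<Longrightarrow> \<tau> (\<psi> a x) = \<tau> (\<psi> a y)"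
    and \<Phi>_branch: "\<And>a x y b. a \<in> I \<Longrightarrow> x \<in> G \<Longrightarrow> y \<in> G \<Longrightarrow> b \<in> Basis \<Longrightarrow>
        \<bar>\<Phi> (\<psi> a x) \<bullet> b - \<Phi> (\<psi> a y) \<bullet> b\<bar> \<le> H * \<tau> (\<psi> a x) * dist x y powr \<eta>"
    and \<Phi>_mean: "(\<integral>x. \<Phi> x \<partial>\<mu>) = 0"
begin

lemma \<tau>_measurable [measurable]: "(\<lambda>x. real (\<tau> x)) \<in> borel_measurable M"
  using borel_measurable_integrable[OF \<tau>_integrable] by simp

text \<open>Adding \<open>(B + 1) \<tau>\<close> makes each component of \<open>\<Phi>\<close> positive and log-Hoelder on branches; the
  same multiple of \<open>\<tau>\<close> alone has the same mean, and the difference of the two is \<open>\<Phi>\<close>.\<close>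

definition U :: "'b \<Rightarrow> 'a \<Rightarrow> ennreal" where
  "U b x = ennreal (\<Phi> x \<bullet> b + (B + 1) * \<tau> x) * h x"

lemma U_measurable [measurable]: "U b \<in> borel_measurable M"
  unfolding U_def by measurable

definition mass :: real where "mass = (\<integral>x. (B + 1) * \<tau> x \<partial>\<mu>)"

lemma mass_nonneg: "0 \<le> mass"
  unfolding mass_def using B_nonneg by (intro integral_nonneg_AE) auto

lemma G_space: "x \<in> G \<Longrightarrow> x \<in> space M"
  using sets.sets_into_space[OF G_sets] by auto

lemma \<Phi>_integrable: "integrable \<mu> \<Phi>"
proof (rule Bochner_Integration.integrable_bound)
  show "integrable \<mu> (\<lambda>x. DIM('b) * (B * real (\<tau> x)))" using \<tau>_integrable by simp
  show "AE x in \<mu>. norm (\<Phi> x) \<le> norm (DIM('b) * (B * real (\<tau> x)))"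
  proof (rule AE_I2)
    fix x assume "x \<in> space \<mu>"
    then have x: "x \<in> space M" using sets_eq_imp_space_eq[OF sets_\<mu>] by simp
    have "norm (\<Phi> x) \<le> (\<Sum>b\<in>Basis. \<bar>\<Phi> x \<bullet> b\<bar>)" by (rule norm_le_l1)
    also have "\<dots> \<le> DIM('b) * (B * real (\<tau> x))" by (rule sum_bounded_above) (rule \<Phi>_bound[OF x])
    finally show "norm (\<Phi> x) \<le> norm (DIM('b) * (B * real (\<tau> x)))" by simp
  qed
qed measurable

text \<open>Taking \<open>b = 0\<close> removes \<open>\<Phi>\<close> and leaves the comparison
  function, so \<open>insert 0 Basis\<close> treats both functions at once. The \<open>1\<close> in
  \<open>B + 1\<close> leaves a reserve of \<tau>, not mere nonnegativity, and the cone estimate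
  lives on this reserve.\<close>

lemma \<Phi>_component_nonneg:
  "x \<in> space M \<Longrightarrow> b \<in> insert 0 Basis \<Longrightarrow> \<tau> x \<le> \<Phi> x \<bullet> b + (B + 1) * \<tau> x"
  using \<Phi>_bound[of x b] B_nonneg by (auto simp: abs_le_iff distrib_right)

lemma U_int:
  assumes b: "b \<in> insert 0 Basis"
  shows "(\<integral>\<^sup>+ x. U b x \<partial>M) = ennreal mass"
proof -
  have int: "integrable \<mu> (\<lambda>x. \<Phi> x \<bullet> b)" using \<Phi>_integrable by auto
  have "(\<integral>\<^sup>+ x. U b x \<partial>M) = (\<integral>\<^sup>+ x. ennreal (\<Phi> x \<bullet> b + (B + 1) * \<tau> x) \<partial>\<mu>)"
    unfolding U_def \<mu>_density by (subst nn_integral_density) (auto simp: mult.commute)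
  also have "\<dots> = ennreal (\<integral>x. \<Phi> x \<bullet> b + (B + 1) * \<tau> x \<partial>\<mu>)"
  proof (rule nn_integral_eq_integral)
    show "integrable \<mu> (\<lambda>x. \<Phi> x \<bullet> b + (B + 1) * \<tau> x)" using int \<tau>_integrable by simp
    show "AE x in \<mu>. 0 \<le> \<Phi> x \<bullet> b + (B + 1) * \<tau> x"
    proof (rule AE_I2)
      fix x assume "x \<in> space \<mu>"
      then have x: "x \<in> space M" using sets_eq_imp_space_eq[OF sets_\<mu>] by simp
      have "0 \<le> real (\<tau> x)" by simp
      also note \<Phi>_component_nonneg[OF x b]
      finally show "0 \<le> \<Phi> x \<bullet> b + (B + 1) * \<tau> x" .
    qed
  qed
  also have "(\<integral>x. \<Phi> x \<bullet> b + (B + 1) * \<tau> x \<partial>\<mu>) = (\<integral>x. \<Phi> x \<bullet> b \<partial>\<mu>) + mass"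
    unfolding mass_def using int \<tau>_integrable by simp
  also have "(\<integral>x. \<Phi> x \<bullet> b \<partial>\<mu>) = 0" using \<Phi>_integrable \<Phi>_mean by simp
  finally show ?thesis by simp
qed

text \<open>The Hoelder constant of \<open>\<Phi>\<close> on a branch is of order
  \<open>H * \<tau>\<close> and the first factor of \<open>U b\<close> is at least \<tau>, so the
  growth of \<tau> cancels in the relative oscillation. The factor \<open>h\<close> contributes
  \<open>K * \<theta>\<close>.\<close>

lemma U_branch_cone:
  assumes b: "b \<in> insert 0 Basis"
  shows "branch_cone (H + K * \<theta>) (U b)"
  unfolding branch_cone_def
proof (intro ballI)
  fix a x y assume a: "a \<in> I" and xy: "x \<in> G" "y \<in> G"
  let ?d = "dist x y powr \<eta>" and ?f = "\<lambda>x. \<Phi> x \<bullet> b + (B + 1) * \<tau> x"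
  have \<tau>: "\<tau> (\<psi> a y) \<le> ?f (\<psi> a y)" using \<Phi>_component_nonneg[OF G_space[OF \<psi>_G[OF a xy(2)]] b] .
  have "\<bar>\<Phi> (\<psi> a x) \<bullet> b - \<Phi> (\<psi> a y) \<bullet> b\<bar> \<le> H * \<tau> (\<psi> a y) * ?d"
    using \<Phi>_branch[OF a xy] b H_nonneg \<tau>_branch[OF a xy] by (cases "b = 0") auto
  also have "\<dots> \<le> H * ?f (\<psi> a y) * ?d"
    using H_nonneg \<tau> by (intro mult_right_mono mult_left_mono) auto
  finally have "?f (\<psi> a x) \<le> (1 + H * ?d) * ?f (\<psi> a y)"
    using \<tau>_branch[OF a xy] by (simp add: algebra_simps abs_le_iff)
  also have "\<dots> \<le> exp (H * ?d) * ?f (\<psi> a y)"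
    using \<tau> by (intro mult_right_mono exp_ge_add_one_self) linarith
  finally have 1: "ennreal (?f (\<psi> a x)) \<le> ennreal (exp (H * ?d)) * ennreal (?f (\<psi> a y))"
    using \<tau> by (subst ennreal_mult[symmetric]) (auto intro!: ennreal_leI)
  have 2: "h (\<psi> a x) \<le> ennreal (exp (K * \<theta> * ?d)) * h (\<psi> a y)"
    using cone_imp_branch_cone[OF h_hcone K_nonneg] a xy by (auto simp: branch_cone_def)
  have "U b (\<psi> a x) \<le> (ennreal (exp (H * ?d)) * ennreal (?f (\<psi> a y))) * (ennreal (exp (K * \<theta> * ?d)) * h (\<psi> a y))"
    unfolding U_def by (intro mult_mono 1 2) auto
  also have "\<dots> = ennreal (exp (H * ?d) * exp (K * \<theta> * ?d)) * U b (\<psi> a y)"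
    by (simp add: U_def ennreal_mult mult_ac)
  also have "exp (H * ?d) * exp (K * \<theta> * ?d) = exp ((H + K * \<theta>) * ?d)"
    by (simp add: exp_add[symmetric] distrib_right)
  finally show "U b (\<psi> a x) \<le> ennreal (exp ((H + K * \<theta>) * ?d)) * U b (\<psi> a y)" .
qed

text \<open>An explicit representative of the \<open>k\<close>-th iterate of the transfer operator
  on \<open>\<Phi>\<close>, defined at every point; Hoelder estimates need one, and
  \<open>transfer\<close> fixes its values only up to null sets.\<close>

definition p :: "nat \<Rightarrow> 'a \<Rightarrow> 'b" where
  "p k x = (\<Sum>b\<in>Basis. (weight ((Q ^^ k) (U b)) x - weight ((Q ^^ k) (U 0)) x) *\<^sub>R b)"

lemma p_inner: "b \<in> Basis \<Longrightarrow> p k x \<bullet> b = weight ((Q ^^ k) (U b)) x - weight ((Q ^^ k) (U 0)) x"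
  by (simp add: p_def)

lemma weight_Qn_integrable: "b \<in> insert 0 Basis \<Longrightarrow> integrable \<mu> (weight ((Q ^^ k) (U b)))"
  by (rule weight_integrable) (use U_int[of b] in \<open>auto simp: nn_integral_Qn\<close>)

lemma p_integrable: "integrable \<mu> (p k)"
  unfolding p_def using weight_Qn_integrable
  by (intro Bochner_Integration.integrable_sum integrable_scaleR_left Bochner_Integration.integrable_diff) auto

lemma p_0: "AE x in \<mu>. p 0 x = \<Phi> x"
proof (rule AE_\<mu>, use AE_G in eventually_elim)
  fix x assume x: "x \<in> G"
  show "p 0 x = \<Phi> x"
  proof (rule euclidean_eqI)
    fix b :: 'b assume b: "b \<in> Basis"
    have "weight (U b') x = \<Phi> x \<bullet> b' + (B + 1) * \<tau> x" if "b' \<in> insert 0 Basis" for b'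
    proof -
      have "0 \<le> real (\<tau> x)" by simp
      also note \<Phi>_component_nonneg[OF G_space[OF x] that]
      finally show ?thesis
        using hr_pos[OF x] by (simp add: weight_def U_def h_eq[OF x] enn2real_mult)
    qed
    from this[of b] this[of 0] show "p 0 x \<bullet> b = \<Phi> x \<bullet> b" using b by (simp add: p_inner)
  qed
qed

lemma p_dual:
  assumes w: "ess_bounded \<mu> w"
  shows "(\<integral>x. w x *\<^sub>R p (Suc k) x \<partial>\<mu>) = (\<integral>x. w (F x) *\<^sub>R p k x \<partial>\<mu>)"
proof (rule euclidean_eqI)
  fix b :: 'b assume b: "b \<in> Basis"
  have [measurable]: "w \<in> borel_measurable M"
    using w measurable_cong_sets[OF sets_\<mu> refl, of borel] by (auto simp: ess_bounded_def)
  note wF = ess_bounded_comp[OF F_measurable_\<mu> inv w]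
  have comp: "(\<integral>x. g x *\<^sub>R p k x \<partial>\<mu>) \<bullet> b = (\<integral>x. g x * weight ((Q ^^ k) (U b)) x \<partial>\<mu>) -
      (\<integral>x. g x * weight ((Q ^^ k) (U 0)) x \<partial>\<mu>)" if g: "ess_bounded \<mu> g" for g k
  proof -
    have 1: "integrable \<mu> (\<lambda>x. g x * weight ((Q ^^ k) (U b')) x)" if "b' \<in> insert 0 Basis" for b'
      using ess_bounded_scaleR_integrable[OF g weight_Qn_integrable[OF that, of k]] by simp
    have "(\<integral>x. g x *\<^sub>R p k x \<partial>\<mu>) \<bullet> b = (\<integral>x. (g x *\<^sub>R p k x) \<bullet> b \<partial>\<mu>)"
      by (rule integral_inner_left[symmetric]) (rule ess_bounded_scaleR_integrable[OF g p_integrable])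
    also have "\<dots> = (\<integral>x. g x * weight ((Q ^^ k) (U b)) x - g x * weight ((Q ^^ k) (U 0)) x \<partial>\<mu>)"
      using b by (simp add: p_inner right_diff_distrib)
    finally show ?thesis using 1[of b] 1[of 0] b by simp
  qed
  have fin: "(\<integral>\<^sup>+ x. (Q ^^ k) (U b') x \<partial>M) < \<infinity>" if "b' \<in> insert 0 Basis" for b'
    using U_int[OF that] by (simp add: nn_integral_Qn)
  show "(\<integral>x. w x *\<^sub>R p (Suc k) x \<partial>\<mu>) \<bullet> b = (\<integral>x. w (F x) *\<^sub>R p k x \<partial>\<mu>) \<bullet> b"
    using b by (simp add: comp[OF w] comp[OF wF] weight_dual[OF _ fin])
qed

lemma finite_measure_\<mu>: "finite_measure \<mu>"
  using prob_space_\<mu> by (rule prob_space.finite_measure)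

text \<open>Each application of \<open>transfer\<close> chooses a new representative, so the
  induction carries almost sure equality with \<open>p k\<close>. This is enough because the duality
  relation depends on the argument only up to null sets.\<close>

lemma transfer_p: "integrable \<mu> ((transfer \<mu> F ^^ k) \<Phi>) \<and> (AE x in \<mu>. (transfer \<mu> F ^^ k) \<Phi> x = p k x)"
  and transfer_dual_p: "ess_bounded \<mu> w \<Longrightarrow>
     (\<integral>x. w x *\<^sub>R (transfer \<mu> F ^^ Suc k) \<Phi> x \<partial>\<mu>) = (\<integral>x. w (F x) *\<^sub>R (transfer \<mu> F ^^ k) \<Phi> x \<partial>\<mu>)"
proof -
  have dual: "(\<integral>x. w x *\<^sub>R p (Suc k) x \<partial>\<mu>) = (\<integral>x. w (F x) *\<^sub>R f x \<partial>\<mu>)"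
    if f: "integrable \<mu> f" "AE x in \<mu>. f x = p k x" and w: "ess_bounded \<mu> w" for f w k
  proof -
    note wF = ess_bounded_comp[OF F_measurable_\<mu> inv w]
    have "(\<integral>x. w (F x) *\<^sub>R f x \<partial>\<mu>) = (\<integral>x. w (F x) *\<^sub>R p k x \<partial>\<mu>)"
      using f ess_bounded_scaleR_integrable[OF wF f(1)] ess_bounded_scaleR_integrable[OF wF p_integrable[of k]]
      by (intro integral_cong_AE) (auto elim!: eventually_mono)
    then show ?thesis by (simp add: p_dual[OF w])
  qed
  have *: "integrable \<mu> ((transfer \<mu> F ^^ k) \<Phi>) \<and> (AE x in \<mu>. (transfer \<mu> F ^^ k) \<Phi> x = p k x)" for k
  proof (induction k)
    case 0
    show ?case using \<Phi>_integrable p_0 by (auto elim: eventually_mono)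
  next
    case (Suc k)
    let ?f = "(transfer \<mu> F ^^ k) \<Phi>"
    have d: "(\<integral>x. w x *\<^sub>R p (Suc k) x \<partial>\<mu>) = (\<integral>x. w (F x) *\<^sub>R ?f x \<partial>\<mu>)" if "ess_bounded \<mu> w" for w
      using Suc that by (intro dual) auto
    show ?case
      using integrable_transfer[OF finite_measure_\<mu> p_integrable d] AE_transfer[OF finite_measure_\<mu> p_integrable d]
      by simp
  qed
  then show "integrable \<mu> ((transfer \<mu> F ^^ k) \<Phi>) \<and> (AE x in \<mu>. (transfer \<mu> F ^^ k) \<Phi> x = p k x)" .
  assume w: "ess_bounded \<mu> w"
  let ?f = "(transfer \<mu> F ^^ k) \<Phi>"
  have d: "(\<integral>x. w x *\<^sub>R p (Suc k) x \<partial>\<mu>) = (\<integral>x. w (F x) *\<^sub>R ?f x \<partial>\<mu>)" if "ess_bounded \<mu> w" for w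
    using * that by (intro dual) auto
  show "(\<integral>x. w x *\<^sub>R (transfer \<mu> F ^^ Suc k) \<Phi> x \<partial>\<mu>) = (\<integral>x. w (F x) *\<^sub>R ?f x \<partial>\<mu>)"
    using transfer_dual[OF finite_measure_\<mu> p_integrable d w] by simp
qed

text \<open>The bounds start at \<open>p (Suc k)\<close>: only after one application of
  \<open>Q\<close> does the branchwise regularity of \<open>U b\<close> become membership in a cone.
  \<open>U b\<close> and \<open>U 0\<close> both have integral \<open>mass\<close>, so
  \<open>decay\<close> applies to them, and division by the density is handled by a product
  estimate.\<close>

lemma p_hoelder:
  obtains A \<delta> where "0 \<le> A" "0 \<le> \<delta>" "\<delta> < 1"
    "\<And>k x b. x \<in> G \<Longrightarrow> b \<in> Basis \<Longrightarrow> \<bar>p (Suc k) x \<bullet> b\<bar> \<le> A * \<delta> ^ k"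
    "\<And>k x y b. x \<in> G \<Longrightarrow> y \<in> G \<Longrightarrow> b \<in> Basis \<Longrightarrow>
        \<bar>p (Suc k) x \<bullet> b - p (Suc k) y \<bullet> b\<bar> \<le> A * \<delta> ^ k * dist x y powr \<eta>"
proof -
  \<comment> \<open>The second entry is the cone constant of \<open>Q (U b)\<close>; the first is
    the threshold above which \<open>Q\<close> contracts.\<close>
  define K1 where "K1 = max K\<^sub>0 (C + (H + K * \<theta>))"
  have K1: "K\<^sub>0 \<le> K1" and K1_ge: "1 \<le> K1" using K\<^sub>0_ge_1 by (auto simp: K1_def)
  have QU: "hcone K1 (Q (U b))" if "b \<in> insert 0 Basis" for b
    using cone_Q[OF U_branch_cone[OF that]] by (rule cone_mono) (simp add: K1_def)
  have QU_int: "(\<integral>\<^sup>+ x. Q (U b) x \<partial>M) = ennreal mass" if "b \<in> insert 0 Basis" for b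
    using U_int[OF that] by (simp add: nn_integral_Q)
  define d where "d b k x = enn2real ((Q ^^ k) (Q (U b)) x) - enn2real ((Q ^^ k) (Q (U 0)) x)" for b k x
  define m where "m = exp (K1 * D) * mass / V"
  define L where "L = 2 * m * K1 * exp (K1 * D)"
  define \<delta> where "\<delta> = \<gamma> K1"
  have \<delta>: "0 \<le> \<delta>" "\<delta> < 1" using \<gamma>_range[OF K1_ge] by (auto simp: \<delta>_def)
  have m: "0 \<le> m" using mass_nonneg M_pos by (simp add: m_def)
  have L: "0 \<le> L" using m K1_ge by (simp add: L_def)
  have p: "p (Suc k) x \<bullet> b = d b k x * (1 / hr x)" if "b \<in> Basis" for k x b
    using that by (simp add: p_inner weight_def d_def funpow_swap1 diff_divide_distrib)
  have d_bound: "\<bar>d b k x\<bar> \<le> m * \<delta> ^ k" if "x \<in> G" "b \<in> Basis" for b k x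
    using decay_bound[OF _ QU QU_int _ QU QU_int mass_nonneg K1 that(1), of b 0 k] that(2)
    by (simp add: d_def m_def \<delta>_def)
  have d_hoelder: "\<bar>d b k x - d b k y\<bar> \<le> L * \<delta> ^ k * dist x y powr \<eta>" if "x \<in> G" "y \<in> G" "b \<in> Basis" for b k x y
    using decay_hoelder[OF _ QU QU_int _ QU QU_int mass_nonneg K1 that(1,2), of b 0 k] that(3)
    by (simp add: d_def L_def m_def \<delta>_def)
  define A where "A = m * R + (L * R + m * (R * K * exp (K * D)))"
  have A: "m * R \<le> A" "L * R + m * (R * K * exp (K * D)) \<le> A" "0 \<le> A"
    using m L R_pos K_nonneg by (auto simp: A_def)
  show thesis
  proof
    fix k x and b :: 'b assume x: "x \<in> G" and b: "b \<in> Basis"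
    have "\<bar>p (Suc k) x \<bullet> b\<bar> = \<bar>d b k x\<bar> * (1 / hr x)" using hr_pos[OF x] by (simp add: p[OF b] abs_mult)
    also have "\<dots> \<le> (m * \<delta> ^ k) * R"
      using d_bound[OF x b] inverse_hr_le[OF x] hr_pos[OF x] m \<delta> by (intro mult_mono) auto
    also have "\<dots> = (m * R) * \<delta> ^ k" by simp
    also have "\<dots> \<le> A * \<delta> ^ k" using A \<delta> by (intro mult_right_mono) auto
    finally show "\<bar>p (Suc k) x \<bullet> b\<bar> \<le> A * \<delta> ^ k" .
    fix y assume y: "y \<in> G"
    let ?s = "dist x y powr \<eta>"
    have "p (Suc k) x \<bullet> b - p (Suc k) y \<bullet> b =
        (d b k x - d b k y) * (1 / hr x) + d b k y * (1 / hr x - 1 / hr y)"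
      by (simp add: p[OF b] algebra_simps)
    also have "\<bar>\<dots>\<bar> \<le> \<bar>d b k x - d b k y\<bar> * (1 / hr x) + \<bar>d b k y\<bar> * \<bar>1 / hr x - 1 / hr y\<bar>"
      using hr_pos[OF x] by (intro order_trans[OF abs_triangle_ineq]) (simp add: abs_mult)
    also have "\<dots> \<le> (L * \<delta> ^ k * ?s) * R + (m * \<delta> ^ k) * (R * K * exp (K * D) * ?s)"
      using d_hoelder[OF x y b] inverse_hr_le[OF x] hr_pos[OF x] d_bound[OF y b] inverse_hr_hoelder[OF x y] m L \<delta>
      by (intro add_mono mult_mono) auto
    also have "\<dots> = (L * R + m * (R * K * exp (K * D))) * (\<delta> ^ k * ?s)" by (simp add: algebra_simps)
    also have "\<dots> \<le> A * (\<delta> ^ k * ?s)" using A \<delta> by (intro mult_right_mono) auto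
    finally show "\<bar>p (Suc k) x \<bullet> b - p (Suc k) y \<bullet> b\<bar> \<le> A * \<delta> ^ k * ?s" by (simp add: mult.assoc)
  qed (use A \<delta> in auto)
qed

text \<open>The estimates hold on \<open>G\<close>, but the norm is a supremum over
  \<open>S\<close>, so each \<open>p (Suc k)\<close> is extended from \<open>G\<close> with the same
  geometric rate. The extension agrees with the iterate almost everywhere, which is what
  \<open>holder_sums\<close> asks of a representative.\<close>

lemma holder_sums_transfer: "\<exists>X. holder_sums \<mu> \<eta> S (\<lambda>k. (transfer \<mu> F ^^ Suc k) \<Phi>) X"
proof -
  obtain A \<delta> where A: "0 \<le> A" and \<delta>: "0 \<le> \<delta>" "\<delta> < 1"
    and b: "\<And>k x b. x \<in> G \<Longrightarrow> b \<in> Basis \<Longrightarrow> \<bar>p (Suc k) x \<bullet> b\<bar> \<le> A * \<delta> ^ k"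
    and hoe: "\<And>k x y b. x \<in> G \<Longrightarrow> y \<in> G \<Longrightarrow> b \<in> Basis \<Longrightarrow>
        \<bar>p (Suc k) x \<bullet> b - p (Suc k) y \<bullet> b\<bar> \<le> A * \<delta> ^ k * dist x y powr \<eta>"
    by (rule p_hoelder) blast
  have "G \<noteq> {}"
  proof
    assume "G = {}"
    then have "AE x in M. False" using AE_G by simp
    then obtain N where "space M \<subseteq> N" "emeasure M N = 0" "N \<in> sets M" by (auto elim: AE_E)
    then have "emeasure M (space M) = 0" using emeasure_mono[of "space M" N M] by simp
    then show False using M_pos by (simp add: measure_def)
  qed
  have "\<exists>g. (\<forall>x\<in>G. g x = p (Suc k) x) \<and> (\<forall>x. norm (g x) \<le> DIM('b) * (A * \<delta> ^ k)) \<and>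
      (\<forall>x y. norm (g x - g y) \<le> DIM('b) * (A * \<delta> ^ k) * dist x y powr \<eta>)" for k
  proof -
    obtain g where "\<And>x. x \<in> G \<Longrightarrow> g x = p (Suc k) x" "\<And>x. norm (g x) \<le> DIM('b) * (A * \<delta> ^ k)"
      "\<And>x y. norm (g x - g y) \<le> DIM('b) * (A * \<delta> ^ k) * dist x y powr \<eta>"
      by (rule hoelder_extension[OF \<open>G \<noteq> {}\<close> \<eta>_pos \<eta>_le_1, of "A * \<delta> ^ k" "p (Suc k)" "A * \<delta> ^ k"])
        (use A \<delta> b hoe in auto)
    then show ?thesis by blast
  qed
  then obtain g where g: "\<And>k x. x \<in> G \<Longrightarrow> g k x = p (Suc k) x"
    "\<And>k x. norm (g k x) \<le> DIM('b) * (A * \<delta> ^ k)"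
    "\<And>k x y. norm (g k x - g k y) \<le> DIM('b) * (A * \<delta> ^ k) * dist x y powr \<eta>" by metis
  have "holder_sums \<mu> \<eta> S (\<lambda>k. (transfer \<mu> F ^^ Suc k) \<Phi>) (\<lambda>x. \<Sum>k. g k x)"
  proof (rule holder_sums_geometric[of "DIM('b) * A" \<delta>])
    show "AE x in \<mu>. g k x = (transfer \<mu> F ^^ Suc k) \<Phi> x" for k
      using AE_\<mu>[OF AE_G] transfer_p[of "Suc k", THEN conjunct2] by eventually_elim (simp add: g(1) del: funpow.simps)
  qed (use A \<delta> g(2,3) in \<open>auto simp: mult.assoc\<close>)
  then show ?thesis by blast
qed

end

section \<open>Inverse branches of a nonuniformly expanding map\<close>

text \<open>A sum of measures, written as an integral over \<open>count_space\<close> to match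
  \<open>pullback_measure\<close>; linearity and monotone convergence carry the identity from sets
  to functions.\<close>

lemma nn_integral_sum_measure:
  fixes P :: "'a measure"
  assumes P: "\<And>E. E \<in> sets P \<Longrightarrow> emeasure P E = (\<integral>\<^sup>+ a. emeasure (N a) E \<partial>count_space I)"
    and N [measurable_cong]: "\<And>a. sets (N a) = sets P"
    and f: "f \<in> borel_measurable P"
  shows "(\<integral>\<^sup>+ x. f x \<partial>P) = (\<integral>\<^sup>+ a. (\<integral>\<^sup>+ x. f x \<partial>N a) \<partial>count_space I)"
  using f
proof (induction rule: borel_measurable_induct)
  case (cong f g)
  have "(\<integral>\<^sup>+ x. f x \<partial>N a) = (\<integral>\<^sup>+ x. g x \<partial>N a)" for a
    using cong(3) sets_eq_imp_space_eq[OF N[of a]] by (intro nn_integral_cong) auto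
  moreover have "(\<integral>\<^sup>+ x. f x \<partial>P) = (\<integral>\<^sup>+ x. g x \<partial>P)" using cong(3) by (intro nn_integral_cong)
  ultimately show ?case using cong(4) by simp
next
  case (set A)
  then show ?case using P[OF set] by (simp add: N)
next
  case (mult u c)
  then show ?case by (simp add: nn_integral_cmult)
next
  case (add u v)
  then show ?case by (simp add: nn_integral_add)
next
  case (seq U)
  then have [measurable]: "U i \<in> borel_measurable P" for i by simp
  have sup: "\<Squnion> (range U) = (\<lambda>x. SUP i. U i x)" by (auto simp: image_comp)
  have 1: "(\<integral>\<^sup>+ x. (\<Squnion> (range U)) x \<partial>P) = (SUP i. \<integral>\<^sup>+ x. U i x \<partial>P)"
    unfolding sup using seq(3) by (rule nn_integral_monotone_convergence_SUP) simp
  have 2: "(\<integral>\<^sup>+ x. (\<Squnion> (range U)) x \<partial>N a) = (SUP i. \<integral>\<^sup>+ x. U i x \<partial>N a)" for a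
    unfolding sup using seq(3) by (rule nn_integral_monotone_convergence_SUP) simp
  have "incseq (\<lambda>i a. \<integral>\<^sup>+ x. U i x \<partial>N a)"
    using seq(3) by (auto simp: incseq_def le_fun_def intro!: nn_integral_mono)
  then have "(\<integral>\<^sup>+ a. (SUP i. \<integral>\<^sup>+ x. U i x \<partial>N a) \<partial>count_space I) = (SUP i. \<integral>\<^sup>+ a. \<integral>\<^sup>+ x. U i x \<partial>N a \<partial>count_space I)"
    by (intro nn_integral_monotone_convergence_SUP) auto
  with 1 2 seq.IH show ?case by simp
qed

context nonuniformly_expanding
begin

abbreviation F :: "'a \<Rightarrow> 'a" where "F \<equiv> return_map T \<tau>"

abbreviation M :: "'a measure" where "M \<equiv> restrict_space \<rho> Y"

lemma space_\<rho>: "space \<rho> = UNIV"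
  using sets_eq_imp_space_eq[OF borel] by simp

lemma space_M: "space M = Y"
  by (simp add: space_restrict_space space_\<rho>)

lemma sets_M: "E \<in> sets M \<longleftrightarrow> E \<subseteq> Y \<and> E \<in> sets \<rho>"
  using Y_measurable by (simp add: sets_restrict_space_iff)

lemma emeasure_M: "E \<subseteq> Y \<Longrightarrow> emeasure M E = emeasure \<rho> E"
  using Y_measurable by (simp add: emeasure_restrict_space)

lemma partition_union: "\<Union> \<alpha> = Y"
  using partition by (simp add: partition_on_def)

lemma partition_subset: "a \<in> \<alpha> \<Longrightarrow> a \<subseteq> Y"
  using partition_union by blast

lemma partition_sets: "a \<in> \<alpha> \<Longrightarrow> a \<in> sets \<rho>"
  using partition_measurable by auto

lemma F_Y: "y \<in> Y \<Longrightarrow> F y \<in> Y"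
  using return_in_Y .

lemma measurable_piecewise:
  assumes "\<And>a. a \<in> \<alpha> \<Longrightarrow> \<exists>g \<in> measurable \<rho> N. \<forall>y\<in>a. f y = g y"
  shows "f \<in> measurable M N"
proof (rule measurable_piecewise_restrict[OF partition_countable])
  show "space M \<subseteq> \<Union> \<alpha>" by (simp add: space_M partition_union)
  fix a assume a: "a \<in> \<alpha>"
  then show "a \<inter> space M \<in> sets M"
    using partition_subset[OF a] partition_sets[OF a] by (simp add: space_M sets_M Int_absorb2)
  obtain g where g: "g \<in> measurable \<rho> N" "\<And>y. y \<in> a \<Longrightarrow> f y = g y" using assms[OF a] by blast
  have "g \<in> measurable (restrict_space M a) N"
    using g(1) by (intro measurable_restrict_space1)
  moreover have "f \<in> measurable (restrict_space M a) N \<longleftrightarrow> g \<in> measurable (restrict_space M a) N"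
    using g(2) by (intro measurable_cong) (auto simp: space_restrict_space)
  ultimately show "f \<in> measurable (restrict_space M a) N" by simp
qed

lemma T_pow_measurable [measurable]: "T ^^ n \<in> measurable \<rho> \<rho>"
proof (induction n)
  case (Suc n)
  then show ?case using measurable_compose[OF Suc T_measurable] by (simp add: comp_def)
qed simp

lemma \<tau>_eq: "a \<in> \<alpha> \<Longrightarrow> \<exists>n. \<forall>y\<in>a. \<tau> y = n"
  using \<tau>_const[of a] by (cases "a = {}") blast+

lemma F_measurable: "F \<in> measurable M M"
proof (rule measurable_restrict_space2)
  show "F \<in> space M \<rightarrow> Y" using F_Y by (auto simp: space_M)
  show "F \<in> measurable M \<rho>"
  proof (rule measurable_piecewise)
    fix a assume "a \<in> \<alpha>"
    then obtain n where "\<forall>y\<in>a. \<tau> y = n" using \<tau>_eq by blast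
    then show "\<exists>g\<in>measurable \<rho> \<rho>. \<forall>y\<in>a. F y = g y"
      by (intro bexI[of _ "T ^^ n"]) (auto simp: return_map_def)
  qed
qed

section \<open>Inverse branches defined off null sets\<close>

lemma inj_on_F: "a \<in> \<alpha> \<Longrightarrow> inj_on F a"
proof (rule inj_onI)
  fix x y assume a: "a \<in> \<alpha>" and xy: "x \<in> a" "y \<in> a" "F x = F y"
  have "lam * dist x y \<le> 0" using expansion[OF a xy(1,2)] xy(3) by simp
  then show "x = y" using lam_gt_1 by (simp add: mult_le_0_iff)
qed

text \<open>The full-measure sets provided by \<open>full_branch\<close>, fixed once per branch.
  They are chosen as a pair because the bijection ties one to the other.\<close>

definition branch_sets :: "'a set \<Rightarrow> 'a set \<times> 'a set" where
  "branch_sets a = (SOME (A, B). A \<subseteq> a \<and> B \<subseteq> Y \<and> a - A \<in> null_sets \<rho> \<and> Y - B \<in> null_sets \<rho> \<and>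
     bij_betw F A B \<and> (\<forall>E\<in>sets \<rho>. E \<subseteq> A \<longrightarrow> F ` E \<in> sets \<rho>))"

definition bdom :: "'a set \<Rightarrow> 'a set" where "bdom a = fst (branch_sets a)"

definition bran :: "'a set \<Rightarrow> 'a set" where "bran a = snd (branch_sets a)"

lemma
  assumes a: "a \<in> \<alpha>"
  shows bdom_subset: "bdom a \<subseteq> a" and bran_subset: "bran a \<subseteq> Y"
    and bran_null: "Y - bran a \<in> null_sets \<rho>"
    and bdom_sets: "bdom a \<in> sets \<rho>" and bran_sets: "bran a \<in> sets \<rho>"
    and bij_bdom: "bij_betw F (bdom a) (bran a)"
    and image_bdom_sets: "\<And>E. E \<in> sets \<rho> \<Longrightarrow> E \<subseteq> bdom a \<Longrightarrow> F ` E \<in> sets \<rho>"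
proof -
  let ?P = "\<lambda>(A, B). A \<subseteq> a \<and> B \<subseteq> Y \<and> a - A \<in> null_sets \<rho> \<and> Y - B \<in> null_sets \<rho> \<and>
     bij_betw F A B \<and> (\<forall>E\<in>sets \<rho>. E \<subseteq> A \<longrightarrow> F ` E \<in> sets \<rho>)"
  obtain A B where "?P (A, B)"
    using full_branch[OF a] unfolding bij_betw_mod_null_def prod.case by (elim exE conjE) (rule that, blast)
  then have "?P (branch_sets a)"
    unfolding branch_sets_def by (rule someI[of ?P "(A, B)"])
  then have *: "bdom a \<subseteq> a" "bran a \<subseteq> Y" "a - bdom a \<in> null_sets \<rho>" "Y - bran a \<in> null_sets \<rho>"
    "bij_betw F (bdom a) (bran a)" "\<And>E. E \<in> sets \<rho> \<Longrightarrow> E \<subseteq> bdom a \<Longrightarrow> F ` E \<in> sets \<rho>"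
    unfolding bdom_def bran_def case_prod_beta by blast+
  show "bdom a \<subseteq> a" "bran a \<subseteq> Y" "Y - bran a \<in> null_sets \<rho>" "bij_betw F (bdom a) (bran a)"
    "\<And>E. E \<in> sets \<rho> \<Longrightarrow> E \<subseteq> bdom a \<Longrightarrow> F ` E \<in> sets \<rho>" by fact+
  have "bdom a = a - (a - bdom a)" "bran a = Y - (Y - bran a)" using *(1,2) by auto
  moreover have "a - (a - bdom a) \<in> sets \<rho>" using sets.Diff[OF partition_sets[OF a] null_setsD2[OF *(3)]] .
  moreover have "Y - (Y - bran a) \<in> sets \<rho>" using sets.Diff[OF Y_measurable null_setsD2[OF *(4)]] .
  ultimately show "bdom a \<in> sets \<rho>" "bran a \<in> sets \<rho>" by simp_all
qed

text \<open>The identity off \<open>bran a\<close> keeps \<open>\<psi> a\<close> a measurable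
  self-map of \<open>Y\<close>; these values carry no weight, since \<open>J a\<close> vanishes
  there.\<close>

definition \<psi> :: "'a set \<Rightarrow> 'a \<Rightarrow> 'a" where
  "\<psi> a y = (if y \<in> bran a then inv_into (bdom a) F y else y)"

lemma
  assumes a: "a \<in> \<alpha>" and y: "y \<in> bran a"
  shows \<psi>_dom: "\<psi> a y \<in> bdom a" and F_\<psi>: "F (\<psi> a y) = y"
proof -
  have "y \<in> F ` bdom a" using bij_bdom[OF a] y by (simp add: bij_betw_def)
  then show "\<psi> a y \<in> bdom a" "F (\<psi> a y) = y"
    using y by (simp_all add: \<psi>_def inv_into_into f_inv_into_f)
qed

lemma \<psi>_F: "a \<in> \<alpha> \<Longrightarrow> x \<in> bdom a \<Longrightarrow> \<psi> a (F x) = x"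
  using bij_bdom[of a] by (simp add: \<psi>_def bij_betw_def) (metis imageI inv_into_f_f)

text \<open>Images under \<open>F\<close>, which enter \<open>pullback_measure\<close>, become
  preimages under \<open>\<psi> a\<close>, which are what an image measure is made of.\<close>

lemma image_eq_vimage:
  assumes a: "a \<in> \<alpha>"
  shows "F ` (E \<inter> bdom a) = {y \<in> bran a. \<psi> a y \<in> E}"
proof
  show "F ` (E \<inter> bdom a) \<subseteq> {y \<in> bran a. \<psi> a y \<in> E}"
    using bij_bdom[OF a] \<psi>_F[OF a] by (auto simp: bij_betw_def)
  show "{y \<in> bran a. \<psi> a y \<in> E} \<subseteq> F ` (E \<inter> bdom a)"
  proof
    fix y assume "y \<in> {y \<in> bran a. \<psi> a y \<in> E}"
    then have y: "y \<in> bran a" "\<psi> a y \<in> E" by auto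
    then show "y \<in> F ` (E \<inter> bdom a)"
      by (intro image_eqI[of _ _ "\<psi> a y"]) (auto simp: F_\<psi>[OF a] \<psi>_dom[OF a])
  qed
qed

lemma image_sets:
  assumes a: "a \<in> \<alpha>" and E: "E \<in> sets M"
  shows "F ` (E \<inter> bdom a) \<in> sets M"
proof -
  have "F ` (E \<inter> bdom a) \<in> sets \<rho>"
    using E bdom_sets[OF a] by (intro image_bdom_sets[OF a]) (auto simp: sets_M)
  moreover have "F ` (E \<inter> bdom a) \<subseteq> Y" using image_eq_vimage[OF a] bran_subset[OF a] by auto
  ultimately show ?thesis by (simp add: sets_M)
qed

lemma bran_sets_M: "a \<in> \<alpha> \<Longrightarrow> bran a \<in> sets M"
  using bran_subset bran_sets by (simp add: sets_M)

lemma \<psi>_measurable: "a \<in> \<alpha> \<Longrightarrow> \<psi> a \<in> measurable M M"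
proof (rule measurableI)
  fix y assume a: "a \<in> \<alpha>" and "y \<in> space M"
  then show "\<psi> a y \<in> space M"
    using \<psi>_dom[OF a, of y] bdom_subset[OF a] partition_subset[OF a] by (cases "y \<in> bran a") (auto simp: space_M \<psi>_def)
next
  fix E assume a: "a \<in> \<alpha>" and E: "E \<in> sets M"
  have "\<psi> a -` E \<inter> space M = F ` (E \<inter> bdom a) \<union> (E - bran a)"
    unfolding image_eq_vimage[OF a] using bran_subset[OF a] E by (auto simp: space_M \<psi>_def sets_M split: if_splits)
  also have "\<dots> \<in> sets M" using image_sets[OF a E] E bran_sets_M[OF a] by auto
  finally show "\<psi> a -` E \<inter> space M \<in> sets M" .
qed

text \<open>The image of \<open>M\<close> on \<open>bran a\<close> under the inverse branch, which
  is the summand of \<open>pullback_measure\<close> that belongs to \<open>a\<close>. The null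
  measure gives every other index the sigma-algebra of \<open>M\<close>, as
  \<open>nn_integral_sum_measure\<close> assumes.\<close>

definition branch_measure :: "'a set \<Rightarrow> 'a measure" where
  "branch_measure a = (if a \<in> \<alpha> then distr (density M (indicator (bran a))) M (\<psi> a) else null_measure M)"

lemma sets_branch_measure: "sets (branch_measure a) = sets M"
  by (simp add: branch_measure_def)

lemma emeasure_branch_measure:
  assumes a: "a \<in> \<alpha>" and E: "E \<in> sets M"
  shows "emeasure (branch_measure a) E = emeasure \<rho> (F ` (E \<inter> bdom a))"
proof -
  note [measurable] = \<psi>_measurable[OF a] bran_sets_M[OF a] E
  have "emeasure (branch_measure a) E = emeasure (density M (indicator (bran a))) (\<psi> a -` E \<inter> space M)"
    using a by (simp add: branch_measure_def emeasure_distr)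
  also have "\<dots> = (\<integral>\<^sup>+ y. indicator (bran a) y * indicator (\<psi> a -` E \<inter> space M) y \<partial>M)"
    by (rule emeasure_density) auto
  also have "\<dots> = (\<integral>\<^sup>+ y. indicator (F ` (E \<inter> bdom a)) y \<partial>M)"
    unfolding image_eq_vimage[OF a] using bran_subset[OF a]
    by (intro nn_integral_cong) (auto split: split_indicator simp: space_M)
  also have "\<dots> = emeasure M (F ` (E \<inter> bdom a))" using image_sets[OF a E] by simp
  also have "\<dots> = emeasure \<rho> (F ` (E \<inter> bdom a))" using image_sets[OF a E] by (intro emeasure_M) (simp add: sets_M)
  finally show ?thesis .
qed

text \<open>Since \<open>F\<close> is injective on all of \<open>a\<close>, points outside \<open>bdom a\<close> are mapped outside \<open>bran a\<close>, that
  is, into a null set.\<close>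

lemma completion_image:
  assumes a: "a \<in> \<alpha>" and E: "E \<in> sets M"
  shows "emeasure (completion \<rho>) (F ` (E \<inter> a)) = emeasure (branch_measure a) E"
proof -
  have "E \<inter> a = (E \<inter> bdom a) \<union> (E \<inter> (a - bdom a))" using bdom_subset[OF a] by blast
  then have "F ` (E \<inter> a) = F ` (E \<inter> bdom a) \<union> F ` (E \<inter> (a - bdom a))"
    by (metis image_Un)
  moreover have "F ` (E \<inter> (a - bdom a)) \<in> null_sets (completion \<rho>)"
  proof (rule null_sets_completion_subset)
    show "Y - bran a \<in> null_sets (completion \<rho>)" using bran_null[OF a] by (rule null_sets_completionI)
    show "F ` (E \<inter> (a - bdom a)) \<subseteq> Y - bran a"
    proof safe
      fix x assume x: "x \<in> a" "x \<notin> bdom a"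
      then show "F x \<in> Y" using partition_subset[OF a] F_Y by auto
      assume "F x \<in> bran a"
      then have "F (\<psi> a (F x)) = F x" "\<psi> a (F x) \<in> bdom a" using F_\<psi>[OF a] \<psi>_dom[OF a] by auto
      then have "\<psi> a (F x) = x" using inj_onD[OF inj_on_F[OF a]] x bdom_subset[OF a] by blast
      then show False using x \<open>\<psi> a (F x) \<in> bdom a\<close> by simp
    qed
  qed
  moreover have "F ` (E \<inter> bdom a) \<in> sets \<rho>" using image_sets[OF a E] by (simp add: sets_M)
  ultimately show ?thesis
    by (simp add: emeasure_Un_null_set emeasure_branch_measure[OF a E] main_part sets_completionI_sets)
qed

abbreviation pull :: "'a measure" where "pull \<equiv> pullback_measure \<rho> Y \<alpha> F"

lemma sets_pull: "sets pull = sets M"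
  unfolding pullback_measure_def
  using sets.sigma_sets_eq[of M] sets.space_closed[of M] by (simp add: space_M)

text \<open>\<open>measure_of\<close> takes over the given set function only if it is countably
  additive, and this is visible once each summand is recognised as a branch measure.\<close>

lemma emeasure_pull:
  assumes E: "E \<in> sets M"
  shows "emeasure pull E = (\<integral>\<^sup>+ a. emeasure (branch_measure a) E \<partial>count_space \<alpha>)"
proof -
  let ?m = "\<lambda>E. \<integral>\<^sup>+ a. emeasure (completion \<rho>) (F ` (E \<inter> a)) \<partial>count_space \<alpha>"
  have m: "?m E = (\<integral>\<^sup>+ a. emeasure (branch_measure a) E \<partial>count_space \<alpha>)" if "E \<in> sets M" for E
    using that by (intro nn_integral_cong) (simp add: completion_image)
  have "emeasure pull E = ?m E"
  proof (rule emeasure_measure_of[OF pullback_measure_def])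
    show "sets M \<subseteq> Pow Y" using sets.space_closed[of M] by (simp add: space_M)
    show "positive (sets pull) ?m" by (simp add: positive_def)
    show "countably_additive (sets pull) ?m"
    proof (rule countably_additiveI)
      fix A :: "nat \<Rightarrow> 'a set" assume A: "range A \<subseteq> sets pull" "disjoint_family A" "\<Union> (range A) \<in> sets pull"
      have "(\<Sum>i. ?m (A i)) = (\<Sum>i. \<integral>\<^sup>+ a. emeasure (branch_measure a) (A i) \<partial>count_space \<alpha>)"
        using A(1) by (intro suminf_cong m) (auto simp: sets_pull)
      also have "\<dots> = (\<integral>\<^sup>+ a. (\<Sum>i. emeasure (branch_measure a) (A i)) \<partial>count_space \<alpha>)"
        by (rule nn_integral_suminf[symmetric]) simp
      also have "\<dots> = (\<integral>\<^sup>+ a. emeasure (branch_measure a) (\<Union> (range A)) \<partial>count_space \<alpha>)"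
        using A by (intro nn_integral_cong suminf_emeasure) (auto simp: sets_pull sets_branch_measure)
      also have "\<dots> = ?m (\<Union> (range A))" using A(3) by (intro m[symmetric]) (simp add: sets_pull)
      finally show "(\<Sum>i. ?m (A i)) = ?m (\<Union> (range A))" .
    qed
    show "E \<in> sets pull" using E by (simp add: sets_pull)
  qed
  then show ?thesis using m[OF E] by simp
qed

section \<open>Jacobians of the inverse branches\<close>

lemma finite_measure_M: "finite_measure M"
  using finite_measure_axioms Y_measurable by (rule finite_measure_restrict_space)

text \<open>\<open>\<zeta>\<^sub>0\<close> is the density of the measure against its pullback under
  \<open>F\<close>, so along the inverse branch it is the Jacobian of
  \<open>\<psi> a\<close>.\<close>

definition J :: "'a set \<Rightarrow> 'a \<Rightarrow> ennreal" where
  "J a y = indicator (bran a) y * ennreal (\<zeta>\<^sub>0 (\<psi> a y))"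

lemma J_measurable:
  assumes a: "a \<in> \<alpha>"
  shows "J a \<in> borel_measurable M"
proof -
  note [measurable] = measurable_compose[OF \<psi>_measurable[OF a] \<zeta>\<^sub>0_measurable] bran_sets_M[OF a]
  show ?thesis unfolding J_def by measurable
qed

text \<open>By \<open>\<zeta>\<^sub>0_density\<close>, \<open>M\<close> is
  \<open>\<zeta>\<^sub>0\<close> times \<open>pull\<close>, and \<open>pull\<close> is the sum of
  the images of \<open>M\<close> under the inverse branches. Moving each integral back along
  \<open>\<psi> a\<close> produces \<open>J a\<close>; Tonelli exchanges sum and integral.\<close>

lemma change_of_variables:
  assumes f: "f \<in> borel_measurable M"
  shows "(\<integral>\<^sup>+ x. f x \<partial>M) = (\<integral>\<^sup>+ y. (\<integral>\<^sup>+ a. J a y * f (\<psi> a y) \<partial>count_space \<alpha>) \<partial>M)"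
proof -
  interpret M: finite_measure M by (rule finite_measure_M)
  interpret I: sigma_finite_measure "count_space \<alpha>"
    by (rule sigma_finite_measure_count_space_countable) (rule partition_countable)
  interpret IM: pair_sigma_finite "count_space \<alpha>" M ..
  have meas [simp]: "borel_measurable pull = borel_measurable M"
    by (rule measurable_cong_sets[OF sets_pull refl])
  have "(\<integral>\<^sup>+ x. f x \<partial>M) = (\<integral>\<^sup>+ x. f x \<partial>density pull (\<lambda>y. ennreal (\<zeta>\<^sub>0 y)))" by (simp add: \<zeta>\<^sub>0_density)
  also have "\<dots> = (\<integral>\<^sup>+ x. ennreal (\<zeta>\<^sub>0 x) * f x \<partial>pull)"
    using \<zeta>\<^sub>0_measurable f by (intro nn_integral_density) auto
  also have "\<dots> = (\<integral>\<^sup>+ a. (\<integral>\<^sup>+ x. ennreal (\<zeta>\<^sub>0 x) * f x \<partial>branch_measure a) \<partial>count_space \<alpha>)"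
    using \<zeta>\<^sub>0_measurable f
    by (intro nn_integral_sum_measure) (auto simp: emeasure_pull sets_pull sets_branch_measure)
  also have "\<dots> = (\<integral>\<^sup>+ a. (\<integral>\<^sup>+ y. J a y * f (\<psi> a y) \<partial>M) \<partial>count_space \<alpha>)"
  proof (rule nn_integral_cong)
    fix a assume "a \<in> space (count_space \<alpha>)"
    then have a: "a \<in> \<alpha>" by simp
    note [measurable] = \<psi>_measurable[OF a] bran_sets_M[OF a] \<zeta>\<^sub>0_measurable f
    have "(\<integral>\<^sup>+ x. ennreal (\<zeta>\<^sub>0 x) * f x \<partial>branch_measure a) =
        (\<integral>\<^sup>+ y. ennreal (\<zeta>\<^sub>0 (\<psi> a y)) * f (\<psi> a y) \<partial>density M (indicator (bran a)))"
      using a by (simp add: branch_measure_def nn_integral_distr)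
    also have "\<dots> = (\<integral>\<^sup>+ y. indicator (bran a) y * (ennreal (\<zeta>\<^sub>0 (\<psi> a y)) * f (\<psi> a y)) \<partial>M)"
      by (rule nn_integral_density) auto
    finally show "(\<integral>\<^sup>+ x. ennreal (\<zeta>\<^sub>0 x) * f x \<partial>branch_measure a) = (\<integral>\<^sup>+ y. J a y * f (\<psi> a y) \<partial>M)"
      by (simp add: J_def mult.assoc)
  qed
  also have "\<dots> = (\<integral>\<^sup>+ y. (\<integral>\<^sup>+ a. J a y * f (\<psi> a y) \<partial>count_space \<alpha>) \<partial>M)"
  proof (rule IM.Fubini'[symmetric], rule measurable_pair_measure_countable1[OF partition_countable])
    fix a assume a: "a \<in> \<alpha>"
    note [measurable] = \<psi>_measurable[OF a] J_measurable[OF a] f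
    show "(\<lambda>y. case (a, y) of (a, y) \<Rightarrow> J a y * f (\<psi> a y)) \<in> borel_measurable M" by simp
  qed
  finally show ?thesis .
qed

text \<open>As \<open>\<zeta>\<^sub>0\<close> is positive, an \<open>M\<close>-null set is also null
  for \<open>pull\<close>, which adds up the measures of its images under \<open>F\<close>.\<close>

lemma image_null:
  assumes a: "a \<in> \<alpha>" and E: "E \<in> sets M" "emeasure M E = 0"
  shows "emeasure \<rho> (F ` (E \<inter> bdom a)) = 0"
proof -
  have [measurable]: "\<zeta>\<^sub>0 \<in> borel_measurable pull" "E \<in> sets pull"
    using \<zeta>\<^sub>0_measurable E(1) measurable_cong_sets[OF sets_pull refl, of borel] sets_pull by auto
  have sp: "space pull = Y" using sets_eq_imp_space_eq[OF sets_pull] by (simp add: space_M)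
  have "(\<integral>\<^sup>+ y. ennreal (\<zeta>\<^sub>0 y) * indicator E y \<partial>pull) = emeasure M E"
    unfolding \<zeta>\<^sub>0_density[symmetric] by (rule emeasure_density[symmetric]) auto
  then have "(\<integral>\<^sup>+ y. ennreal (\<zeta>\<^sub>0 y) * indicator E y \<partial>pull) = 0" using E(2) by simp
  then have "AE y in pull. ennreal (\<zeta>\<^sub>0 y) * indicator E y = 0"
    by (rule nn_integral_0_iff_AE[THEN iffD1, rotated]) auto
  then have "AE y in pull. y \<notin> E"
    using AE_space by eventually_elim (use \<zeta>\<^sub>0_pos sp in \<open>force split: split_indicator_asm\<close>)
  then have "E \<in> null_sets pull" by (subst AE_iff_null_sets) auto
  then have "emeasure pull E = 0" by auto
  then have "(\<integral>\<^sup>+ a. emeasure (branch_measure a) E \<partial>count_space \<alpha>) = 0" by (simp add: emeasure_pull[OF E(1)])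
  then have "emeasure (branch_measure a) E = 0"
    using a by (subst (asm) nn_integral_0_iff_AE) (auto simp: AE_count_space)
  then show ?thesis by (simp add: emeasure_branch_measure[OF a E(1)])
qed

text \<open>Off the union of these null sets, all compositions of inverse branches are defined.\<close>

primrec bad :: "nat \<Rightarrow> 'a set" where
  "bad 0 = (\<Union>a\<in>\<alpha>. Y - bran a)"
| "bad (Suc n) = (\<Union>a\<in>\<alpha>. F ` (bad n \<inter> bdom a))"

lemma bad_null: "bad n \<in> null_sets M"
proof (induction n)
  case 0
  have "Y - bran a \<in> null_sets M" if "a \<in> \<alpha>" for a
    using bran_null[OF that] by (auto simp: null_sets_def sets_M emeasure_M)
  then show ?case unfolding bad.simps using partition_countable by (intro null_sets_UN')
next
  case (Suc n)
  then have n: "bad n \<in> sets M" "emeasure M (bad n) = 0" by auto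
  have "F ` (bad n \<inter> bdom a) \<in> null_sets M" if a: "a \<in> \<alpha>" for a
    using image_sets[OF a n(1)] image_null[OF a n] by (auto simp: null_sets_def emeasure_M sets_M)
  then show ?case unfolding bad.simps using partition_countable by (intro null_sets_UN')
qed

definition G :: "'a set" where "G = Y - (\<Union>n. bad n)"

lemma G_sets: "G \<in> sets M"
proof -
  have "(\<Union>n. bad n) \<in> sets M" using bad_null by auto
  moreover have "Y \<in> sets M" using sets.top[of M] by (simp add: space_M)
  ultimately show ?thesis unfolding G_def by auto
qed

lemma AE_G: "AE x in M. x \<in> G"
proof -
  have "(\<Union>n. bad n) \<in> null_sets M" using bad_null by auto
  then have "AE x in M. x \<notin> (\<Union>n. bad n)" by (rule AE_not_in)
  then show ?thesis using AE_space by eventually_elim (auto simp: G_def space_M)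
qed

lemma G_bran: "a \<in> \<alpha> \<Longrightarrow> y \<in> G \<Longrightarrow> y \<in> bran a"
proof (rule ccontr)
  assume "a \<in> \<alpha>" "y \<in> G" "y \<notin> bran a"
  then have "y \<in> bad 0" by (auto simp: G_def)
  then show False using \<open>y \<in> G\<close> unfolding G_def by blast
qed

text \<open>If \<open>\<psi> a y\<close> were in \<open>bad n\<close>, then \<open>y\<close>, its
  image under \<open>F\<close>, would be in \<open>bad (Suc n)\<close>.\<close>

lemma \<psi>_G: "a \<in> \<alpha> \<Longrightarrow> y \<in> G \<Longrightarrow> \<psi> a y \<in> G"
proof -
  assume a: "a \<in> \<alpha>" and y: "y \<in> G"
  note r = G_bran[OF a y]
  have "\<psi> a y \<notin> bad n" for n
  proof
    assume "\<psi> a y \<in> bad n"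
    then have "y \<in> F ` (bad n \<inter> bdom a)"
      using F_\<psi>[OF a r] \<psi>_dom[OF a r] by (metis IntI image_eqI)
    then have "y \<in> bad (Suc n)" using a by auto
    then show False using y unfolding G_def by blast
  qed
  moreover have "\<psi> a y \<in> Y" using \<psi>_dom[OF a r] bdom_subset[OF a] partition_subset[OF a] by auto
  ultimately show ?thesis by (auto simp: G_def)
qed

lemma \<psi>_in: "a \<in> \<alpha> \<Longrightarrow> y \<in> G \<Longrightarrow> \<psi> a y \<in> a"
  by (rule subsetD[OF bdom_subset \<psi>_dom[OF _ G_bran]])

lemma F_\<psi>_G: "a \<in> \<alpha> \<Longrightarrow> y \<in> G \<Longrightarrow> F (\<psi> a y) = y"
  by (rule F_\<psi>[OF _ G_bran])

lemma diameter_bound: "\<exists>D\<ge>1. \<forall>x y :: 'a. dist x y \<le> D"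
proof -
  obtain e where "\<And>x y :: 'a. dist x y \<le> e"
    using bounded_space unfolding bounded_two_points by auto
  then show ?thesis by (intro exI[of _ "max 1 e"]) (auto intro: max.coboundedI2)
qed

text \<open>Expansion by \<open>lam\<close> becomes contraction by
  \<open>(1 / lam) powr \<eta>\<close> in the metric \<open>dist powr \<eta>\<close>. Since
  \<open>expansion\<close> and \<open>distortion\<close> compare \<open>F x\<close> with
  \<open>F y\<close>, they turn directly into bounds in the base points of the inverse
  branches.\<close>

lemma branch_system_exists:
  obtains \<theta> D where "branch_system M G \<alpha> \<psi> J F \<eta> \<theta> C\<^sub>1 D"
proof -
  obtain D where D: "1 \<le> D" "\<And>x y :: 'a. dist x y \<le> D" using diameter_bound by blast
  have "branch_system M G \<alpha> \<psi> J F \<eta> ((1 / lam) powr \<eta>) C\<^sub>1 D"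
  proof (rule branch_system.intro[OF finite_measure_M], rule branch_system_axioms.intro)
    show "measure M (space M) > 0"
      using Y_pos emeasure_M[of Y] unfolding space_M measure_def
      by (simp add: enn2real_positive_iff less_top[symmetric])
    show "countable \<alpha>" "G \<in> sets M" "AE x in M. x \<in> G" "F \<in> measurable M M"
      by (fact partition_countable G_sets AE_G F_measurable)+
    show "\<psi> a \<in> measurable M M" "J a \<in> borel_measurable M" if "a \<in> \<alpha>" for a
      using \<psi>_measurable[OF that] J_measurable[OF that] .
    show "\<psi> a y \<in> G" "F (\<psi> a y) = y" if "a \<in> \<alpha>" "y \<in> G" for a y
      using \<psi>_G[OF that] F_\<psi>_G[OF that] .
    show "(\<integral>\<^sup>+ x. f x \<partial>M) = (\<integral>\<^sup>+ y. (\<integral>\<^sup>+ a. J a y * f (\<psi> a y) \<partial>count_space \<alpha>) \<partial>M)"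
      if "f \<in> borel_measurable M" for f using change_of_variables[OF that] .
    show "0 < \<eta>" "\<eta> \<le> 1" "0 \<le> (1 / lam) powr \<eta>" "0 \<le> C\<^sub>1" "1 \<le> D"
      using \<eta>_range C\<^sub>1_ge_1 D(1) by auto
    show "dist x y \<le> D" for x y :: 'a by (rule D(2))
    show "(1 / lam) powr \<eta> < 1"
      using powr_less_mono2[of \<eta> "1 / lam" 1] lam_gt_1 \<eta>_range by simp
    fix a x y assume a: "a \<in> \<alpha>" and xy: "x \<in> G" "y \<in> G"
    note in_a = \<psi>_in[OF a xy(1)] \<psi>_in[OF a xy(2)]
    have "lam * dist (\<psi> a x) (\<psi> a y) \<le> dist x y"
      using expansion[OF a in_a] F_\<psi>_G[OF a xy(1)] F_\<psi>_G[OF a xy(2)] by simp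
    then have "dist (\<psi> a x) (\<psi> a y) \<le> 1 / lam * dist x y" using lam_gt_1 by (simp add: field_simps)
    then have "dist (\<psi> a x) (\<psi> a y) powr \<eta> \<le> (1 / lam * dist x y) powr \<eta>"
      using \<eta>_range by (intro powr_mono2) auto
    also have "(1 / lam * dist x y) powr \<eta> = (1 / lam) powr \<eta> * dist x y powr \<eta>"
      by (rule powr_mult)
    finally show "dist (\<psi> a x) (\<psi> a y) powr \<eta> \<le> (1 / lam) powr \<eta> * dist x y powr \<eta>" .
    note Y = subsetD[OF partition_subset[OF a] in_a(1)] subsetD[OF partition_subset[OF a] in_a(2)]
    have "\<bar>ln (\<zeta>\<^sub>0 (\<psi> a x)) - ln (\<zeta>\<^sub>0 (\<psi> a y))\<bar> \<le> C\<^sub>1 * dist x y powr \<eta>"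
      using distortion[OF a in_a] unfolding F_\<psi>_G[OF a xy(1)] F_\<psi>_G[OF a xy(2)] .
    then have "ln (\<zeta>\<^sub>0 (\<psi> a x)) \<le> C\<^sub>1 * dist x y powr \<eta> + ln (\<zeta>\<^sub>0 (\<psi> a y))"
      by linarith
    then have "exp (ln (\<zeta>\<^sub>0 (\<psi> a x))) \<le> exp (C\<^sub>1 * dist x y powr \<eta>) * exp (ln (\<zeta>\<^sub>0 (\<psi> a y)))"
      unfolding exp_add[symmetric] exp_le_cancel_iff .
    then have "\<zeta>\<^sub>0 (\<psi> a x) \<le> exp (C\<^sub>1 * dist x y powr \<eta>) * \<zeta>\<^sub>0 (\<psi> a y)"
      by (simp only: exp_ln \<zeta>\<^sub>0_pos[OF Y(1)] \<zeta>\<^sub>0_pos[OF Y(2)])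
    then have "ennreal (\<zeta>\<^sub>0 (\<psi> a x)) \<le> ennreal (exp (C\<^sub>1 * dist x y powr \<eta>)) * ennreal (\<zeta>\<^sub>0 (\<psi> a y))"
      using \<zeta>\<^sub>0_pos[OF Y(2)] by (subst ennreal_mult[symmetric]) (auto intro: ennreal_leI)
    then show "J a x \<le> ennreal (exp (C\<^sub>1 * dist x y powr \<eta>)) * J a y"
      unfolding J_def using G_bran[OF a xy(1)] G_bran[OF a xy(2)] by simp
  qed
  then show thesis by (rule that)
qed

end

section \<open>Integration on the tower\<close>

lemma scale_measure_eq_density: "scale_measure r M = density M (\<lambda>_. r)"
  by (rule measure_eqI) (auto simp: emeasure_density nn_integral_cmult)

locale tower_base = prob_space \<mu> for \<mu> :: "'a measure" +
  fixes Y :: "'a set" and \<tau> :: "'a \<Rightarrow> nat"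
  assumes space_base: "space \<mu> = Y"
    and height_measurable [measurable]: "\<tau> \<in> measurable \<mu> (count_space UNIV)"
    and height_pos: "\<And>y. y \<in> Y \<Longrightarrow> 1 \<le> \<tau> y"
    and height_integrable: "integrable \<mu> (\<lambda>y. real (\<tau> y))"
begin

definition mean_height :: real where "mean_height = (\<integral>y. real (\<tau> y) \<partial>\<mu>)"

abbreviation P :: "('a \<times> nat) measure" where "P \<equiv> \<mu> \<Otimes>\<^sub>M count_space UNIV"

abbreviation \<Delta> :: "('a \<times> nat) set" where "\<Delta> \<equiv> tower Y \<tau>"

lemma mean_height_ge_1: "1 \<le> mean_height"
proof -
  have "(\<integral>y. 1 \<partial>\<mu>) \<le> mean_height"
    unfolding mean_height_def using height_integrable height_pos
    by (intro integral_mono) (auto simp: space_base)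
  then show ?thesis by (simp add: prob_space)
qed

lemma tower_measure_eq:
  "tower_measure Y \<tau> \<mu> = density (restrict_space P \<Delta>) (\<lambda>_. ennreal (1 / mean_height))"
proof -
  have "(\<integral>\<^sup>+ y. of_nat (\<tau> y) \<partial>\<mu>) = (\<integral>\<^sup>+ y. ennreal (real (\<tau> y)) \<partial>\<mu>)"
    by (simp add: ennreal_of_nat_eq_real_of_nat)
  also have "\<dots> = ennreal mean_height"
    unfolding mean_height_def using height_integrable by (intro nn_integral_eq_integral) auto
  finally have "1 / (\<integral>\<^sup>+ y. of_nat (\<tau> y) \<partial>\<mu>) = ennreal (1 / mean_height)"
    using mean_height_ge_1 divide_ennreal[of 1 mean_height] by simp
  then show ?thesis by (simp add: tower_measure_def scale_measure_eq_density)
qed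

lemma tower_sets [measurable]: "\<Delta> \<in> sets P"
proof -
  have "{y \<in> space \<mu>. l < \<tau> y} \<times> {l} \<in> sets P" for l by (intro pair_measureI) measurable
  then have "(\<Union>l. {y \<in> space \<mu>. l < \<tau> y} \<times> {l}) \<in> sets P" by auto
  also have "(\<Union>l. {y \<in> space \<mu>. l < \<tau> y} \<times> {l}) = \<Delta>" by (auto simp: tower_def space_base)
  finally show ?thesis .
qed

section \<open>Level-by-level integration\<close>

lemma measurable_product:
  assumes "\<And>l. (\<lambda>y. g (y, l)) \<in> measurable \<mu> N"
  shows "g \<in> measurable P N"
proof -
  have "(\<lambda>x. (\<lambda>l x. g (fst x, l)) (snd x) x) \<in> measurable P N"
  proof (rule measurable_compose_countable'[where f="\<lambda>l x. g (fst x, l)" and g=snd and I=UNIV])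
    show "(\<lambda>x. g (fst x, l)) \<in> measurable P N" for l
      using measurable_compose[OF measurable_fst assms[of l]] .
  qed auto
  then show ?thesis by simp
qed

lemma
  fixes g :: "'a \<times> nat \<Rightarrow> 'b::euclidean_space"
  assumes g: "\<And>l. (\<lambda>y. g (y, l)) \<in> borel_measurable \<mu>"
    and int: "integrable \<mu> (\<lambda>y. \<Sum>l<\<tau> y. norm (g (y, l)))"
  shows tower_integrable: "integrable (tower_measure Y \<tau> \<mu>) g"
    and tower_integral: "(\<integral>x. g x \<partial>tower_measure Y \<tau> \<mu>) = (1 / mean_height) *\<^sub>R (\<integral>y. (\<Sum>l<\<tau> y. g (y, l)) \<partial>\<mu>)"
proof -
  interpret N: sigma_finite_measure "count_space (UNIV :: nat set)"
    by (rule sigma_finite_measure_count_space_countable) simp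
  interpret PN: pair_sigma_finite \<mu> "count_space (UNIV :: nat set)" ..
  note [measurable] = measurable_product[OF g]
  \<comment> \<open>After cutting off to the tower, each integral over a fibre is a finite sum, so
    Fubini on the whole product applies.\<close>
  let ?h = "\<lambda>x. indicator \<Delta> x *\<^sub>R g x"
  have supp: "?h (y, l) = (if l < \<tau> y then g (y, l) else 0)" if "y \<in> Y" for y l
    using that by (simp add: tower_def)
  have fin: "{l. (if l < \<tau> y then G l else 0) \<noteq> 0} \<subseteq> {..<\<tau> y}" for y and G :: "nat \<Rightarrow> 'c::zero"
    by (auto split: if_splits)
  have sum: "(\<integral>l. (if l < \<tau> y then G l else 0) \<partial>count_space UNIV) = (\<Sum>l<\<tau> y. G l)"
    for y and G :: "nat \<Rightarrow> 'c::euclidean_space"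
  proof -
    have "(\<integral>l. (if l < \<tau> y then G l else 0) \<partial>count_space UNIV) =
        (\<Sum>l | l \<in> UNIV \<and> (if l < \<tau> y then G l else 0) \<noteq> 0. if l < \<tau> y then G l else 0)"
      using finite_subset[OF fin[of y G]] by (intro lebesgue_integral_count_space_finite_support) auto
    also have "\<dots> = (\<Sum>l<\<tau> y. G l)"
      by (intro sum.mono_neutral_cong_left) auto
    finally show ?thesis .
  qed
  have h_int: "integrable P ?h"
  proof (rule PN.Fubini_integrable)
    have "(\<integral>l. norm (?h (y, l)) \<partial>count_space UNIV) = (\<Sum>l<\<tau> y. norm (g (y, l)))" if "y \<in> space \<mu>" for y
      using that sum[of y "\<lambda>l. norm (g (y, l))"] by (simp add: supp space_base if_distrib cong: if_cong)
    then show "integrable \<mu> (\<lambda>y. \<integral>l. norm (?h (y, l)) \<partial>count_space UNIV)"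
      using int by (subst Bochner_Integration.integrable_cong[OF refl]) auto
    have "integrable (count_space UNIV) (\<lambda>l. ?h (y, l))" if "y \<in> space \<mu>" for y
      unfolding integrable_count_space_nat_iff
      by (rule summable_finite[of "{..<\<tau> y}"]) (use that in \<open>auto simp: tower_def\<close>)
    then show "AE y in \<mu>. integrable (count_space UNIV) (\<lambda>l. ?h (y, l))" by (intro AE_I2)
  qed measurable
  have \<Delta>: "\<Delta> \<inter> space P \<in> sets P" by measurable
  have r: "AE x in restrict_space P \<Delta>. 0 \<le> 1 / mean_height" using mean_height_ge_1 by simp
  have g': "g \<in> borel_measurable (restrict_space P \<Delta>)" by (intro measurable_restrict_space1) measurable
  have "integrable (restrict_space P \<Delta>) g" using h_int by (simp add: integrable_restrict_space[OF \<Delta>])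
  then show "integrable (tower_measure Y \<tau> \<mu>) g"
    unfolding tower_measure_eq by (subst integrable_density[OF g' _ r]) auto
  have "(\<integral>x. g x \<partial>tower_measure Y \<tau> \<mu>) = (\<integral>x. (1 / mean_height) *\<^sub>R g x \<partial>restrict_space P \<Delta>)"
    unfolding tower_measure_eq by (subst integral_density[OF g' _ r]) auto
  also have "\<dots> = (1 / mean_height) *\<^sub>R (\<integral>x. ?h x \<partial>P)" by (simp add: integral_restrict_space[OF \<Delta>])
  also have "(\<integral>x. ?h x \<partial>P) = (\<integral>y. (\<integral>l. ?h (y, l) \<partial>count_space UNIV) \<partial>\<mu>)"
    using PN.integral_fst[of "\<lambda>y l. ?h (y, l)"] h_int by (simp add: case_prod_beta')
  also have "\<dots> = (\<integral>y. (\<Sum>l<\<tau> y. g (y, l)) \<partial>\<mu>)"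
    using sum by (intro Bochner_Integration.integral_cong refl) (simp add: supp space_base cong: if_cong)
  finally show "(\<integral>x. g x \<partial>tower_measure Y \<tau> \<mu>) = (1 / mean_height) *\<^sub>R (\<integral>y. (\<Sum>l<\<tau> y. g (y, l)) \<partial>\<mu>)" .
qed

lemma sum_top_level:
  fixes k :: "'a \<Rightarrow> 'b::comm_monoid_add"
  assumes "y \<in> Y"
  shows "(\<Sum>l<\<tau> y. if l + 2 \<le> \<tau> y then 0 else k y) = k y"
proof -
  \<comment> \<open>Among \<open>l < \<tau> y\<close> the condition fails only for
    \<open>l = \<tau> y - 1\<close>, and \<open>\<tau> y \<ge> 1\<close> makes this an actual
    level.\<close>
  have "(\<Sum>l<\<tau> y. if l + 2 \<le> \<tau> y then 0 else k y) = (\<Sum>l\<in>{\<tau> y - 1}. k y)"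
    using height_pos[OF assms] by (intro sum.mono_neutral_cong_right) auto
  then show ?thesis by simp
qed

lemma
  fixes k :: "'a \<Rightarrow> 'b::euclidean_space"
  assumes k: "integrable \<mu> k"
  defines "g \<equiv> \<lambda>(y, l). if l + 2 \<le> \<tau> y then 0 else k y"
  shows top_level_integrable: "integrable (tower_measure Y \<tau> \<mu>) g"
    and top_level_integral: "(\<integral>x. g x \<partial>tower_measure Y \<tau> \<mu>) = (1 / mean_height) *\<^sub>R (\<integral>y. k y \<partial>\<mu>)"
proof -
  have meas: "(\<lambda>y. g (y, l)) \<in> borel_measurable \<mu>" for l
    using borel_measurable_integrable[OF k] unfolding g_def by simp
  have "(\<Sum>l<\<tau> y. norm (g (y, l))) = norm (k y)" if "y \<in> Y" for y
    using sum_top_level[OF that, of "\<lambda>y. norm (k y)"] by (simp add: g_def if_distrib cong: if_cong)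
  then have int: "integrable \<mu> (\<lambda>y. \<Sum>l<\<tau> y. norm (g (y, l)))"
    using k by (subst Bochner_Integration.integrable_cong[OF refl, of _ _ "\<lambda>y. norm (k y)"]) (auto simp: space_base)
  show "integrable (tower_measure Y \<tau> \<mu>) g" by (rule tower_integrable[OF meas int])
  have "(\<integral>y. (\<Sum>l<\<tau> y. g (y, l)) \<partial>\<mu>) = (\<integral>y. k y \<partial>\<mu>)"
    using sum_top_level[of _ k] by (intro Bochner_Integration.integral_cong refl) (simp add: g_def space_base)
  then show "(\<integral>x. g x \<partial>tower_measure Y \<tau> \<mu>) = (1 / mean_height) *\<^sub>R (\<integral>y. k y \<partial>\<mu>)"
    using tower_integral[OF meas int] by simp
qed

lemma sets_tower_measure: "sets (tower_measure Y \<tau> \<mu>) = sets (restrict_space P \<Delta>)"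
  by (simp add: tower_measure_def)

lemma finite_measure_tower: "finite_measure (tower_measure Y \<tau> \<mu>)"
proof -
  have "(\<lambda>y. \<Sum>l<\<tau> y. norm (1 :: real)) = (\<lambda>y. real (\<tau> y))" by auto
  then have "integrable (tower_measure Y \<tau> \<mu>) (\<lambda>_. 1 :: real)"
    using height_integrable by (intro tower_integrable) auto
  then have "(\<integral>\<^sup>+ x. ennreal (norm (1 :: real)) \<partial>tower_measure Y \<tau> \<mu>) < \<infinity>" by (simp only: integrable_iff_bounded)
  then show ?thesis by (intro finite_measureI) auto
qed

text \<open>The ground level is a copy of the base with its measure divided by
  \<open>mean_height\<close>, so a null set of the tower meets it in a \<mu>-null set.\<close>

lemma ess_bounded_ground_level:
  assumes w: "ess_bounded (tower_measure Y \<tau> \<mu>) w"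
  shows "ess_bounded \<mu> (\<lambda>y. w (y, 0))"
proof -
  let ?M = "tower_measure Y \<tau> \<mu>"
  have emb: "(\<lambda>y. (y, 0)) \<in> measurable \<mu> ?M"
  proof -
    have "(\<lambda>y. (y, 0)) \<in> measurable \<mu> (restrict_space P \<Delta>)"
    proof (rule measurable_restrict_space2)
      show "(\<lambda>y. (y, 0)) \<in> space \<mu> \<rightarrow> \<Delta>" using height_pos by (force simp: tower_def space_base)
    qed measurable
    then show ?thesis using measurable_cong_sets[OF refl sets_tower_measure] by blast
  qed
  have "w \<in> borel_measurable ?M" using w by (simp add: ess_bounded_def)
  from measurable_compose[OF emb this] have meas: "(\<lambda>y. w (y, 0)) \<in> borel_measurable \<mu>" .
  obtain B where "AE x in ?M. \<bar>w x\<bar> \<le> B" using w by (auto simp: ess_bounded_def)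
  then obtain N where N: "{x \<in> space ?M. \<not> \<bar>w x\<bar> \<le> B} \<subseteq> N" "emeasure ?M N = 0" "N \<in> sets ?M" by (rule AE_E)
  define E where "E = (\<lambda>y. (y, 0)) -` N \<inter> space \<mu>"
  have E: "E \<in> sets \<mu>" unfolding E_def using emb N(3) by (rule measurable_sets)
  have E_\<Delta>: "E \<times> {0} \<subseteq> \<Delta>" using height_pos by (force simp: E_def tower_def space_base)
  have "E \<times> {0} \<in> sets P" using E by auto
  then have E0: "E \<times> {0} \<in> sets (restrict_space P \<Delta>)" using E_\<Delta> by (simp add: sets_restrict_space_iff)
  interpret N: sigma_finite_measure "count_space (UNIV :: nat set)"
    by (rule sigma_finite_measure_count_space_countable) simp
  have "ennreal (1 / mean_height) * emeasure \<mu> E = ennreal (1 / mean_height) * emeasure (restrict_space P \<Delta>) (E \<times> {0})"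
    using E E_\<Delta> by (simp add: emeasure_restrict_space N.emeasure_pair_measure_Times)
  also have "\<dots> = emeasure ?M (E \<times> {0})"
    unfolding tower_measure_eq using E0 by (simp add: emeasure_density nn_integral_cmult)
  also have "\<dots> \<le> emeasure ?M N" using N(3) by (intro emeasure_mono) (auto simp: E_def)
  finally have "emeasure \<mu> E = 0" using N(2) mean_height_ge_1 by (simp add: ennreal_eq_0_iff)
  moreover have "{y \<in> space \<mu>. \<not> \<bar>w (y, 0)\<bar> \<le> B} \<subseteq> E"
  proof
    fix y assume y: "y \<in> {y \<in> space \<mu>. \<not> \<bar>w (y, 0)\<bar> \<le> B}"
    then have "(y, 0) \<in> space ?M" using measurable_space[OF emb] by auto
    then show "y \<in> E" using y N(1) by (auto simp: E_def)
  qed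
  ultimately have "AE y in \<mu>. \<bar>w (y, 0)\<bar> \<le> B" using E by (intro AE_I[of _ _ E]) auto
  then show ?thesis using meas by (auto simp: ess_bounded_def)
qed

end

section \<open>Invariant measures on the base\<close>

context nonuniformly_expanding
begin

text \<open>The Radon-Nikodym derivative of \<mu> is a fixed point of \<open>Q\<close>, since
  \<open>Q\<close> pushes densities forward. Being approximable by Lipschitz functions, it has a
  version in the cone.\<close>

lemma invariant_density_exists:
  assumes ac: "ac_invariant_prob \<rho> Y F \<mu>" and bs: "branch_system M G \<alpha> \<psi> J F \<eta> \<theta> C\<^sub>1 D"
  obtains h K where "invariant_branch_system M G \<alpha> \<psi> J F \<eta> \<theta> C\<^sub>1 D h K \<mu>"
proof -
  interpret B: branch_system M G \<alpha> \<psi> J F \<eta> \<theta> C\<^sub>1 D by (rule bs)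
  interpret \<mu>: prob_space \<mu> using ac by (simp add: ac_invariant_prob_def)
  have sets_\<mu>: "sets \<mu> = sets M" and inv: "distr \<mu> \<mu> F = \<mu>" and abs: "absolutely_continuous M \<mu>"
    using ac by (auto simp: ac_invariant_prob_def)
  define f where "f = RN_deriv M \<mu>"
  have f_meas [measurable]: "f \<in> borel_measurable M" by (simp add: f_def)
  have dens: "density M f = \<mu>" unfolding f_def using abs sets_\<mu> by (rule B.density_RN_deriv)
  have f_int: "(\<integral>\<^sup>+ x. f x \<partial>M) = 1"
  proof -
    have "(\<integral>\<^sup>+ x. f x \<partial>M) = (\<integral>\<^sup>+ x. f x * indicator (space M) x \<partial>M)" by (intro nn_integral_cong) simp
    also have "\<dots> = emeasure (density M f) (space M)" by (rule emeasure_density[symmetric]) auto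
    also have "\<dots> = 1" using \<mu>.emeasure_space_1 sets_eq_imp_space_eq[OF sets_\<mu>] by (simp add: dens)
    finally show ?thesis .
  qed
  have "density M (B.Q f) = distr (density M f) M F" by (rule B.density_Q[symmetric]) simp
  also have "\<dots> = distr \<mu> \<mu> F" unfolding dens by (rule distr_cong) (simp_all add: sets_\<mu>)
  also have "\<dots> = density M f" by (simp add: inv dens)
  finally have f_inv: "AE x in M. B.Q f x = f x" by (simp add: B.density_unique_iff)
  interpret \<rho>: finite_borel_measure \<rho> by unfold_locales (rule borel)
  have f_fin: "AE x in M. f x \<noteq> \<infinity>" by (intro nn_integral_noteq_infinite) (auto simp: f_int)
  have fr_eq: "AE x in M. f x = ennreal (enn2real (f x))"
    using f_fin by (auto elim!: eventually_mono simp: less_top)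
  have Y_int: "Y \<inter> space \<rho> \<in> sets \<rho>" using Y_measurable by auto
  have fr_int: "integrable M (\<lambda>x. enn2real (f x))"
  proof (rule integrableI_nonneg)
    have "(\<integral>\<^sup>+ x. ennreal (enn2real (f x)) \<partial>M) = 1"
      unfolding f_int[symmetric] using fr_eq by (intro nn_integral_cong_AE) (auto elim: eventually_mono)
    then show "(\<integral>\<^sup>+ x. ennreal (enn2real (f x)) \<partial>M) < \<infinity>" by simp
  qed auto
  \<comment> \<open>Extension by zero: Lipschitz approximation is formulated for Borel measures on
    the whole type, and \<open>M\<close> lives on \<open>Y\<close>.\<close>
  define k where "k x = indicator Y x *\<^sub>R enn2real (f x)" for x
  have k_int: "integrable \<rho> k"
    using fr_int unfolding k_def by (simp add: integrable_restrict_space[OF Y_int])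
  have approx: "\<exists>g L. (\<forall>x y. \<bar>g x - g y\<bar> \<le> L * dist x y) \<and> (\<forall>x. 0 \<le> g x) \<and>
        g \<in> borel_measurable M \<and> B.L1_dist f (\<lambda>x. ennreal (g x)) \<le> ennreal e" if e: "e > 0" for e
  proof -
    obtain g L b where g: "\<And>x y. \<bar>g x - g y\<bar> \<le> L * dist x y" "\<And>x. \<bar>g x\<bar> \<le> b" "(\<integral>x. \<bar>k x - g x\<bar> \<partial>\<rho>) < e"
      using \<rho>.integrable_imp_lipschitz_approximable[OF k_int] e unfolding lipschitz_approximable_def by blast
    \<comment> \<open>The positive part keeps the Lipschitz bound and does not increase the distance
      to a nonnegative function.\<close>
    define g' where "g' x = max 0 (g x)" for x
    have g': "\<bar>g' x - g' y\<bar> \<le> L * dist x y" for x y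
      using g(1)[of x y] by (auto simp: g'_def)
    have g_int: "integrable \<rho> g" using \<rho>.lipschitz_integrable[OF g(1,2)] .
    then have g'_int: "integrable \<rho> g'" unfolding g'_def by auto
    have g'_meas: "g' \<in> borel_measurable M"
      using borel_measurable_integrable[OF g'_int] by (rule measurable_restrict_space1)
    have "B.L1_dist f (\<lambda>x. ennreal (g' x)) = (\<integral>\<^sup>+ x. ennreal \<bar>enn2real (f x) - g' x\<bar> \<partial>M)"
      unfolding B.L1_dist_def
    proof (rule nn_integral_cong_AE, use fr_eq in eventually_elim)
      fix x assume "f x = ennreal (enn2real (f x))"
      then obtain r where r: "f x = ennreal r" "0 \<le> r" by (metis enn2real_nonneg)
      have "0 \<le> g' x" by (simp add: g'_def)
      then show "f x - ennreal (g' x) + (ennreal (g' x) - f x) = ennreal \<bar>enn2real (f x) - g' x\<bar>"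
        using r by (cases "r \<le> g' x") (auto simp: ennreal_minus ennreal_neg)
    qed
    also have "\<dots> = (\<integral>\<^sup>+ x. ennreal \<bar>enn2real (f x) - g' x\<bar> * indicator Y x \<partial>\<rho>)"
      by (rule nn_integral_restrict_space[OF Y_int])
    also have "\<dots> \<le> (\<integral>\<^sup>+ x. ennreal \<bar>k x - g x\<bar> \<partial>\<rho>)"
    proof (rule nn_integral_mono)
      fix x
      have "\<bar>r - max 0 s\<bar> \<le> \<bar>r - s\<bar>" if "0 \<le> r" for r s :: real using that by (auto simp: max_def)
      then have "\<bar>enn2real (f x) - g' x\<bar> \<le> \<bar>enn2real (f x) - g x\<bar>" by (simp add: g'_def)
      then show "ennreal \<bar>enn2real (f x) - g' x\<bar> * indicator Y x \<le> ennreal \<bar>k x - g x\<bar>"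
        by (auto simp: k_def intro!: ennreal_leI split: split_indicator)
    qed
    also have "\<dots> = ennreal (\<integral>x. \<bar>k x - g x\<bar> \<partial>\<rho>)"
      using k_int g_int by (intro nn_integral_eq_integral) auto
    also have "\<dots> \<le> ennreal e" using g(3) by (intro ennreal_leI) simp
    finally show ?thesis using g' g'_meas by (intro exI[of _ g'] exI[of _ L]) (auto simp: g'_def)
  qed
  obtain h where h: "h \<in> borel_measurable M" "B.hcone B.K\<^sub>0 h" "AE x in M. f x = h x"
    using B.invariant_density_hcone[OF f_meas f_int f_inv approx] by blast
  have "invariant_branch_system M G \<alpha> \<psi> J F \<eta> \<theta> C\<^sub>1 D h B.K\<^sub>0 \<mu>"
  proof (rule invariant_branch_system.intro[OF bs], rule invariant_branch_system_axioms.intro)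
    show "0 \<le> B.K\<^sub>0" using B.K\<^sub>0_ge_1 by simp
    show "(\<integral>\<^sup>+ x. h x \<partial>M) = 1"
      unfolding f_int[symmetric] using h(3) by (intro nn_integral_cong_AE) (auto elim: eventually_mono)
    show "\<mu> = density M h" unfolding dens[symmetric] using h by (intro density_cong) auto
  qed (use h in auto)
  then show thesis by (rule that)
qed

end

section \<open>The martingale-coboundary decomposition\<close>

context nonuniformly_expanding
begin

lemma induced_obs_measurable:
  assumes v: "v \<in> borel_measurable borel"
  shows "induced_obs \<tau> (v \<circ> tower_proj T) \<in> borel_measurable M"
proof (rule measurable_piecewise)
  fix a assume "a \<in> \<alpha>"
  then obtain n where n: "\<forall>y\<in>a. \<tau> y = n" using \<tau>_eq by blast
  have [measurable]: "v \<in> borel_measurable \<rho>"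
    by (subst measurable_cong_sets[OF borel refl]) (rule v)
  have "(\<lambda>y. \<Sum>l<n. v ((T ^^ l) y)) \<in> borel_measurable \<rho>" by measurable
  then show "\<exists>g\<in>borel_measurable \<rho>. \<forall>y\<in>a. induced_obs \<tau> (v \<circ> tower_proj T) y = g y"
    using n by (intro bexI[of _ "\<lambda>y. \<Sum>l<n. v ((T ^^ l) y)"]) (auto simp: induced_obs_def tower_proj_def)
qed

text \<open>Each of the \<tau> summands varies by at most
  \<open>A * (C\<^sub>0 * dist x y) powr \<eta>\<close>, because \<open>intermediate\<close>
  controls distances along the orbit by the distance after the return, and
  \<open>\<psi> a x\<close>, \<open>\<psi> a y\<close> return to \<open>x\<close>, \<open>y\<close>.
  This is the origin of \<open>A * C\<^sub>0 powr \<eta>\<close>.\<close>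

lemma branch_observable_exists:
  fixes v :: "'a \<Rightarrow> 'b::euclidean_space"
  assumes ac: "ac_invariant_prob \<rho> Y F \<mu>" and \<tau>: "integrable \<mu> (\<lambda>y. real (\<tau> y))"
    and v_bound: "\<And>x. norm (v x) \<le> A" and v_hoelder: "\<And>x y. norm (v x - v y) \<le> A * dist x y powr \<eta>"
    and mean: "(\<integral>y. induced_obs \<tau> (v \<circ> tower_proj T) y \<partial>\<mu>) = 0"
  obtains \<theta> D h K where "branch_observable M G \<alpha> \<psi> J F \<eta> \<theta> C\<^sub>1 D h K \<mu> \<tau>
    (induced_obs \<tau> (v \<circ> tower_proj T)) A (A * C\<^sub>0 powr \<eta>)"
proof -
  let ?\<Phi> = "induced_obs \<tau> (v \<circ> tower_proj T)"
  obtain \<theta> D where bs: "branch_system M G \<alpha> \<psi> J F \<eta> \<theta> C\<^sub>1 D" by (rule branch_system_exists)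
  obtain h K where inv: "invariant_branch_system M G \<alpha> \<psi> J F \<eta> \<theta> C\<^sub>1 D h K \<mu>"
    by (rule invariant_density_exists[OF ac bs])
  have A: "0 \<le> A" using order_trans[OF norm_ge_zero v_bound] .
  have v_meas: "v \<in> borel_measurable borel"
    by (intro borel_measurable_continuous_onI hoelder_continuous_on[OF _ \<eta>_range(1), of _ _ A] v_hoelder)
  have "branch_observable M G \<alpha> \<psi> J F \<eta> \<theta> C\<^sub>1 D h K \<mu> \<tau> ?\<Phi> A (A * C\<^sub>0 powr \<eta>)"
  proof (rule branch_observable.intro[OF inv], rule branch_observable_axioms.intro)
    show "distr \<mu> \<mu> F = \<mu>" using ac by (simp add: ac_invariant_prob_def)
    show "?\<Phi> \<in> borel_measurable M" using v_meas by (rule induced_obs_measurable)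
    show "0 \<le> A" "0 \<le> A * C\<^sub>0 powr \<eta>" using A by auto
  next
    fix x and b :: 'b assume b: "b \<in> Basis"
    have "\<bar>?\<Phi> x \<bullet> b\<bar> \<le> norm (?\<Phi> x)" using b by (rule Basis_le_norm)
    also have "\<dots> \<le> (\<Sum>l<\<tau> x. norm (v ((T ^^ l) x)))"
      by (simp add: induced_obs_def tower_proj_def norm_sum)
    also have "\<dots> \<le> of_nat (card {..<\<tau> x}) * A" by (rule sum_bounded_above) (rule v_bound)
    finally show "\<bar>?\<Phi> x \<bullet> b\<bar> \<le> A * \<tau> x" by (simp add: mult.commute)
  next
    fix a x y assume a: "a \<in> \<alpha>" and xy: "x \<in> G" "y \<in> G"
    note in_a = \<psi>_in[OF a xy(1)] \<psi>_in[OF a xy(2)]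
    show \<tau>_eq: "\<tau> (\<psi> a x) = \<tau> (\<psi> a y)" by (rule \<tau>_const[OF a in_a])
    fix b :: 'b assume b: "b \<in> Basis"
    let ?x = "\<psi> a x" and ?y = "\<psi> a y"
    have "\<bar>?\<Phi> ?x \<bullet> b - ?\<Phi> ?y \<bullet> b\<bar> = \<bar>(?\<Phi> ?x - ?\<Phi> ?y) \<bullet> b\<bar>" by (simp only: inner_diff_left)
    also have "\<dots> \<le> norm (?\<Phi> ?x - ?\<Phi> ?y)" using b by (rule Basis_le_norm)
    also have "?\<Phi> ?x - ?\<Phi> ?y = (\<Sum>l<\<tau> ?x. v ((T ^^ l) ?x) - v ((T ^^ l) ?y))"
      by (simp only: induced_obs_def tower_proj_def comp_def prod.case \<tau>_eq sum_subtractf)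
    also have "norm \<dots> \<le> (\<Sum>l<\<tau> ?x. norm (v ((T ^^ l) ?x) - v ((T ^^ l) ?y)))" by (rule norm_sum)
    also have "\<dots> \<le> of_nat (card {..<\<tau> ?x}) * (A * C\<^sub>0 powr \<eta> * dist x y powr \<eta>)"
    proof (rule sum_bounded_above)
      fix l assume "l \<in> {..<\<tau> ?x}"
      then have "dist ((T ^^ l) ?x) ((T ^^ l) ?y) \<le> C\<^sub>0 * dist x y"
        using intermediate[OF a in_a, of l] unfolding F_\<psi>_G[OF a xy(1)] F_\<psi>_G[OF a xy(2)] by simp
      then have "dist ((T ^^ l) ?x) ((T ^^ l) ?y) powr \<eta> \<le> (C\<^sub>0 * dist x y) powr \<eta>"
        using \<eta>_range by (intro powr_mono2) auto
      also have "\<dots> = C\<^sub>0 powr \<eta> * dist x y powr \<eta>" by (rule powr_mult)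
      finally have "A * dist ((T ^^ l) ?x) ((T ^^ l) ?y) powr \<eta> \<le> A * (C\<^sub>0 powr \<eta> * dist x y powr \<eta>)"
        using A by (rule mult_left_mono)
      with v_hoelder[of "(T ^^ l) ?x" "(T ^^ l) ?y"]
      show "norm (v ((T ^^ l) ?x) - v ((T ^^ l) ?y)) \<le> A * C\<^sub>0 powr \<eta> * dist x y powr \<eta>"
        by (simp only: mult.assoc)
    qed
    finally show "\<bar>?\<Phi> ?x \<bullet> b - ?\<Phi> ?y \<bullet> b\<bar> \<le> A * C\<^sub>0 powr \<eta> * \<tau> ?x * dist x y powr \<eta>"
      by (simp only: card_lessThan mult_ac)
  qed (fact \<tau> mean)+
  then show thesis by (rule that)
qed

lemma base_m_dual:
  fixes v :: "'a \<Rightarrow> 'b::euclidean_space"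
  assumes ac: "ac_invariant_prob \<rho> Y F \<mu>" and \<tau>: "integrable \<mu> (\<lambda>y. real (\<tau> y))"
    and v: "\<And>x. norm (v x) \<le> A" "\<And>x y. norm (v x - v y) \<le> A * dist x y powr \<eta>"
    and mean: "(\<integral>y. induced_obs \<tau> (v \<circ> tower_proj T) y \<partial>\<mu>) = 0"
  shows base_m_integrable: "integrable \<mu> (base_m T Y \<tau> \<eta> \<mu> (v \<circ> tower_proj T))"
    and base_m_kernel: "ess_bounded \<mu> w \<Longrightarrow>
      (\<integral>y. w (F y) *\<^sub>R base_m T Y \<tau> \<eta> \<mu> (v \<circ> tower_proj T) y \<partial>\<mu>) = 0"
proof -
  obtain \<theta> D h K where "branch_observable M G \<alpha> \<psi> J F \<eta> \<theta> C\<^sub>1 D h K \<mu> \<tau>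
    (induced_obs \<tau> (v \<circ> tower_proj T)) A (A * C\<^sub>0 powr \<eta>)"
    by (rule branch_observable_exists[OF ac \<tau> v mean])
  then interpret O: branch_observable M G \<alpha> \<psi> J F \<eta> \<theta> C\<^sub>1 D h K \<mu> \<tau>
    "induced_obs \<tau> (v \<circ> tower_proj T)" A "A * C\<^sub>0 powr \<eta>" .
  have "\<exists>X. holder_sums \<mu> \<eta> Y (\<lambda>k. (transfer \<mu> F ^^ Suc k) (induced_obs \<tau> (v \<circ> tower_proj T))) X"
    by (rule O.holder_sums_transfer)
  \<comment> \<open>Existence of some sum makes the choice in \<open>base_chi\<close> a sum; which
    one is chosen does not matter below.\<close>
  then have hs: "holder_sums \<mu> \<eta> Y (\<lambda>k. (transfer \<mu> F ^^ Suc k) (induced_obs \<tau> (v \<circ> tower_proj T)))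
      (base_chi T Y \<tau> \<eta> \<mu> (v \<circ> tower_proj T))"
    unfolding base_chi_def by (rule someI_ex)
  have sets: "sets \<mu> = sets (restrict_space borel Y)"
    unfolding O.sets_\<mu> by (rule sets_restrict_space_cong) (rule borel)
  have m: "base_m T Y \<tau> \<eta> \<mu> (v \<circ> tower_proj T) = (\<lambda>y. induced_obs \<tau> (v \<circ> tower_proj T) y -
      base_chi T Y \<tau> \<eta> \<mu> (v \<circ> tower_proj T) (F y) + base_chi T Y \<tau> \<eta> \<mu> (v \<circ> tower_proj T) y)"
    by (simp add: base_m_def fun_eq_iff)
  note dual = martingale_coboundary_dual[OF O.finite_measure_\<mu> sets \<eta>_range(1) O.F_measurable_\<mu> O.inv
      conjunct1[OF O.transfer_p] O.transfer_dual_p hs]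
  show "integrable \<mu> (base_m T Y \<tau> \<eta> \<mu> (v \<circ> tower_proj T))" unfolding m by (rule dual(1))
  show "ess_bounded \<mu> w \<Longrightarrow> (\<integral>y. w (F y) *\<^sub>R base_m T Y \<tau> \<eta> \<mu> (v \<circ> tower_proj T) y \<partial>\<mu>) = 0"
    unfolding m by (rule dual(2))
qed

end

lemma tower_coboundary:
  assumes "x \<in> tower Y \<tau>"
  shows "\<phi> x = tower_m T Y \<tau> \<eta> \<mu> \<phi> x + tower_chi T Y \<tau> \<eta> \<mu> \<phi> (tower_map T \<tau> x) - tower_chi T Y \<tau> \<eta> \<mu> \<phi> x"
proof (cases x)
  case (Pair y l)
  show ?thesis
  proof (cases "l + 2 \<le> \<tau> y")
    case True
    then show ?thesis by (simp add: Pair tower_m_def tower_chi_def tower_map_def)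
  next
    case False
    \<comment> \<open>On the top level the partial sum in \<open>tower_chi\<close> lacks exactly the
      term \<open>\<phi> (y, l)\<close> of the full sum in \<open>base_m\<close>, and
      \<open>tower_map\<close> returns to level 0, where the partial sum is empty.\<close>
    then have "\<tau> y = Suc l" using assms Pair by (auto simp: tower_def)
    then show ?thesis
      by (simp add: Pair tower_m_def tower_chi_def tower_map_def base_m_def induced_obs_def)
  qed
qed

text \<open>\<open>tower_m\<close> lives on the top level, from where \<open>tower_map\<close> leads
  to \<open>(F y, 0)\<close>. So testing it against \<open>w\<close> after \<open>tower_map\<close>
  amounts to testing \<open>base_m\<close> against the ground-level part of \<open>w\<close>
  composed with \<open>F\<close>, which gives 0. Hence the zero function satisfies the duality
  relation and represents the transfer.\<close>

lemma (in nonuniformly_expanding) tower_m_kernel: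
  fixes v :: "'a \<Rightarrow> 'b::euclidean_space"
  assumes ac: "ac_invariant_prob \<rho> Y F \<mu>" and p: "p \<ge> 1" and \<tau>p: "integrable \<mu> (\<lambda>y. real (\<tau> y) powr p)"
    and v: "holder_norm \<eta> UNIV v < \<infinity>"
    and mean: "(\<integral>x. v x \<partial>distr (tower_measure Y \<tau> \<mu>) borel (tower_proj T)) = 0"
  shows "in_transfer_kernel (tower_measure Y \<tau> \<mu>) (tower_map T \<tau>) (tower_m T Y \<tau> \<eta> \<mu> (v \<circ> tower_proj T))"
proof -
  let ?\<phi> = "v \<circ> tower_proj T" and ?\<Delta> = "tower_measure Y \<tau> \<mu>"
  have sets_\<mu>: "sets \<mu> = sets M" using ac by (simp add: ac_invariant_prob_def)
  have space_\<mu>: "space \<mu> = Y" using sets_eq_imp_space_eq[OF sets_\<mu>] by (simp add: space_M)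
  note meas_\<mu> = measurable_cong_sets[OF sets_\<mu> refl]
  have \<tau>_real: "(\<lambda>y. real (\<tau> y)) \<in> borel_measurable \<mu>"
    by (subst meas_\<mu>) (rule borel_measurable_integrable[OF \<tau>_integrable])
  \<comment> \<open>The locale provides integrability with respect to \<rho> only; for \<mu> it
    comes from \<open>\<tau> \<le> \<tau> powr p\<close>, as \<tau> and \<open>p\<close> are at
    least 1.\<close>
  have \<tau>_int: "integrable \<mu> (\<lambda>y. real (\<tau> y))"
  proof (rule Bochner_Integration.integrable_bound[OF \<tau>p \<tau>_real AE_I2])
    fix y assume "y \<in> space \<mu>"
    then have "1 \<le> real (\<tau> y)" using \<tau>_ge_1 by (auto simp: space_\<mu>)
    then have "real (\<tau> y) powr 1 \<le> real (\<tau> y) powr p" using p by (intro powr_mono) auto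
    then show "norm (real (\<tau> y)) \<le> norm (real (\<tau> y) powr p)" by simp
  qed
  have "\<tau> \<in> measurable \<mu> (count_space UNIV)"
  proof (subst measurable_count_space_eq2_countable, safe)
    fix n
    have "\<tau> -` {n} \<inter> space \<mu> = (\<lambda>y. real (\<tau> y)) -` {real n} \<inter> space \<mu>" by auto
    also have "\<dots> \<in> sets \<mu>" using \<tau>_real by (rule measurable_sets) simp
    finally show "\<tau> -` {n} \<inter> space \<mu> \<in> sets \<mu>" .
  qed auto
  then interpret tower_base \<mu> Y \<tau>
    using ac space_\<mu> \<tau>_ge_1 \<tau>_int
    by (intro tower_base.intro tower_base_axioms.intro) (auto simp: ac_invariant_prob_def)
  obtain A where A: "holder_norm \<eta> UNIV v = ennreal A" "0 \<le> A" using v by (cases "holder_norm \<eta> UNIV v") auto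
  have v_bound: "norm (v x) \<le> A" and v_hoelder: "norm (v x - v y) \<le> A * dist x y powr \<eta>" for x y
    using holder_norm_bound[of \<eta> UNIV v A] holder_norm_hoelder[of \<eta> UNIV v A] A by auto
  have v_meas: "v \<in> borel_measurable borel"
    by (intro borel_measurable_continuous_onI hoelder_continuous_on[OF _ \<eta>_range(1), of _ _ A] v_hoelder)
  have T_pow_\<mu>: "T ^^ l \<in> measurable \<mu> borel" for l
  proof -
    have "T ^^ l \<in> measurable M \<rho>" by (intro measurable_restrict_space1 T_pow_measurable)
    then show ?thesis using measurable_cong_sets[OF sets_\<mu> borel[symmetric]] by blast
  qed
  have proj_P: "tower_proj T \<in> measurable P borel"
    by (rule measurable_product) (use T_pow_\<mu> in \<open>simp add: tower_proj_def\<close>)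
  have proj: "tower_proj T \<in> measurable ?\<Delta> borel"
    using measurable_restrict_space1[OF proj_P, of \<Delta>] measurable_cong_sets[OF sets_tower_measure refl] by blast
  have \<phi>_meas: "(\<lambda>y. ?\<phi> (y, l)) \<in> borel_measurable \<mu>" for l
    using measurable_compose[OF T_pow_\<mu> v_meas] by (simp add: tower_proj_def)
  have "integrable \<mu> (\<lambda>y. \<Sum>l<\<tau> y. norm (?\<phi> (y, l)))"
  proof (rule Bochner_Integration.integrable_bound[of \<mu> "\<lambda>y. real (\<tau> y) * A"])
    have "(\<lambda>y. \<Sum>l<n. norm (?\<phi> (y, l))) \<in> borel_measurable \<mu>" for n using \<phi>_meas by measurable
    then show "(\<lambda>y. \<Sum>l<\<tau> y. norm (?\<phi> (y, l))) \<in> borel_measurable \<mu>"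
      by (rule measurable_compose_countable'[where f="\<lambda>n y. \<Sum>l<n. norm (?\<phi> (y, l))" and g=\<tau> and I=UNIV])
        (auto simp: height_measurable)
    show "AE y in \<mu>. norm (\<Sum>l<\<tau> y. norm (?\<phi> (y, l))) \<le> norm (real (\<tau> y) * A)"
    proof (rule AE_I2)
      fix y
      have "(\<Sum>l<\<tau> y. norm (?\<phi> (y, l))) \<le> of_nat (card {..<\<tau> y}) * A"
        by (rule sum_bounded_above) (use v_bound in auto)
      then show "norm (\<Sum>l<\<tau> y. norm (?\<phi> (y, l))) \<le> norm (real (\<tau> y) * A)"
        using A(2) by (simp add: sum_nonneg)
    qed
  qed (use \<tau>_int in auto)
  \<comment> \<open>The mean of \<open>v\<close> is the mean of \<open>?\<phi>\<close> over the
    tower; summed over the levels it is a positive multiple of the mean of the induced observable,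
    which therefore vanishes too.\<close>
  from tower_integral[OF \<phi>_meas this]
  have "(\<integral>x. ?\<phi> x \<partial>?\<Delta>) = (1 / mean_height) *\<^sub>R (\<integral>y. induced_obs \<tau> ?\<phi> y \<partial>\<mu>)"
    by (simp add: induced_obs_def)
  moreover have "(\<integral>x. ?\<phi> x \<partial>?\<Delta>) = 0"
    using mean integral_distr[OF proj v_meas] by simp
  ultimately have base_mean: "(\<integral>y. induced_obs \<tau> ?\<phi> y \<partial>\<mu>) = 0" using mean_height_ge_1 by simp
  let ?m = "base_m T Y \<tau> \<eta> \<mu> ?\<phi>"
  have m_int: "integrable \<mu> ?m" by (rule base_m_integrable[OF ac \<tau>_int v_bound v_hoelder base_mean])
  have dual: "(\<integral>x. w x *\<^sub>R (0 :: 'b) \<partial>?\<Delta>) = (\<integral>x. w (tower_map T \<tau> x) *\<^sub>R tower_m T Y \<tau> \<eta> \<mu> ?\<phi> x \<partial>?\<Delta>)"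
    if w: "ess_bounded ?\<Delta> w" for w
  proof -
    let ?w = "\<lambda>y. w (y, 0)"
    have w0: "ess_bounded \<mu> ?w" using w by (rule ess_bounded_ground_level)
    let ?k = "\<lambda>y. ?w (F y) *\<^sub>R ?m y"
    have inv: "distr \<mu> \<mu> F = \<mu>" using ac by (simp add: ac_invariant_prob_def)
    have F_\<mu>: "F \<in> measurable \<mu> \<mu>" using F_measurable measurable_cong_sets[OF sets_\<mu> sets_\<mu>] by blast
    have k_int: "integrable \<mu> ?k"
      using ess_bounded_scaleR_integrable[OF ess_bounded_comp[OF F_\<mu> inv w0] m_int] .
    have "(\<integral>x. w (tower_map T \<tau> x) *\<^sub>R tower_m T Y \<tau> \<eta> \<mu> ?\<phi> x \<partial>?\<Delta>) =
        (\<integral>x. (case x of (y, l) \<Rightarrow> if l + 2 \<le> \<tau> y then 0 else ?k y) \<partial>?\<Delta>)"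
      by (intro Bochner_Integration.integral_cong refl) (auto simp: tower_m_def tower_map_def)
    also have "\<dots> = (1 / mean_height) *\<^sub>R (\<integral>y. ?k y \<partial>\<mu>)" by (rule top_level_integral[OF k_int])
    also have "(\<integral>y. ?k y \<partial>\<mu>) = 0" by (rule base_m_kernel[OF ac \<tau>_int v_bound v_hoelder base_mean w0])
    finally have eq: "(\<integral>x. w (tower_map T \<tau> x) *\<^sub>R tower_m T Y \<tau> \<eta> \<mu> ?\<phi> x \<partial>?\<Delta>) = (1 / mean_height) *\<^sub>R 0" .
    show ?thesis unfolding eq by simp
  qed
  have "AE x in ?\<Delta>. transfer ?\<Delta> (tower_map T \<tau>) (tower_m T Y \<tau> \<eta> \<mu> ?\<phi>) x = 0"
    by (rule AE_transfer[OF finite_measure_tower _ dual]) auto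
  moreover have "integrable ?\<Delta> (tower_m T Y \<tau> \<eta> \<mu> ?\<phi>)"
    unfolding tower_m_def by (rule top_level_integrable[OF m_int])
  ultimately show ?thesis by (simp add: in_transfer_kernel_def)
qed

theorem proposition2p5:
  fixes \<rho> \<mu>Y :: "'a::metric_space measure"
    and T :: "'a \<Rightarrow> 'a" and Y :: "'a set" and \<alpha> :: "'a set set" and \<tau> :: "'a \<Rightarrow> nat"
    and lam \<eta> C\<^sub>0 C\<^sub>1 p :: real and \<zeta>\<^sub>0 :: "'a \<Rightarrow> real"
    and v :: "'a \<Rightarrow> real ^ 'd"
    and \<phi> chi m :: "'a \<times> nat \<Rightarrow> real ^ 'd"
    and f :: "'a \<times> nat \<Rightarrow> 'a \<times> nat" and \<mu>\<Delta> :: "('a \<times> nat) measure"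
  assumes "nonuniformly_expanding \<rho> T Y \<alpha> \<tau> lam \<eta> C\<^sub>0 C\<^sub>1 \<zeta>\<^sub>0"
    and "ac_invariant_prob \<rho> Y (return_map T \<tau>) \<mu>Y"
    and "p \<ge> 1" and "integrable \<mu>Y (\<lambda>y. real (\<tau> y) powr p)"
  defines "f \<equiv> tower_map T \<tau>"
    and "\<mu>\<Delta> \<equiv> tower_measure Y \<tau> \<mu>Y"
  assumes "holder_norm \<eta> UNIV v < \<infinity>"
    and "(\<integral>x. v x \<partial>distr \<mu>\<Delta> borel (tower_proj T)) = 0"
  defines "\<phi> \<equiv> v \<circ> tower_proj T"
    and "chi \<equiv> tower_chi T Y \<tau> \<eta> \<mu>Y \<phi>"
    and "m \<equiv> tower_m T Y \<tau> \<eta> \<mu>Y \<phi>"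
  shows "(\<forall>x\<in>tower Y \<tau>. \<phi> x = m x + chi (f x) - chi x) \<and> in_transfer_kernel \<mu>\<Delta> f m"
proof
  show "\<forall>x\<in>tower Y \<tau>. \<phi> x = m x + chi (f x) - chi x"
    unfolding m_def chi_def f_def by (intro ballI tower_coboundary)
  show "in_transfer_kernel \<mu>\<Delta> f m"
    using nonuniformly_expanding.tower_m_kernel[OF assms(1-4,7)] assms(8)
    unfolding m_def \<phi>_def f_def \<mu>\<Delta>_def by simp
qed

end
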